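(* Fix an integer $d\geq 3$ and write $\lambda(\xi)=\lambda(d,\xi)$ for the set-to-set distance exponent of $d$-dimensional Liouville first passage percolation. The function $\xi\mapsto\lambda(\xi)$ is $\sqrt{2d}$-Lipschitz on $[0,\infty)$, and thus its derivative $\lambda'(\xi)$ exists for Lebesgue-a.e. $\xi$. Moreover, for Lebesgue-a.e. $\xi\geq0$, $$\max\left\{-\xi,\ \frac{1}{\xi}(\lambda(\xi)-1)\right\}\leq\lambda'(\xi)\leq\sqrt{2(d-1)+2\lambda(\xi)+\xi^2}-\xi.$$
   Context: Log-correlated field. For $d\ge 2$, let $h$ be the whole-space log-correlated Gaussian field (LGF) on $\mathbb{R}^d$: the centered Gaussian random generalized function, a priori defined modulo additive constant, with $\mathrm{Cov}[(h,f_1),(h,f_2)] = \int_{\mathbb{R}^d\times\mathbb{R}^d} f_1(x)f_2(y)\log\frac{1}{|x-y|}\,dx\,dy$ for Schwartz functions $f_1,f_2$ with average $0$. The additive constant is fixed by requiring the average of $h$ over the unit sphere to be $0$. Equivalently, with $\sigma$ the uniform probability measure on the unit sphere, for a suitable probability measure $\mu$ (one with finite logarithmic energy) the variable $(h,\mu)$ is interpreted as $(h,\mu-\sigma)$, where the covariance formula above extends to signed measures of total mass $0$ with finite logarithmic energy. Mollification. For $\epsilon>0$ and $x\in\mathbb{R}^d$, $h_\epsilon(x)$ is the average of $h$ over the box $x+[-\epsilon,\epsilon]^d$. LFPP. For $\xi\ge 0$ and a discrete (nearest-neighbor) path $P:\{1,\dots,N\}\to\epsilon\mathbb{Z}^d$,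 set $L_h^{\epsilon,\xi}(P) := \sum_{i=1}^N \epsilon\, e^{\xi h_\epsilon(P(i))}$. For $A\subset\epsilon\mathbb{Z}^d$ and $z,w\in A$, let $D_h^{\epsilon,\xi}(z,w;A)$ be the infimum of $L_h^{\epsilon,\xi}(P)$ over discrete paths $P$ from $z$ to $w$ staying in $A$; for sets $U,V\subset A$, $D_h^{\epsilon,\xi}(U,V;A)$ is the infimum over $z\in U$, $w\in V$. Distance exponent. Let $S^\epsilon=[0,1]^d\cap\epsilon\mathbb{Z}^d$, $\partial_L S^\epsilon = (\{0\}\times[0,1]^{d-1})\cap\epsilon\mathbb{Z}^d$, $\partial_R S^\epsilon = (\{1\}\times[0,1]^{d-1})\cap\epsilon\mathbb{Z}^d$. Define $$\lambda(d,\xi) := \sup\left\{\alpha\in\mathbb{R} : \liminf_{\epsilon\to0}\mathbb{P}\left[D_h^{\epsilon,\xi}(\partial_L S^\epsilon,\partial_R S^\epsilon;S^\epsilon)\leq\epsilon^\alpha\right]=1\right\},$$ where $\epsilon\to0$ along values with $\epsilon^{-1}\in\mathbb{N}$. *)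

theory Defs
  imports "HOL-Probability.Probability"
begin

section \<open>Schwartz functions\<close>

text \<open>\<^term>\<open>partials vs f\<close> is the iterated directional derivative of \<^term>\<open>f\<close> along the
  vectors in \<^term>\<open>vs\<close>; lists of basis vectors play the role of multi-indices.\<close>

primrec partials :: "'a::euclidean_space list \<Rightarrow> ('a \<Rightarrow> real) \<Rightarrow> 'a \<Rightarrow> real" where
  "partials [] f = f"
| "partials (v # vs) f = (\<lambda>x. frechet_derivative (partials vs f) (at x) v)"

definition schwartz :: "('a::euclidean_space \<Rightarrow> real) \<Rightarrow> bool" where
  "schwartz f \<longleftrightarrow>
     (\<forall>vs. set vs \<subseteq> Basis \<longrightarrow>
        (\<forall>x. partials vs f differentiable (at x)) \<and>
        (\<forall>N::nat. bounded (range (\<lambda>x. (1 + norm x) ^ N * partials vs f x))))"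

definition schwartz0 :: "('a::euclidean_space \<Rightarrow> real) set" where
  "schwartz0 = {f. schwartz f \<and> integral\<^sup>L lborel f = 0}"

definition schwartz_norm :: "nat \<Rightarrow> ('a::euclidean_space \<Rightarrow> real) \<Rightarrow> real" where
  "schwartz_norm N f =
     Sup {(1 + norm x) ^ N * \<bar>partials vs f x\<bar> |x vs. set vs \<subseteq> Basis \<and> length vs \<le> N}"

text \<open>Continuity of a linear functional for the Schwartz topology means that it is bounded by one
  of the increasing norms \<^term>\<open>schwartz_norm N\<close>.\<close>

definition tempered_mod_const :: "(('a::euclidean_space \<Rightarrow> real) \<Rightarrow> real) \<Rightarrow> bool" where
  "tempered_mod_const T \<longleftrightarrow>
     (\<forall>f\<in>schwartz0. \<forall>g\<in>schwartz0. \<forall>a b. T (\<lambda>x. a * f x + b * g x) = a * T f + b * T g) \<and>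
     (\<exists>C N. \<forall>f\<in>schwartz0. \<bar>T f\<bar> \<le> C * schwartz_norm N f)"


section \<open>Signed measures of total mass zero with finite logarithmic energy\<close>

text \<open>A signed measure is represented by a pair of finite Borel measures, of which it is the
  difference. Since \<^prop>\<open>ln (0::real) = 0\<close>, the value infinity on the diagonal is put into
  the kernel explicitly; it excludes measures with atoms.\<close>

definition abs_log_energy :: "'a::euclidean_space measure \<Rightarrow> 'a measure \<Rightarrow> ennreal" where
  "abs_log_energy \<mu> \<nu> =
     (\<integral>\<^sup>+x. (\<integral>\<^sup>+y. (if x = y then \<infinity> else ennreal \<bar>ln (norm (x - y))\<bar>) \<partial>\<nu>) \<partial>\<mu>)"

definition neutral_charges :: "('a::euclidean_space measure \<times> 'a measure) set" where
  "neutral_charges =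
     {(\<mu>, \<nu>). sets \<mu> = sets borel \<and> sets \<nu> = sets borel \<and>
        finite_measure \<mu> \<and> finite_measure \<nu> \<and> measure \<mu> UNIV = measure \<nu> UNIV \<and>
        (\<forall>\<rho>1\<in>{\<mu>, \<nu>}. \<forall>\<rho>2\<in>{\<mu>, \<nu>}. abs_log_energy \<rho>1 \<rho>2 < \<infinity>)}"

text \<open>The pair of the densities of the positive and the negative part of \<^term>\<open>f\<close>
  (\<^const>\<open>ennreal\<close> truncates negative values to zero).\<close>

definition function_charge :: "('a::euclidean_space \<Rightarrow> real) \<Rightarrow> 'a measure \<times> 'a measure" where
  "function_charge f =
     (density lborel (\<lambda>x. ennreal (f x)), density lborel (\<lambda>x. ennreal (- f x)))"

definition log_form :: "'a::euclidean_space measure \<Rightarrow> 'a measure \<Rightarrow> real" where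
  "log_form \<mu> \<nu> = (\<integral>x. (\<integral>y. ln (1 / norm (x - y)) \<partial>\<nu>) \<partial>\<mu>)"

definition log_cov ::
  "'a::euclidean_space measure \<times> 'a measure \<Rightarrow> 'a measure \<times> 'a measure \<Rightarrow> real" where
  "log_cov p q =
     log_form (fst p) (fst q) - log_form (fst p) (snd q)
     - log_form (snd p) (fst q) + log_form (snd p) (snd q)"


section \<open>The log-correlated Gaussian field\<close>

definition centered_gaussian :: "'w measure \<Rightarrow> ('w \<Rightarrow> real) \<Rightarrow> bool" where
  "centered_gaussian M X \<longleftrightarrow>
     X \<in> borel_measurable M \<and>
     ((AE \<omega> in M. X \<omega> = 0) \<or> (\<exists>s>0. distributed M lborel X (normal_density 0 s)))"

definition centered_gaussian_process ::
  "'w measure \<Rightarrow> 'i set \<Rightarrow> ('w \<Rightarrow> 'i \<Rightarrow> real) \<Rightarrow> bool" where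
  "centered_gaussian_process M I X \<longleftrightarrow>
     (\<forall>J c. finite J \<and> J \<subseteq> I \<longrightarrow> centered_gaussian M (\<lambda>\<omega>. \<Sum>j\<in>J. c j * X \<omega> j))"

text \<open>The field modulo additive constant, paired with mean-zero Schwartz functions and, by the same
  covariance formula, with all signed measures of mass zero and finite logarithmic energy.\<close>

definition log_correlated_field ::
  "'w measure \<Rightarrow> ('w \<Rightarrow> 'a::euclidean_space measure \<times> 'a measure \<Rightarrow> real) \<Rightarrow> bool" where
  "log_correlated_field M h \<longleftrightarrow>
     prob_space M \<and>
     centered_gaussian_process M neutral_charges h \<and>
     (\<forall>p\<in>neutral_charges. \<forall>q\<in>neutral_charges. (\<integral>\<omega>. h \<omega> p * h \<omega> q \<partial>M) = log_cov p q) \<and>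
     (AE \<omega> in M. tempered_mod_const (\<lambda>f. h \<omega> (function_charge f)))"

text \<open>The uniform distribution on the unit sphere is that of \<open>x / norm x\<close> for \<open>x\<close> uniform on the
  unit ball.\<close>

definition sphere_measure :: "'a::euclidean_space measure" where
  "sphere_measure = distr (uniform_measure lborel (ball 0 1)) borel sgn"

text \<open>Pairing of a probability measure with the field whose additive constant is fixed by giving
  it average zero over the unit sphere.\<close>

definition pairing ::
  "('a::euclidean_space measure \<times> 'a measure \<Rightarrow> real) \<Rightarrow> 'a measure \<Rightarrow> real" where
  "pairing h \<mu> = h (\<mu>, sphere_measure)"

definition box_average ::
  "((real^'n) measure \<times> (real^'n) measure \<Rightarrow> real) \<Rightarrow> real \<Rightarrow> real^'n \<Rightarrow> real" where
  "box_average h \<epsilon> x = pairing h (uniform_measure lborel {y. \<forall>i. \<bar>y $ i - x $ i\<bar> \<le> \<epsilon>})"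


section \<open>Liouville first passage percolation\<close>

definition lattice :: "real \<Rightarrow> (real^'n) set" where
  "lattice \<epsilon> = {x. \<forall>i. \<exists>m::int. x $ i = \<epsilon> * of_int m}"

text \<open>Paths are indexed by \<open>{1..N}\<close>; points of \<^term>\<open>lattice \<epsilon>\<close> are nearest
  neighbors iff their Euclidean distance is \<^term>\<open>\<epsilon>\<close>.\<close>

definition lattice_paths ::
  "real \<Rightarrow> real^'n \<Rightarrow> real^'n \<Rightarrow> (real^'n) set \<Rightarrow> (nat \<times> (nat \<Rightarrow> real^'n)) set" where
  "lattice_paths \<epsilon> z w A =
     {(N, P). 1 \<le> N \<and> P 1 = z \<and> P N = w \<and> (\<forall>i\<in>{1..N}. P i \<in> A \<inter> lattice \<epsilon>) \<and>
        (\<forall>i\<in>{1..<N}. dist (P i) (P (Suc i)) = \<epsilon>)}"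

definition lfpp_length ::
  "((real^'n) measure \<times> (real^'n) measure \<Rightarrow> real) \<Rightarrow> real \<Rightarrow> real
     \<Rightarrow> nat \<times> (nat \<Rightarrow> real^'n) \<Rightarrow> real" where
  "lfpp_length h \<epsilon> \<xi> = (\<lambda>(N, P). \<Sum>i=1..N. \<epsilon> * exp (\<xi> * box_average h \<epsilon> (P i)))"

definition lfpp_dist ::
  "((real^'n) measure \<times> (real^'n) measure \<Rightarrow> real) \<Rightarrow> real \<Rightarrow> real
     \<Rightarrow> real^'n \<Rightarrow> real^'n \<Rightarrow> (real^'n) set \<Rightarrow> ennreal" where
  "lfpp_dist h \<epsilon> \<xi> z w A = (INF p\<in>lattice_paths \<epsilon> z w A. ennreal (lfpp_length h \<epsilon> \<xi> p))"

definition lfpp_set_dist ::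
  "((real^'n) measure \<times> (real^'n) measure \<Rightarrow> real) \<Rightarrow> real \<Rightarrow> real
     \<Rightarrow> (real^'n) set \<Rightarrow> (real^'n) set \<Rightarrow> (real^'n) set \<Rightarrow> ennreal" where
  "lfpp_set_dist h \<epsilon> \<xi> U V A = (INF z\<in>U. INF w\<in>V. lfpp_dist h \<epsilon> \<xi> z w A)"

definition lattice_cube :: "real \<Rightarrow> (real^'n) set" where
  "lattice_cube \<epsilon> = {x \<in> lattice \<epsilon>. \<forall>i. 0 \<le> x $ i \<and> x $ i \<le> 1}"

text \<open>The coordinate \<^term>\<open>k\<close> is the one in which the cube is crossed: the index type has no
  distinguished first element.\<close>

definition left_face :: "'n \<Rightarrow> real \<Rightarrow> (real^'n) set" where
  "left_face k \<epsilon> = {x \<in> lattice_cube \<epsilon>. x $ k = 0}"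

definition right_face :: "'n \<Rightarrow> real \<Rightarrow> (real^'n) set" where
  "right_face k \<epsilon> = {x \<in> lattice_cube \<epsilon>. x $ k = 1}"

definition crossing_prob ::
  "'w measure \<Rightarrow> ('w \<Rightarrow> (real^'n) measure \<times> (real^'n) measure \<Rightarrow> real)
     \<Rightarrow> 'n \<Rightarrow> real \<Rightarrow> real \<Rightarrow> real \<Rightarrow> real" where
  "crossing_prob M h k \<xi> \<alpha> \<epsilon> =
     measure M {\<omega> \<in> space M.
       lfpp_set_dist (h \<omega>) \<epsilon> \<xi> (left_face k \<epsilon>) (right_face k \<epsilon>) (lattice_cube \<epsilon>)
         \<le> ennreal (\<epsilon> powr \<alpha>)}"

text \<open>The supremum is taken in the extended reals, so that finiteness is not built in.\<close>

definition lfpp_exponent ::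
  "'w measure \<Rightarrow> ('w \<Rightarrow> (real^'n) measure \<times> (real^'n) measure \<Rightarrow> real)
     \<Rightarrow> 'n \<Rightarrow> real \<Rightarrow> ereal" where
  "lfpp_exponent M h k \<xi> =
     Sup (ereal ` {\<alpha>. liminf (\<lambda>n. ereal (crossing_prob M h k \<xi> \<alpha> (1 / real n))) = 1})"

end

theory Submission
  imports Defs
begin

text \<open>The field enters only through the Gaussian vectors of its averages $h_\epsilon(x)$ over the
  lattice points $x$ of the unit cube. What matters about their covariance is the bound
  $\mathrm{Var}\, h_\epsilon(x) \le \log(1/\epsilon) + C$; it holds because an average over a
  cube of side $2\epsilon$ has logarithmic energy at most $\log(1/\epsilon) + O(1)$
  (\<open>box_charge\<close>). A path enters only through its set of vertices, since loops can be cut out of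
  it. Writing $\epsilon = 1/n$, the crossing distance becomes the minimum over finitely many sets $A$
  of the cost $\sum_{x \in A} e^{\xi h_\epsilon(x)} / n$.

  Every assertion about $\lambda$ comes from comparing these costs at two parameters.

  \<^item> \<open>good_lipschitz\<close>: by a union bound, with probability tending to one all $|h_\epsilon(x)|$
    are at most $c \log n$ for a given $c > \sqrt{2d}$. On this event a change of $\xi$ by $t$ changes every
    weight by a factor of at most $n^{c|t|}$. So $\lambda$ is $\sqrt{2d}$-Lipschitz, and
    it is finite because at $\xi = 0$ the cost only counts vertices.

  \<^item> \<open>good_quadratic\<close>: for $0 \le \xi \le \xi'$ the vector $\xi' h$ has the law of $\xi h + s h'$, where
    $h'$ is an independent copy and $s^2 = \xi'^2 - \xi^2$. The cost of a path that is
    cheap for $\xi h$ is multiplied, in the mean over $h'$, by at most $E e^{s h'} = O(n^{s^2/2})$. So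
    $\lambda(\xi) + \xi^2/2$ is nondecreasing, and $\lambda' \ge -\xi$.

  \<^item> \<open>good_power\<close>: $\sum a^p \le (\sum a)^p$ for $p \ge 1$. So $(\lambda(\xi) - 1)/\xi$ is nondecreasing, and
    $\lambda' \ge (\lambda - 1)/\xi$.

  \<^item> \<open>good_thick\<close>: take a path that is cheap for $\xi$, and let $\xi' \le \xi$ and $b \ge -\xi'$. Vertices with
    $h_\epsilon \ge -b \log n$ gain at most a factor $n^{(\xi - \xi') b}$, and all the other points of the cube
    together contribute at most $n^{-(1 - d + \xi' b + b^2/2)}$, up to an arbitrarily small power, by a first moment estimate.
    So $\lambda(\xi') \ge \min(\lambda(\xi) - (\xi - \xi') b,\ 1 - d + \xi' b + b^2/2)$. If $b$ exceeds the
    larger root of $b^2/2 + \xi b = \lambda(\xi) + d - 1$, the first term is the smaller one for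
    $\xi'$ close to $\xi$, hence $\lambda'(\xi) \le b$. That root is the upper bound of the theorem.

  The derivative exists almost everywhere by Lebesgue's theorem for Lipschitz functions
  (\<open>lipschitz_AE_differentiable\<close>), which is derived from Vitali's covering theorem. The
  identity in law in the second comparison needs the Cramer--Wold theorem (\<open>cramer_wold\<close>), which is derived
  from the uniqueness of characteristic functions on the line.\<close>

section \<open>Lipschitz functions are differentiable almost everywhere\<close>

text \<open>Cover \<^term>\<open>E\<close>, up to a null set, by disjoint balls inside an open set that is only slightly
  larger in the sense of \<open>\<nu>\<close>; on each of the balls the inequality holds by assumption. Used
  below with Lebesgue measure in either role, once as \<open>\<mu>\<close> and once as \<open>\<nu>\<close>.\<close>

lemma covering_measure_le:
  fixes \<mu> \<nu> :: "'a::euclidean_space measure"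
  assumes [measurable_cong]: "sets \<mu> = sets borel" "sets \<nu> = sets borel"
    and fin: "emeasure \<nu> UNIV \<noteq> \<infinity>"
    and ac: "absolutely_continuous lborel \<mu>"
    and E: "E \<in> sets borel" and c: "c \<noteq> 0" "c < top"
    and cover: "\<And>x d. x \<in> E \<Longrightarrow> d > 0 \<Longrightarrow>
      \<exists>a r. x \<in> ball a r \<and> r < d \<and> emeasure \<mu> (ball a r) \<le> c * emeasure \<nu> (ball a r)"
  shows "emeasure \<mu> E \<le> c * emeasure \<nu> E"
proof -
  have le: "emeasure \<mu> E \<le> c * emeasure \<nu> U" if U: "E \<subseteq> U" "open U" for U
  proof -
    define K where "K = {(a, r). ball a r \<subseteq> U \<and> emeasure \<mu> (ball a r) \<le> c * emeasure \<nu> (ball a r)}"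
    have "\<exists>i. i \<in> K \<and> x \<in> ball (fst i) (snd i) \<and> snd i < d" if x: "x \<in> E" "d > 0" for x d
    proof -
      obtain e where e: "e > 0" "ball x e \<subseteq> U"
        using U x by (meson open_contains_ball subsetD)
      obtain a r where ar: "x \<in> ball a r" "r < min d (e / 2)"
        "emeasure \<mu> (ball a r) \<le> c * emeasure \<nu> (ball a r)"
        using cover[of x "min d (e / 2)"] x e by auto
      have "ball a r \<subseteq> ball x e"
      proof
        fix y assume "y \<in> ball a r"
        then have "dist a y < r" "dist a x < r" using ar by auto
        then have "dist x y < 2 * r" using dist_triangle3[of x y a] by linarith
        then show "y \<in> ball x e" using ar by auto
      qed
      then show ?thesis
        using ar e by (intro exI[of _ "(a, r)"]) (auto simp: K_def)
    qed
    from this obtain C where C: "countable C" "C \<subseteq> K"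
      "pairwise (\<lambda>i j. disjnt (ball (fst i) (snd i)) (ball (fst j) (snd j))) C"
      "negligible (E - (\<Union>i \<in> C. ball (fst i) (snd i)))"
      by (rule Vitali_covering_theorem_balls[of E K fst snd])
    let ?B = "\<lambda>i. ball (fst i) (snd i)"
    have disj: "disjoint_family_on ?B C"
      using C(3) by (auto simp: disjoint_family_on_def pairwise_def disjnt_def)
    have meas: "(\<Union>i\<in>C. ?B i) \<in> sets borel" by (intro borel_open) auto
    have "E - (\<Union>i\<in>C. ?B i) \<in> null_sets lborel"
      using C(4) E meas by (simp add: negligible_iff_null_sets null_sets_completion_iff)
    then have null: "E - (\<Union>i\<in>C. ?B i) \<in> null_sets \<mu>"
      using ac unfolding absolutely_continuous_def by auto
    have "emeasure \<mu> E \<le> emeasure \<mu> ((E - (\<Union>i\<in>C. ?B i)) \<union> (\<Union>i\<in>C. ?B i))"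
      using E meas by (intro emeasure_mono) auto
    also have "\<dots> \<le> emeasure \<mu> (E - (\<Union>i\<in>C. ?B i)) + emeasure \<mu> (\<Union>i\<in>C. ?B i)"
      using E meas by (intro emeasure_subadditive) auto
    also have "emeasure \<mu> (E - (\<Union>i\<in>C. ?B i)) = 0" using null by auto
    also have "emeasure \<mu> (\<Union>i\<in>C. ?B i) = (\<integral>\<^sup>+i. emeasure \<mu> (?B i) \<partial>count_space C)"
      using C(1) disj by (intro emeasure_UN_countable) auto
    also have "\<dots> \<le> (\<integral>\<^sup>+i. c * emeasure \<nu> (?B i) \<partial>count_space C)"
      using C(2) by (intro nn_integral_mono) (auto simp: K_def)
    also have "\<dots> = c * (\<integral>\<^sup>+i. emeasure \<nu> (?B i) \<partial>count_space C)"
      by (intro nn_integral_cmult) auto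
    also have "(\<integral>\<^sup>+i. emeasure \<nu> (?B i) \<partial>count_space C) = emeasure \<nu> (\<Union>i\<in>C. ?B i)"
      using C(1) disj by (intro emeasure_UN_countable[symmetric]) auto
    also have "\<dots> \<le> emeasure \<nu> U"
      using C(2) U assms(2) by (intro emeasure_mono) (auto simp: K_def subset_iff)
    finally show ?thesis by (simp add: mult_left_mono)
  qed
  have "emeasure \<mu> E / c \<le> (INF U\<in>{U. E \<subseteq> U \<and> open U}. emeasure \<nu> U)"
  proof (intro INF_greatest)
    fix U assume "U \<in> {U. E \<subseteq> U \<and> open U}"
    then have "emeasure \<mu> E \<le> c * emeasure \<nu> U" using le by auto
    then show "emeasure \<mu> E / c \<le> emeasure \<nu> U"
      using c by (intro divide_le_posI_ennreal) (auto simp: zero_less_iff_neq_zero)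
  qed
  also have "\<dots> = emeasure \<nu> E"
    using assms by (intro outer_regular[symmetric]) (auto simp: sets_eq_imp_space_eq[OF assms(2)])
  finally have "c * (emeasure \<mu> E / c) \<le> c * emeasure \<nu> E" by (rule mult_left_mono) simp
  moreover have "c * (emeasure \<mu> E / c) = emeasure \<mu> E"
    using c by (simp add: ennreal_times_divide mult.commute[of c] ennreal_mult_divide_eq)
  ultimately show ?thesis by simp
qed

lemma emeasure_density_indicator:
  assumes "W \<in> sets M" "A \<in> sets M"
  shows "emeasure (density M (indicator W)) A = emeasure M (W \<inter> A)"
  using assms by (subst emeasure_density) (auto simp flip: indicator_inter_arith)

lemma abs_diff_le_shift:
  fixes a b c m E T :: real
  assumes "\<bar>a - m\<bar> \<le> E" "\<bar>b\<bar> \<le> c" "0 \<le> m" "m \<le> c" "E + (c + c) \<le> T"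
  shows "\<bar>a - b\<bar> \<le> T"
  using assms by linarith

text \<open>If the slopes of \<open>F\<close> over small intervals around \<open>x\<close> have no limit, there are rationals
  \<open>p < q\<close> such that arbitrarily small intervals around \<open>x\<close> have slope below \<open>p\<close> and others
  have slope above \<open>q\<close>. For the set \<open>E p q R\<close> of such points in \<open>{- R<..<R}\<close>, the Stieltjes measure
  \<open>\<mu>\<close> of \<open>F\<close> satisfies both \<open>\<mu> E \<le> p |E|\<close> and \<open>q |E| \<le> \<mu> E\<close>, so that \<open>|E| = 0\<close>.\<close>

lemma bi_lipschitz_AE_differentiable:
  fixes F :: "real \<Rightarrow> real"
  assumes lo: "\<And>x y. x \<le> y \<Longrightarrow> y - x \<le> F y - F x"
    and hi: "\<And>x y. x \<le> y \<Longrightarrow> F y - F x \<le> C * (y - x)"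
  shows "AE x in lborel. F differentiable (at x)"
proof -
  have C1: "C \<ge> 1" using lo[of 0 1] hi[of 0 1] by simp
  have absF: "\<bar>F y - F x\<bar> \<le> C * \<bar>y - x\<bar>" for x y
    using lo[of x y] lo[of y x] hi[of x y] hi[of y x] by (cases "x \<le> y") auto
  have lip: "C-lipschitz_on UNIV F"
    using absF C1 by (auto simp: lipschitz_on_def dist_real_def)
  then have cont: "continuous_on UNIV F" by (rule lipschitz_on_continuous_on)
  have less: "F x < F y \<longleftrightarrow> x < y" for x y
    using lo[of x y] lo[of y x] by (cases "x = y"; cases "x \<le> y") auto
  have inj: "inj F" by (rule injI) (metis less less_irrefl linorder_less_linear)
  have "surj F"
  proof -
    have "\<exists>x. F x = y" for y
    proof -
      let ?u = "min 0 (y - F 0)" and ?v = "max 0 (y - F 0)"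
      have "F ?u \<le> y" "y \<le> F ?v"
        using lo[of ?u 0] lo[of 0 ?v] by (auto simp: min_def max_def split: if_splits)
      then show ?thesis
        using IVT'[of F ?u y ?v] continuous_on_subset[OF cont subset_UNIV] by (meson max.cobounded1 min.cobounded1 order_trans)
    qed
    then show ?thesis by (metis surjI)
  qed
  define g where "g = inv F"
  have Fg [simp]: "F (g y) = y" for y using \<open>surj F\<close> by (simp add: g_def surj_f_inv_f)
  have gF [simp]: "g (F x) = x" for x using inj by (simp add: g_def)
  have g_less: "x < g y \<longleftrightarrow> F x < y" "g y < x \<longleftrightarrow> y < F x" for x y
    using less[of x "g y"] less[of "g y" x] by auto
  have g_vimage: "g -` {a<..<b} = {F a<..<F b}" for a b
    by (auto simp: g_less)
  have "mono g" by (rule monoI) (metis Fg less linorder_not_less)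
  then have [measurable]: "g \<in> borel_measurable borel" by (rule borel_measurable_mono)
  \<comment> \<open>The Stieltjes measure of \<open>F\<close>, realised as an image of Lebesgue measure.\<close>
  define \<mu> where "\<mu> = distr lborel borel g"
  have \<mu>_sets [measurable_cong, simp]: "sets \<mu> = sets borel" by (simp add: \<mu>_def)
  have \<mu>_Ioo: "emeasure \<mu> {a<..<b} = ennreal (F b - F a)" if "a \<le> b" for a b
    using that lo[of a b] by (simp add: \<mu>_def emeasure_distr g_vimage)
  have \<mu>_null: "absolutely_continuous lborel \<mu>"
    unfolding absolutely_continuous_def
  proof
    fix N assume N: "N \<in> null_sets (lborel :: real measure)"
    then have [measurable]: "N \<in> sets borel" by auto
    have "negligible N" using N by (simp add: negligible_iff_null_sets null_sets_completion_iff)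
    then have "negligible (F ` N)"
      using absF by (intro negligible_locally_Lipschitz_image) (auto intro!: exI[of _ UNIV])
    moreover have "g -` N = F ` N"
      by (auto simp: image_iff) (metis Fg)
    moreover have "g -` N \<in> sets borel" using measurable_sets_borel[of g borel N] by simp
    ultimately have "g -` N \<in> null_sets lborel"
      by (simp add: negligible_iff_null_sets null_sets_completion_iff)
    then show "N \<in> null_sets \<mu>"
      by (auto simp: \<mu>_def null_sets_def emeasure_distr)
  qed
  \<comment> \<open>The covering argument needs finite measures, hence the restriction to a bounded interval.\<close>
  define W where "W R = {- R<..<R}" for R :: real
  define Up where "Up P R d = \<Union>{ball a r | a r. r < d \<and> ball a r \<subseteq> W R \<and> P (F (a + r) - F (a - r)) (2 * r)}"
    for P :: "real \<Rightarrow> real \<Rightarrow> bool" and R d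
  define E where "E p q R = (\<Inter>n. Up (\<lambda>s l. s < p * l) R (1 / Suc n)) \<inter> (\<Inter>n. Up (\<lambda>s l. s > q * l) R (1 / Suc n))"
    for p q R
  have Up_open: "open (Up P R d)" for P R d by (auto simp: Up_def)
  have E_borel [measurable]: "E p q R \<in> sets borel" for p q R
    unfolding E_def by (intro sets.Int sets.countable_INT'' borel_open Up_open) simp_all
  have Up_mono: "Up P R d \<subseteq> Up P R d'" if "d \<le> d'" for P R d d'
    using that unfolding Up_def by (intro Union_mono Collect_mono) (auto intro: less_le_trans)
  have Up_all: "x \<in> Up P R d" if "\<And>n::nat. x \<in> Up P R (1 / Suc n)" "d > 0" for x P R d
  proof -
    obtain n where "1 / Suc n < d" using \<open>d > 0\<close> by (metis nat_approx_posE)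
    then show ?thesis using that(1)[of n] Up_mono[of "1 / Suc n" d] by auto
  qed
  have W_borel [measurable]: "W R \<in> sets borel" for R by (simp add: W_def)
  define mW where "mW R = density lborel (indicator (W R))" for R
  define \<mu>W where "\<mu>W R = density \<mu> (indicator (W R))" for R
  have mW_sets: "sets (mW R) = sets borel" "sets (\<mu>W R) = sets borel" for R
    by (simp_all add: mW_def \<mu>W_def)
  have ball_eq: "ball a r = {a - r<..<a + r}" for a r :: real
    by (auto simp: dist_real_def)
  have mW_ball: "emeasure (mW R) (ball a r) = ennreal (2 * r)" 
      "emeasure (\<mu>W R) (ball a r) = ennreal (F (a + r) - F (a - r))"
    if "ball a r \<subseteq> W R" "r \<ge> 0" for R a r
    using that \<mu>_Ioo[of "a - r" "a + r"]
    by (simp_all add: mW_def \<mu>W_def emeasure_density_indicator Int_absorb1 ball_eq)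
  have mW_fin: "emeasure (mW R) UNIV \<noteq> \<infinity>" "emeasure (\<mu>W R) UNIV \<noteq> \<infinity>" for R
    using \<mu>_Ioo[of "-R" R]
    by (cases "-R \<le> R"; simp add: mW_def \<mu>W_def emeasure_density_indicator W_def)+
  have ac: "absolutely_continuous lborel (mW R)" "absolutely_continuous lborel (\<mu>W R)" for R
    using \<mu>_null unfolding absolutely_continuous_def
    by (auto simp: mW_def \<mu>W_def null_sets_def emeasure_density_indicator subset_iff
        intro!: emeasure_eq_0[OF _ _ Int_lower2])
  have E_null: "E p q R \<in> null_sets lborel" if "0 < p" "p < q" for p q R
  proof -
    let ?E = "E p q R"
    have "emeasure (\<mu>W R) ?E \<le> ennreal p * emeasure (mW R) ?E"
    proof (rule covering_measure_le)
      fix x d :: real assume x: "x \<in> ?E" "d > 0"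
      then have "x \<in> Up (\<lambda>s l. s < p * l) R d" by (auto simp: E_def simp del: of_nat_Suc intro: Up_all)
      then obtain a r where "x \<in> ball a r" "r < d" "ball a r \<subseteq> W R" "F (a + r) - F (a - r) < p * (2 * r)"
        by (auto simp: Up_def)
      moreover have "r > 0" using \<open>x \<in> ball a r\<close> by (metis ball_eq_empty empty_iff linorder_not_less)
      ultimately show "\<exists>a r. x \<in> ball a r \<and> r < d \<and>
          emeasure (\<mu>W R) (ball a r) \<le> ennreal p * emeasure (mW R) (ball a r)"
        using \<open>0 < p\<close> by (intro exI[of _ a] exI[of _ r]) 
          (auto simp: mW_ball simp flip: ennreal_mult intro!: ennreal_leI)
    qed (use that in \<open>simp_all add: mW_sets mW_fin[unfolded infinity_ennreal_def] ac\<close>)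
    moreover have "emeasure (mW R) ?E \<le> ennreal (1 / q) * emeasure (\<mu>W R) ?E"
    proof (rule covering_measure_le)
      fix x d :: real assume x: "x \<in> ?E" "d > 0"
      then have "x \<in> Up (\<lambda>s l. s > q * l) R d" by (auto simp: E_def simp del: of_nat_Suc intro: Up_all)
      then obtain a r where *: "x \<in> ball a r" "r < d" "ball a r \<subseteq> W R" "F (a + r) - F (a - r) > q * (2 * r)"
        by (auto simp: Up_def)
      moreover have "r > 0" using \<open>x \<in> ball a r\<close> by (metis ball_eq_empty empty_iff linorder_not_less)
      moreover have "F (a + r) - F (a - r) \<ge> 0" using lo[of "a - r" "a + r"] \<open>r > 0\<close> by simp
      ultimately show "\<exists>a r. x \<in> ball a r \<and> r < d \<and>
          emeasure (mW R) (ball a r) \<le> ennreal (1 / q) * emeasure (\<mu>W R) (ball a r)"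
        using that by (intro exI[of _ a] exI[of _ r]) 
          (auto simp: mW_ball field_simps simp flip: ennreal_mult intro!: ennreal_leI)
    qed (use that in \<open>simp_all add: mW_sets mW_fin[unfolded infinity_ennreal_def] ac\<close>)
    ultimately have "emeasure (mW R) ?E \<le> ennreal (1 / q) * (ennreal p * emeasure (mW R) ?E)"
      by (meson mult_left_mono order_trans zero_le)
    also have "\<dots> = ennreal (p / q) * emeasure (mW R) ?E"
      using that by (simp add: mult.assoc[symmetric] flip: ennreal_mult)
    finally have le: "emeasure (mW R) ?E \<le> ennreal (p / q) * emeasure (mW R) ?E" .
    have "emeasure (mW R) ?E \<le> emeasure (mW R) UNIV"
      by (intro emeasure_mono) (auto simp: mW_sets)
    then have "emeasure (mW R) ?E \<noteq> \<infinity>" using mW_fin(1)[of R] by (auto simp: top_unique)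
    then obtain t where t: "emeasure (mW R) ?E = ennreal t" "t \<ge> 0"
      by (metis ennreal_cases infinity_ennreal_def)
    have "t \<le> p / q * t" using le t that by (simp flip: ennreal_mult)
    then have "t * (q - p) \<le> 0" using that by (simp add: field_simps)
    then have "t = 0" using that t(2) by (simp add: mult_le_0_iff)
    moreover have "?E \<subseteq> W R" by (auto simp: E_def Up_def)
    ultimately show ?thesis
      using t by (auto simp: mW_def emeasure_density_indicator Int_absorb1 null_sets_def)
  qed
  define B where "B = (\<Union>p\<in>{p\<in>\<rat>. 0 < p}. \<Union>q\<in>{q\<in>\<rat>. p < q}. \<Union>n::nat. E p q (real n))"
  have cr: "countable {q \<in> \<rat>. r < q}" for r :: real
    by (rule countable_subset[OF _ countable_rat]) blast
  have "B \<in> null_sets lborel"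
    unfolding B_def by (intro null_sets_UN' cr E_null) simp_all
  then have AE_B: "AE x in lborel. x \<notin> B" by (rule AE_not_in)
  have diff: "F differentiable (at x)" if xB: "x \<notin> B" for x
  proof -
    define Ev where "Ev P \<longleftrightarrow> (\<exists>d>0. \<forall>u v. u < x \<and> x < v \<and> v - u < d \<longrightarrow> P (F v - F u) (v - u))"
      for P :: "real \<Rightarrow> real \<Rightarrow> bool"
    have dich: "Ev (\<lambda>s l. s \<ge> p * l) \<or> Ev (\<lambda>s l. s \<le> q * l)" if pq: "p \<in> \<rat>" "q \<in> \<rat>" "0 < p" "p < q" for p q
    proof -
      obtain n :: nat where n: "\<bar>x\<bar> < n" by (meson reals_Archimedean2)
      have "x \<notin> E p q (real n)" using xB pq by (auto simp: B_def)
      then obtain m where m: "x \<notin> Up (\<lambda>s l. s < p * l) (real n) (1 / Suc m) \<or>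
            x \<notin> Up (\<lambda>s l. s > q * l) (real n) (1 / Suc m)"
        by (auto simp: E_def)
      have Ev_not: "Ev (\<lambda>s l. \<not> P s l)" if "x \<notin> Up P (real n) (1 / Suc m)" for P
        unfolding Ev_def
      proof (intro exI conjI allI impI)
        let ?d = "min (1 / Suc m) (n - \<bar>x\<bar>)"
        show "0 < ?d" using n by simp
        fix u v assume uv: "u < x \<and> x < v \<and> v - u < ?d"
        let ?a = "(u + v) / 2" and ?r = "(v - u) / 2"
        have "?a + ?r = v" "?a - ?r = u" by (simp_all add: field_simps)
        moreover have "ball ?a ?r \<subseteq> W n" "x \<in> ball ?a ?r" "?r < 1 / Suc m"
          using uv \<open>?a + ?r = v\<close> \<open>?a - ?r = u\<close> unfolding ball_eq W_def by (auto simp: abs_if min_def split: if_splits)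
        ultimately have "\<not> P (F (?a + ?r) - F (?a - ?r)) (2 * ?r)"
          using that unfolding Up_def by blast
        moreover have "2 * ?r = v - u" by simp
        ultimately show "\<not> P (F v - F u) (v - u)"
          using \<open>?a + ?r = v\<close> \<open>?a - ?r = u\<close> by metis
      qed
      show ?thesis
        using m Ev_not[of "\<lambda>s l. s < p * l"] Ev_not[of "\<lambda>s l. s > q * l"] by (auto simp: not_less)
    qed
    define l where "l = Sup {p. Ev (\<lambda>s l. s \<ge> p * l)}"
    have Ev_mono: "Ev Q" if "Ev P" "\<And>s l. l > 0 \<Longrightarrow> P s l \<Longrightarrow> Q s l" for P Q
    proof -
      obtain d where "d > 0" "\<And>u v. u < x \<Longrightarrow> x < v \<Longrightarrow> v - u < d \<Longrightarrow> P (F v - F u) (v - u)"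
        using \<open>Ev P\<close> by (auto simp: Ev_def)
      then show ?thesis using that(2) unfolding Ev_def
        by (intro exI[of _ d]) auto
    qed
    have Ev1: "Ev (\<lambda>s l. s \<ge> 1 * l)" using lo unfolding Ev_def by (intro exI[of _ 1]) auto
    have Ev_le: "p \<le> C" if p: "Ev (\<lambda>s l. s \<ge> p * l)" for p
    proof -
      obtain d where d: "d > 0" "\<And>u v. u < x \<Longrightarrow> x < v \<Longrightarrow> v - u < d \<Longrightarrow> F v - F u \<ge> p * (v - u)"
        using p unfolding Ev_def by blast
      let ?u = "x - d / 3" and ?v = "x + d / 3"
      have "p * (?v - ?u) \<le> F ?v - F ?u" by (rule d(2)) (use d(1) in auto)
      also have "\<dots> \<le> C * (?v - ?u)" using d(1) by (intro hi) simp
      finally show ?thesis using d(1) by (subst (asm) mult_le_cancel_right) simp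
    qed
    have bdd: "bdd_above {p. Ev (\<lambda>s l. s \<ge> p * l)}" using Ev_le by (auto intro!: bdd_aboveI)
    have ne: "{p. Ev (\<lambda>s l. s \<ge> p * l)} \<noteq> {}" using Ev1 by blast
    have l1: "l \<ge> 1" unfolding l_def using Ev1 by (intro cSup_upper bdd) simp
    have lC: "l \<le> C" unfolding l_def using Ev_le by (intro cSup_least ne) simp
    have low: "Ev (\<lambda>s k. s \<ge> (l - e) * k)" if e: "e > 0" for e
    proof -
      obtain p where "Ev (\<lambda>s l. s \<ge> p * l)" "l - e < p"
        using less_cSup_iff[OF ne bdd, of "l - e"] e by (auto simp: l_def)
      then show ?thesis
        by (elim Ev_mono) (meson less_imp_le mult_right_mono order_trans)
    qed
    have up: "Ev (\<lambda>s k. s \<le> (l + e) * k)" if e: "e > 0" for e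
    proof -
      obtain p where p: "p \<in> \<rat>" "l < p" "p < l + e / 2" using Rats_dense_in_real[of l "l + e / 2"] e by auto
      obtain q where q: "q \<in> \<rat>" "p < q" "q < l + e" using Rats_dense_in_real[of p "l + e"] p e by auto
      have "\<not> Ev (\<lambda>s l. s \<ge> p * l)" using p(2) cSup_upper[OF _ bdd, of p] by (auto simp: l_def)
      then have "Ev (\<lambda>s l. s \<le> q * l)" using dich[of p q] p q l1 by auto
      then show ?thesis
        using q(3) by (elim Ev_mono) (meson less_imp_le mult_right_mono order_trans)
    qed
    have "(F has_field_derivative l) (at x)"
      unfolding DERIV_def LIM_def dist_real_def
    proof (intro allI impI)
      fix e :: real assume e: "e > 0"
      obtain d1 where d1: "d1 > 0" "\<And>u v. u < x \<Longrightarrow> x < v \<Longrightarrow> v - u < d1 \<Longrightarrow> F v - F u \<ge> (l - e / 2) * (v - u)"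
        using low[of "e / 2"] e by (auto simp: Ev_def)
      obtain d2 where d2: "d2 > 0" "\<And>u v. u < x \<Longrightarrow> x < v \<Longrightarrow> v - u < d2 \<Longrightarrow> F v - F u \<le> (l + e / 2) * (v - u)"
        using up[of "e / 2"] e by (auto simp: Ev_def)
      let ?d = "min d1 d2"
      have strad: "\<bar>F v - F u - l * (v - u)\<bar> \<le> e / 2 * (v - u)" if "u < x" "x < v" "v - u < ?d" for u v
      proof -
        have "F v - F u \<ge> l * (v - u) - e / 2 * (v - u)" "F v - F u \<le> l * (v - u) + e / 2 * (v - u)"
          using d1(2)[of u v] d2(2)[of u v] that by (simp_all only: left_diff_distrib distrib_right min_less_iff_conj)
        then show ?thesis by linarith
      qed
      have key: "\<bar>F (x + h) - F x - l * h\<bar> \<le> e / 2 * \<bar>h\<bar>" if h: "h \<noteq> 0" "\<bar>h\<bar> < ?d" for h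
      proof (rule field_le_epsilon)
        fix t :: real assume t: "t > 0"
        define \<eta> where "\<eta> = min (t / (e / 2 + 2 * C)) ((?d - \<bar>h\<bar>) / 2)"
        have \<eta>: "\<eta> > 0" "\<eta> \<le> (?d - \<bar>h\<bar>) / 2" using t e C1 h unfolding \<eta>_def by (simp, simp only: min.cobounded2)
        have "\<eta> \<le> t / (e / 2 + 2 * C)" by (simp add: \<eta>_def)
        then have \<eta>t: "\<eta> * (e / 2 + 2 * C) \<le> t" using e C1 by (subst (asm) pos_le_divide_eq) auto
        have l\<eta>: "0 \<le> l * \<eta>" "l * \<eta> \<le> C * \<eta>" using l1 lC \<eta> by auto
        show "\<bar>F (x + h) - F x - l * h\<bar> \<le> e / 2 * \<bar>h\<bar> + t"
        proof (cases "h > 0")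
          case True
          have "\<bar>F (x + h) - F (x - \<eta>) - l * (x + h - (x - \<eta>))\<bar> \<le> e / 2 * (x + h - (x - \<eta>))"
            using True \<eta> h by (intro strad) (auto simp: min_def split: if_splits)
          then have "\<bar>F (x + h) - F (x - \<eta>) - l * h - l * \<eta>\<bar> \<le> e / 2 * h + e / 2 * \<eta>" by (simp add: algebra_simps)
          moreover have "\<bar>F x - F (x - \<eta>)\<bar> \<le> C * \<eta>" using absF[of x "x - \<eta>"] \<eta> by simp
          moreover have "\<eta> * (e / 2 + 2 * C) = e / 2 * \<eta> + C * \<eta> + C * \<eta>" by (simp add: algebra_simps)
          ultimately have "\<bar>(F (x + h) - F (x - \<eta>) - l * h) - (F x - F (x - \<eta>))\<bar> \<le> e / 2 * h + t"
            using \<eta>t l\<eta> by - (rule abs_diff_le_shift[where m = "l * \<eta>" and c = "C * \<eta>"], assumption+, linarith)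
          then show ?thesis using True by simp
        next
          case False
          then have hneg: "h < 0" using h by simp
          have "\<bar>F (x + \<eta>) - F (x + h) - l * (x + \<eta> - (x + h))\<bar> \<le> e / 2 * (x + \<eta> - (x + h))"
            using hneg \<eta> h by (intro strad) (auto simp: min_def split: if_splits)
          then have "\<bar>F (x + \<eta>) - F (x + h) + l * h - l * \<eta>\<bar> \<le> e / 2 * \<eta> - e / 2 * h" by (simp add: algebra_simps)
          moreover have "\<bar>F (x + \<eta>) - F x\<bar> \<le> C * \<eta>" using absF[of "x + \<eta>" x] \<eta> by simp
          moreover have "\<eta> * (e / 2 + 2 * C) = e / 2 * \<eta> + C * \<eta> + C * \<eta>" by (simp add: algebra_simps)
          ultimately have "\<bar>(F (x + \<eta>) - F (x + h) + l * h) - (F (x + \<eta>) - F x)\<bar> \<le> - (e / 2 * h) + t"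
            using \<eta>t l\<eta> by - (rule abs_diff_le_shift[where m = "l * \<eta>" and c = "C * \<eta>"], assumption+, linarith)
          moreover have "(F (x + \<eta>) - F (x + h) + l * h) - (F (x + \<eta>) - F x) = - (F (x + h) - F x - l * h)" by simp
          ultimately show ?thesis using hneg by simp
        qed
      qed
      show "\<exists>s>0. \<forall>h. h \<noteq> 0 \<and> \<bar>h - 0\<bar> < s \<longrightarrow> \<bar>(F (x + h) - F x) / h - l\<bar> < e"
      proof (intro exI conjI allI impI)
        show "0 < ?d" using d1 d2 by simp
        fix h assume h: "h \<noteq> 0 \<and> \<bar>h - 0\<bar> < ?d"
        have "(F (x + h) - F x) / h - l = (F (x + h) - F x - l * h) / h"
          using h by (simp add: diff_divide_distrib)
        moreover have "\<bar>F (x + h) - F x - l * h\<bar> / \<bar>h\<bar> \<le> e / 2"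
          using key[of h] h by (subst pos_divide_le_eq) auto
        ultimately have "\<bar>(F (x + h) - F x) / h - l\<bar> \<le> e / 2" by (simp only: abs_divide)
        then show "\<bar>(F (x + h) - F x) / h - l\<bar> < e" using e by simp
      qed
    qed
    then show ?thesis by (auto simp: real_differentiable_def)
  qed
  from AE_B show ?thesis
  proof eventually_elim
    case (elim x)
    then show ?case by (rule diff)
  qed
qed

text \<open>Adding a large multiple of the identity makes a Lipschitz function bi-Lipschitz.\<close>

theorem lipschitz_AE_differentiable:
  fixes f :: "real \<Rightarrow> real"
  assumes "K-lipschitz_on UNIV f"
  shows "AE x in lborel. f differentiable (at x)"
proof -
  have K: "K \<ge> 0" "\<bar>f y - f x\<bar> \<le> K * \<bar>y - x\<bar>" for x y
    using assms by (auto simp: lipschitz_on_def dist_real_def)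
  have "AE x in lborel. (\<lambda>x. f x + (K + 1) * x) differentiable (at x)"
  proof (rule bi_lipschitz_AE_differentiable[where C = "2 * K + 1"])
    fix x y :: real assume "x \<le> y"
    then show "y - x \<le> f y + (K + 1) * y - (f x + (K + 1) * x)"
      "f y + (K + 1) * y - (f x + (K + 1) * x) \<le> (2 * K + 1) * (y - x)"
      using K(2)[of x y] by (auto simp: algebra_simps abs_le_iff)
  qed
  then show ?thesis
  proof eventually_elim
    case (elim x)
    have "(\<lambda>x. (f x + (K + 1) * x) - (K + 1) * x) differentiable (at x)"
      by (intro differentiable_diff elim) auto
    then show ?case by simp
  qed
qed

section \<open>The law of a Gaussian vector\<close>

text \<open>Normalising the weights to densities reduces this to uniqueness for probability measures on
  the line.\<close>

lemma weighted_char_unique: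
  fixes X :: "'a \<Rightarrow> real" and Y :: "'b \<Rightarrow> real"
  assumes "prob_space M" "prob_space N"
    and [measurable]: "X \<in> borel_measurable M" "Y \<in> borel_measurable N"
      "u \<in> borel_measurable M" "v \<in> borel_measurable N"
    and u: "\<And>\<omega>. 0 \<le> u \<omega>" "\<And>\<omega>. u \<omega> \<le> B" and v: "\<And>\<omega>. 0 \<le> v \<omega>" "\<And>\<omega>. v \<omega> \<le> (B::real)"
    and eq: "\<And>s. (CLINT \<omega>|M. of_real (u \<omega>) * iexp (s * X \<omega>)) = (CLINT \<omega>|N. of_real (v \<omega>) * iexp (s * Y \<omega>))"
    and A [measurable]: "A \<in> sets borel"
  shows "(\<integral>\<omega>. u \<omega> * indicator A (X \<omega>) \<partial>M) = (\<integral>\<omega>. v \<omega> * indicator A (Y \<omega>) \<partial>N)"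
proof -
  interpret M: prob_space M by fact
  interpret N: prob_space N by fact
  have int_u: "integrable M u" using u by (intro M.integrable_const_bound[where B=B]) auto
  have int_v: "integrable N v" using v by (intro N.integrable_const_bound[where B=B]) auto
  define m where "m = (\<integral>\<omega>. u \<omega> \<partial>M)"
  have mv: "m = (\<integral>\<omega>. v \<omega> \<partial>N)"
    using eq[of 0] by (simp add: m_def)
  have m0: "m \<ge> 0" unfolding m_def using u by (intro integral_nonneg_AE) auto
  show ?thesis
  proof (cases "m = 0")
    case True
    then have "AE \<omega> in M. u \<omega> = 0" "AE \<omega> in N. v \<omega> = 0"
      using integral_nonneg_eq_0_iff_AE[OF int_u] integral_nonneg_eq_0_iff_AE[OF int_v] u v mv
      by (auto simp: m_def)
    then have "(\<integral>\<omega>. u \<omega> * indicator A (X \<omega>) \<partial>M) = 0" "(\<integral>\<omega>. v \<omega> * indicator A (Y \<omega>) \<partial>N) = 0"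
      by (auto intro!: integral_eq_zero_AE)
    then show ?thesis by simp
  next
    case False
    with m0 have m: "m > 0" by simp
    define M' where "M' = density M (\<lambda>\<omega>. ennreal (u \<omega> / m))"
    define N' where "N' = density N (\<lambda>\<omega>. ennreal (v \<omega> / m))"
    have [measurable_cong, simp]: "sets M' = sets M" "sets N' = sets N" by (simp_all add: M'_def N'_def)
    have "emeasure M' (space M') = (\<integral>\<^sup>+\<omega>. ennreal (u \<omega> / m) \<partial>M)"
      by (simp add: M'_def emeasure_density cong: nn_integral_cong)
    also have "\<dots> = ennreal (\<integral>\<omega>. u \<omega> / m \<partial>M)"
      using int_u u m by (intro nn_integral_eq_integral) auto
    finally have "emeasure M' (space M') = 1" using m by (simp add: m_def)
    then interpret M': prob_space M' by (rule prob_spaceI)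
    have "emeasure N' (space N') = (\<integral>\<^sup>+\<omega>. ennreal (v \<omega> / m) \<partial>N)"
      by (simp add: N'_def emeasure_density cong: nn_integral_cong)
    also have "\<dots> = ennreal (\<integral>\<omega>. v \<omega> / m \<partial>N)"
      using int_v v m by (intro nn_integral_eq_integral) auto
    finally have "emeasure N' (space N') = 1" using m by (simp add: mv)
    then interpret N': prob_space N' by (rule prob_spaceI)
    have [measurable]: "X \<in> borel_measurable M'" "Y \<in> borel_measurable N'" by simp_all
    have iM: "(\<integral>\<omega>. f \<omega> \<partial>M') = (\<integral>\<omega>. (u \<omega> / m) *\<^sub>R f \<omega> \<partial>M)" 
      if [measurable]: "f \<in> borel_measurable M" for f :: "'a \<Rightarrow> complex"
      unfolding M'_def using u m by (subst integral_density) auto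
    have iN: "(\<integral>\<omega>. f \<omega> \<partial>N') = (\<integral>\<omega>. (v \<omega> / m) *\<^sub>R f \<omega> \<partial>N)" 
      if [measurable]: "f \<in> borel_measurable N" for f :: "'b \<Rightarrow> complex"
      unfolding N'_def using v m by (subst integral_density) auto
    have "distr M' borel X = distr N' borel Y"
    proof (rule Levy_uniqueness)
      show "real_distribution (distr M' borel X)" "real_distribution (distr N' borel Y)"
        by (intro M'.real_distribution_distr N'.real_distribution_distr; simp)+
      show "char (distr M' borel X) = char (distr N' borel Y)"
      proof
        fix s
        have "char (distr M' borel X) s = (CLINT \<omega>|M. (u \<omega> / m) *\<^sub>R iexp (s * X \<omega>))"
          unfolding char_def by (subst integral_distr) (auto simp: iM)
        also have "\<dots> = (CLINT \<omega>|M. of_real (u \<omega>) * iexp (s * X \<omega>)) / of_real m"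
          by (simp add: scaleR_conv_of_real field_simps flip: integral_divide_zero)
        also have "\<dots> = (CLINT \<omega>|N. of_real (v \<omega>) * iexp (s * Y \<omega>)) / of_real m"
          by (simp only: eq)
        also have "\<dots> = (CLINT \<omega>|N. (v \<omega> / m) *\<^sub>R iexp (s * Y \<omega>))"
          by (simp add: scaleR_conv_of_real field_simps flip: integral_divide_zero)
        also have "\<dots> = char (distr N' borel Y) s"
          unfolding char_def by (subst integral_distr) (auto simp: iN)
        finally show "char (distr M' borel X) s = char (distr N' borel Y) s" .
      qed
    qed
    then have "(\<integral>x. indicator A x \<partial>distr M' borel X) = (\<integral>x. indicator A x \<partial>distr N' borel Y :: real)"
      by simp
    then have "(\<integral>\<omega>. indicator A (X \<omega>) \<partial>M') = (\<integral>\<omega>. indicator A (Y \<omega>) \<partial>N' :: real)"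
      by (subst (asm) (1 2) integral_distr) auto
    moreover have "(\<integral>\<omega>. indicator A (X \<omega>) \<partial>M') = (\<integral>\<omega>. u \<omega> * indicator A (X \<omega>) \<partial>M) / m"
      unfolding M'_def using u m by (subst integral_density) auto
    moreover have "(\<integral>\<omega>. indicator A (Y \<omega>) \<partial>N') = (\<integral>\<omega>. v \<omega> * indicator A (Y \<omega>) \<partial>N) / m"
      unfolding N'_def using v m by (subst integral_density) auto
    ultimately show ?thesis using m by simp
  qed
qed

text \<open>The coordinates are treated one at a time. Once the indicators of the coordinates in \<open>K\<close> are
  present, they and a trigonometric function of the remaining coordinates act as a weight in the
  law of a single further coordinate, and \<open>weighted_char_unique\<close> inserts the indicator of that
  coordinate. When all indicators are there, the two laws agree on boxes.\<close>

theorem cramer_wold: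
  fixes X :: "'i \<Rightarrow> 'a \<Rightarrow> real" and Y :: "'i \<Rightarrow> 'b \<Rightarrow> real"
  assumes "prob_space M" "prob_space N" and J: "finite J"
    and X [measurable]: "\<And>j. j \<in> J \<Longrightarrow> X j \<in> borel_measurable M"
    and Y [measurable]: "\<And>j. j \<in> J \<Longrightarrow> Y j \<in> borel_measurable N"
    and eq: "\<And>t. (CLINT \<omega>|M. iexp (\<Sum>j\<in>J. t j * X j \<omega>)) = (CLINT \<omega>|N. iexp (\<Sum>j\<in>J. t j * Y j \<omega>))"
  shows "distr M (PiM J (\<lambda>_. borel)) (\<lambda>\<omega>. \<lambda>j\<in>J. X j \<omega>) = distr N (PiM J (\<lambda>_. borel)) (\<lambda>\<omega>. \<lambda>j\<in>J. Y j \<omega>)"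
proof -
  interpret M: prob_space M by fact
  interpret N: prob_space N by fact
  have gen: "(CLINT \<omega>|M. of_real (\<Prod>j\<in>K. indicator (A j) (X j \<omega>)) * iexp (\<Sum>j\<in>J. t j * X j \<omega>)) =
     (CLINT \<omega>|N. of_real (\<Prod>j\<in>K. indicator (A j) (Y j \<omega>)) * iexp (\<Sum>j\<in>J. t j * Y j \<omega>))"
    if "K \<subseteq> J" and A: "\<And>j. j \<in> J \<Longrightarrow> A j \<in> sets borel" for K t A
    using finite_subset[OF \<open>K \<subseteq> J\<close> J] \<open>K \<subseteq> J\<close>
  proof (induction K arbitrary: t rule: finite_induct)
    case empty
    then show ?case using eq by simp
  next
    case (insert k K)
    have KJ: "K \<subseteq> J" "k \<in> J" and IH: "\<And>t. (CLINT \<omega>|M. of_real (\<Prod>j\<in>K. indicator (A j) (X j \<omega>)) * iexp (\<Sum>j\<in>J. t j * X j \<omega>)) =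
     (CLINT \<omega>|N. of_real (\<Prod>j\<in>K. indicator (A j) (Y j \<omega>)) * iexp (\<Sum>j\<in>J. t j * Y j \<omega>))"
      using insert by auto
    note [measurable] = A[OF KJ(2)] X[OF KJ(2)] Y[OF KJ(2)]
    define G where "G \<omega> = (\<Prod>j\<in>K. indicator (A j) (X j \<omega>) :: real)" for \<omega>
    define H where "H \<omega> = (\<Prod>j\<in>K. indicator (A j) (Y j \<omega>) :: real)" for \<omega>
    define \<theta> where "\<theta> \<omega> = (\<Sum>j\<in>J. t j * X j \<omega>)" for \<omega>
    define \<eta> where "\<eta> \<omega> = (\<Sum>j\<in>J. t j * Y j \<omega>)" for \<omega>
    have [measurable]: "G \<in> borel_measurable M" unfolding G_def using KJ A
      by (intro borel_measurable_prod measurable_compose[OF X] borel_measurable_indicator) auto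
    have [measurable]: "H \<in> borel_measurable N" unfolding H_def using KJ A
      by (intro borel_measurable_prod measurable_compose[OF Y] borel_measurable_indicator) auto
    have [measurable]: "\<theta> \<in> borel_measurable M" "\<eta> \<in> borel_measurable N"
      unfolding \<theta>_def \<eta>_def by (intro borel_measurable_sum borel_measurable_times; simp)+
    have G: "0 \<le> G \<omega>" "G \<omega> \<le> 1" for \<omega>
      unfolding G_def by (intro prod_nonneg prod_le_1; simp add: indicator_def)+
    have H: "0 \<le> H \<omega>" "H \<omega> \<le> 1" for \<omega>
      unfolding H_def by (intro prod_nonneg prod_le_1; simp add: indicator_def)+
    have GH: "(CLINT \<omega>|M. of_real (G \<omega>) * iexp (s * X k \<omega> + c * \<theta> \<omega>)) = (CLINT \<omega>|N. of_real (H \<omega>) * iexp (s * Y k \<omega> + c * \<eta> \<omega>))"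
      for s c
    proof -
      have sum_eq: "(\<Sum>j\<in>J. (c * t j + (if j = k then s else 0)) * Z j) = s * Z k + c * (\<Sum>j\<in>J. t j * Z j)" for Z :: "'i \<Rightarrow> real"
        using J KJ(2) by (simp add: distrib_right sum.distrib sum_distrib_left if_distrib[of "\<lambda>x. x * _"] sum.delta' mult.assoc cong: if_cong)
      show ?thesis
        using IH[of "\<lambda>j. c * t j + (if j = k then s else 0)"]
        unfolding sum_eq G_def[symmetric] H_def[symmetric] \<theta>_def[symmetric] \<eta>_def[symmetric] .
    qed
    have intM: "integrable M (\<lambda>\<omega>. of_real (G \<omega>) * iexp (s * X k \<omega> + c * \<theta> \<omega>))" for s c
      using G by (intro M.integrable_const_bound[where B=1]) (auto simp: norm_mult)
    have intN: "integrable N (\<lambda>\<omega>. of_real (H \<omega>) * iexp (s * Y k \<omega> + c * \<eta> \<omega>))" for s c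
      using H by (intro N.integrable_const_bound[where B=1]) (auto simp: norm_mult)
    have e0: "(\<integral>\<omega>. G \<omega> * indicator (A k) (X k \<omega>) \<partial>M) = (\<integral>\<omega>. H \<omega> * indicator (A k) (Y k \<omega>) \<partial>N)"
      using G H GH[of _ 0] by (intro weighted_char_unique[where B=1]) (auto intro: M.prob_space_axioms N.prob_space_axioms)
    have iM: "integrable M (\<lambda>\<omega>. G \<omega> * indicator (A k) (X k \<omega>) * f (\<theta> \<omega>))" 
      if [measurable]: "f \<in> borel_measurable borel" and "\<And>x. \<bar>f x\<bar> \<le> 1" for f
      using G that(2) by (intro M.integrable_const_bound[where B=1]) (auto simp: abs_mult indicator_def mult_le_one)
    have iN: "integrable N (\<lambda>\<omega>. H \<omega> * indicator (A k) (Y k \<omega>) * f (\<eta> \<omega>))" 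
      if [measurable]: "f \<in> borel_measurable borel" and "\<And>x. \<bar>f x\<bar> \<le> 1" for f
      using H that(2) by (intro N.integrable_const_bound[where B=1]) (auto simp: abs_mult indicator_def mult_le_one)
    \<comment> \<open>\<open>1 + w\<close> is a nonnegative weight whose product with \<open>iexp\<close> is again a combination of
      exponentials, for \<open>w = cos\<close> and \<open>w = sin\<close>.\<close>
    have trig: "(\<integral>\<omega>. G \<omega> * indicator (A k) (X k \<omega>) * w (\<theta> \<omega>) \<partial>M) = (\<integral>\<omega>. H \<omega> * indicator (A k) (Y k \<omega>) * w (\<eta> \<omega>) \<partial>N)"
      if [measurable]: "w \<in> borel_measurable borel" and w: "\<And>x. \<bar>w x\<bar> \<le> 1"
        and id: "\<And>x y. of_real (1 + w y) * iexp x = iexp (x + 0 * y) + c * iexp (x + 1 * y) + c' * iexp (x + (-1) * y)"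
      for w :: "real \<Rightarrow> real" and c c' :: complex
    proof -
      have w': "0 \<le> 1 + w x" "1 + w x \<le> 2" for x using w[of x] by auto
      have id': "of_real (g * (1 + w y)) * iexp x = of_real g * iexp (x + 0 * y) + c * (of_real g * iexp (x + 1 * y)) + c' * (of_real g * iexp (x + (-1) * y))"
        for g x y :: real
      proof -
        have "of_real (g * (1 + w y)) * iexp x = of_real g * (of_real (1 + w y) * iexp x)" by simp
        then show ?thesis unfolding id by (simp only: distrib_left ac_simps)
      qed
      have "(\<integral>\<omega>. (G \<omega> * (1 + w (\<theta> \<omega>))) * indicator (A k) (X k \<omega>) \<partial>M) = (\<integral>\<omega>. (H \<omega> * (1 + w (\<eta> \<omega>))) * indicator (A k) (Y k \<omega>) \<partial>N)"
      proof (rule weighted_char_unique[where B=2])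
        fix s
        have "(CLINT \<omega>|M. of_real (G \<omega> * (1 + w (\<theta> \<omega>))) * iexp (s * X k \<omega>)) =
            (CLINT \<omega>|M. of_real (G \<omega>) * iexp (s * X k \<omega> + 0 * \<theta> \<omega>)) + c * (CLINT \<omega>|M. of_real (G \<omega>) * iexp (s * X k \<omega> + 1 * \<theta> \<omega>))
            + c' * (CLINT \<omega>|M. of_real (G \<omega>) * iexp (s * X k \<omega> + (-1) * \<theta> \<omega>))"
          unfolding id' by (simp only: Bochner_Integration.integral_add Bochner_Integration.integrable_add integrable_mult_right integral_mult_right_zero intM)
        moreover have "(CLINT \<omega>|N. of_real (H \<omega> * (1 + w (\<eta> \<omega>))) * iexp (s * Y k \<omega>)) =
            (CLINT \<omega>|N. of_real (H \<omega>) * iexp (s * Y k \<omega> + 0 * \<eta> \<omega>)) + c * (CLINT \<omega>|N. of_real (H \<omega>) * iexp (s * Y k \<omega> + 1 * \<eta> \<omega>))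
            + c' * (CLINT \<omega>|N. of_real (H \<omega>) * iexp (s * Y k \<omega> + (-1) * \<eta> \<omega>))"
          unfolding id' by (simp only: Bochner_Integration.integral_add Bochner_Integration.integrable_add integrable_mult_right integral_mult_right_zero intN)
        ultimately show "(CLINT \<omega>|M. of_real (G \<omega> * (1 + w (\<theta> \<omega>))) * iexp (s * X k \<omega>)) = (CLINT \<omega>|N. of_real (H \<omega> * (1 + w (\<eta> \<omega>))) * iexp (s * Y k \<omega>))"
          by (simp only: GH)
      next
        fix \<omega>
        show "0 \<le> G \<omega> * (1 + w (\<theta> \<omega>))" using G w' by (intro mult_nonneg_nonneg) auto
        show "G \<omega> * (1 + w (\<theta> \<omega>)) \<le> 2" using mult_mono[OF G(2) w'(2) _ w'(1)] by simp
      next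
        fix \<omega>
        show "0 \<le> H \<omega> * (1 + w (\<eta> \<omega>))" using H w' by (intro mult_nonneg_nonneg) auto
        show "H \<omega> * (1 + w (\<eta> \<omega>)) \<le> 2" using mult_mono[OF H(2) w'(2) _ w'(1)] by simp
      qed (auto intro: M.prob_space_axioms N.prob_space_axioms)
      moreover have "(\<integral>\<omega>. (G \<omega> * (1 + w (\<theta> \<omega>))) * indicator (A k) (X k \<omega>) \<partial>M)
          = (\<integral>\<omega>. G \<omega> * indicator (A k) (X k \<omega>) * w (\<theta> \<omega>) \<partial>M) + (\<integral>\<omega>. G \<omega> * indicator (A k) (X k \<omega>) \<partial>M)"
        using iM[of w, OF _ w] iM[of "\<lambda>_. 1"] by (subst Bochner_Integration.integral_add[symmetric]) (auto simp: algebra_simps)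
      moreover have "(\<integral>\<omega>. (H \<omega> * (1 + w (\<eta> \<omega>))) * indicator (A k) (Y k \<omega>) \<partial>N)
          = (\<integral>\<omega>. H \<omega> * indicator (A k) (Y k \<omega>) * w (\<eta> \<omega>) \<partial>N) + (\<integral>\<omega>. H \<omega> * indicator (A k) (Y k \<omega>) \<partial>N)"
        using iN[of w, OF _ w] iN[of "\<lambda>_. 1"] by (subst Bochner_Integration.integral_add[symmetric]) (auto simp: algebra_simps)
      ultimately show ?thesis using e0 by simp
    qed
    have ec: "(\<integral>\<omega>. G \<omega> * indicator (A k) (X k \<omega>) * cos (\<theta> \<omega>) \<partial>M) = (\<integral>\<omega>. H \<omega> * indicator (A k) (Y k \<omega>) * cos (\<eta> \<omega>) \<partial>N)"
    proof (rule trig[of cos "1/2" "1/2"])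
      show "of_real (1 + cos y) * iexp x = iexp (x + 0 * y) + 1 / 2 * iexp (x + 1 * y) + 1 / 2 * iexp (x + - 1 * y)" for x y
        unfolding cis_conv_exp[symmetric] by (simp add: complex_eq_iff cos_add sin_add cos_diff sin_diff field_simps)
    qed auto
    have es: "(\<integral>\<omega>. G \<omega> * indicator (A k) (X k \<omega>) * sin (\<theta> \<omega>) \<partial>M) = (\<integral>\<omega>. H \<omega> * indicator (A k) (Y k \<omega>) * sin (\<eta> \<omega>) \<partial>N)"
    proof (rule trig[of sin "- \<i> / 2" "\<i> / 2"])
      show "of_real (1 + sin y) * iexp x = iexp (x + 0 * y) + - \<i> / 2 * iexp (x + 1 * y) + \<i> / 2 * iexp (x + - 1 * y)" for x y
        unfolding cis_conv_exp[symmetric] by (simp add: complex_eq_iff cos_add sin_add cos_diff sin_diff field_simps)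
    qed auto
    have split: "of_real (g * i) * iexp y = of_real (g * i * cos y) + \<i> * of_real (g * i * sin y)" for g i y :: real
      by (simp add: cis_conv_exp[symmetric] complex_eq_iff)
    have prodG: "(\<Prod>j\<in>insert k K. indicator (A j) (X j \<omega>)) = G \<omega> * indicator (A k) (X k \<omega>)" for \<omega>
      using insert.hyps by (simp add: G_def)
    have prodH: "(\<Prod>j\<in>insert k K. indicator (A j) (Y j \<omega>)) = H \<omega> * indicator (A k) (Y k \<omega>)" for \<omega>
      using insert.hyps by (simp add: H_def)
    have "(CLINT \<omega>|M. of_real (G \<omega> * indicator (A k) (X k \<omega>)) * iexp (\<theta> \<omega>)) =
        of_real (\<integral>\<omega>. G \<omega> * indicator (A k) (X k \<omega>) * cos (\<theta> \<omega>) \<partial>M) + \<i> * of_real (\<integral>\<omega>. G \<omega> * indicator (A k) (X k \<omega>) * sin (\<theta> \<omega>) \<partial>M)"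
      unfolding split using iM[of cos, THEN integrable_of_real] iM[of sin, THEN integrable_of_real]
      by (subst Bochner_Integration.integral_add) (auto simp del: of_real_mult)
    also have "\<dots> = of_real (\<integral>\<omega>. H \<omega> * indicator (A k) (Y k \<omega>) * cos (\<eta> \<omega>) \<partial>N) + \<i> * of_real (\<integral>\<omega>. H \<omega> * indicator (A k) (Y k \<omega>) * sin (\<eta> \<omega>) \<partial>N)"
      by (simp only: ec es)
    also have "\<dots> = (CLINT \<omega>|N. of_real (H \<omega> * indicator (A k) (Y k \<omega>)) * iexp (\<eta> \<omega>))"
      unfolding split using iN[of cos, THEN integrable_of_real] iN[of sin, THEN integrable_of_real]
      by (subst Bochner_Integration.integral_add) (auto simp del: of_real_mult)
    finally show ?case
      unfolding prodG prodH \<theta>_def \<eta>_def .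
  qed
  show ?thesis
  proof (rule measure_eqI_PiM_finite[OF J])
    fix A :: "'i \<Rightarrow> real set" assume A: "\<And>j. j \<in> J \<Longrightarrow> A j \<in> sets borel"
    have mM: "(\<lambda>\<omega>. \<lambda>j\<in>J. X j \<omega>) \<in> measurable M (PiM J (\<lambda>_. borel))"
      by (intro measurable_restrict X)
    have mN: "(\<lambda>\<omega>. \<lambda>j\<in>J. Y j \<omega>) \<in> measurable N (PiM J (\<lambda>_. borel))"
      by (intro measurable_restrict Y)
    have PA: "Pi\<^sub>E J A \<in> sets (PiM J (\<lambda>_. borel))" using A J by (intro sets_PiM_I_finite) auto
    have i: "(\<Prod>j\<in>J. indicator (A j) (Z j) :: real) = indicator (Pi\<^sub>E J A) (\<lambda>j\<in>J. Z j)" for Z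
      using J by (auto simp: indicator_def PiE_def Pi_def prod_zero_iff)
    have "(\<integral>\<omega>. (\<Prod>j\<in>J. indicator (A j) (X j \<omega>)) \<partial>M) = (\<integral>\<omega>. (\<Prod>j\<in>J. indicator (A j) (Y j \<omega>)) \<partial>N :: real)"
      using gen[of J A "\<lambda>_. 0"] A by (simp flip: of_real_prod)
    moreover have "(\<integral>\<omega>. indicator (Pi\<^sub>E J A) (\<lambda>j\<in>J. X j \<omega>) \<partial>M) = measure (distr M (PiM J (\<lambda>_. borel)) (\<lambda>\<omega>. \<lambda>j\<in>J. X j \<omega>)) (Pi\<^sub>E J A)"
      using integral_distr[OF mM, of "indicator (Pi\<^sub>E J A) :: _ \<Rightarrow> real"] PA by simp
    moreover have "(\<integral>\<omega>. indicator (Pi\<^sub>E J A) (\<lambda>j\<in>J. Y j \<omega>) \<partial>N) = measure (distr N (PiM J (\<lambda>_. borel)) (\<lambda>\<omega>. \<lambda>j\<in>J. Y j \<omega>)) (Pi\<^sub>E J A)"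
      using integral_distr[OF mN, of "indicator (Pi\<^sub>E J A) :: _ \<Rightarrow> real"] PA by simp
    ultimately have "measure (distr M (PiM J (\<lambda>_. borel)) (\<lambda>\<omega>. \<lambda>j\<in>J. X j \<omega>)) (Pi\<^sub>E J A) =
      measure (distr N (PiM J (\<lambda>_. borel)) (\<lambda>\<omega>. \<lambda>j\<in>J. Y j \<omega>)) (Pi\<^sub>E J A)"
      unfolding i by (simp only:)
    then show "emeasure (distr M (PiM J (\<lambda>_. borel)) (\<lambda>\<omega>. \<lambda>j\<in>J. X j \<omega>)) (Pi\<^sub>E J A) =
       emeasure (distr N (PiM J (\<lambda>_. borel)) (\<lambda>\<omega>. \<lambda>j\<in>J. Y j \<omega>)) (Pi\<^sub>E J A)"
      using M.prob_space_distr[OF mM] N.prob_space_distr[OF mN]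
      by (simp add: finite_measure.emeasure_eq_measure prob_space.finite_measure)
  next
    show "range (\<lambda>_::nat. Pi\<^sub>E J (\<lambda>_. UNIV)) \<subseteq> prod_algebra J (\<lambda>_. borel)"
      using J by (auto intro!: prod_algebraI_finite)
    show "(\<Union>i::nat. Pi\<^sub>E J (\<lambda>_. UNIV)) = space (PiM J (\<lambda>_. borel))" by (simp add: space_PiM)
    interpret D: prob_space "distr M (PiM J (\<lambda>_. borel)) (\<lambda>\<omega>. \<lambda>j\<in>J. X j \<omega>)"
      by (intro M.prob_space_distr measurable_restrict X)
    show "emeasure (distr M (PiM J (\<lambda>_. borel)) (\<lambda>\<omega>. \<lambda>j\<in>J. X j \<omega>)) (Pi\<^sub>E J (\<lambda>_. UNIV)) \<noteq> \<infinity>"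
      by simp
  qed auto
qed


lemma centered_gaussian_moments:
  assumes "prob_space M" "centered_gaussian M X"
  shows "integrable M (\<lambda>\<omega>. exp (t * X \<omega>))"
    and "(\<integral>\<omega>. exp (t * X \<omega>) \<partial>M) = exp (t\<^sup>2 * (\<integral>\<omega>. (X \<omega>)\<^sup>2 \<partial>M) / 2)"
    and "(CLINT \<omega>|M. iexp (t * X \<omega>)) = of_real (exp (- (t\<^sup>2 * (\<integral>\<omega>. (X \<omega>)\<^sup>2 \<partial>M) / 2)))"
proof -
  interpret prob_space M by fact
  have [measurable]: "X \<in> borel_measurable M" using assms(2) by (simp add: centered_gaussian_def)
  have "integrable M (\<lambda>\<omega>. exp (t * X \<omega>)) \<and> (\<integral>\<omega>. exp (t * X \<omega>) \<partial>M) = exp (t\<^sup>2 * (\<integral>\<omega>. (X \<omega>)\<^sup>2 \<partial>M) / 2)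
    \<and> (CLINT \<omega>|M. iexp (t * X \<omega>)) = of_real (exp (- (t\<^sup>2 * (\<integral>\<omega>. (X \<omega>)\<^sup>2 \<partial>M) / 2)))"
  proof (cases "AE \<omega> in M. X \<omega> = 0")
    case True
    have "(\<integral>\<omega>. (X \<omega>)\<^sup>2 \<partial>M) = (\<integral>\<omega>. 0 \<partial>M)" using True by (intro integral_cong_AE) auto
    moreover have "integrable M (\<lambda>\<omega>. exp (t * X \<omega>)) \<longleftrightarrow> integrable M (\<lambda>\<omega>. 1 :: real)"
      using True by (intro integrable_cong_AE) auto
    moreover have "(\<integral>\<omega>. exp (t * X \<omega>) \<partial>M) = (\<integral>\<omega>. 1 \<partial>M)" using True by (intro integral_cong_AE) auto
    moreover have "(CLINT \<omega>|M. iexp (t * X \<omega>)) = (CLINT \<omega>|M. 1)" using True by (intro integral_cong_AE) auto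
    ultimately show ?thesis by (simp add: prob_space)
  next
    case False
    then obtain s where s: "s > 0" "distributed M lborel X (normal_density 0 s)"
      using assms(2) by (auto simp: centered_gaussian_def)
    have v: "(\<integral>\<omega>. (X \<omega>)\<^sup>2 \<partial>M) = s\<^sup>2"
      using normal_distributed_variance[OF s] normal_distributed_expectation[OF s] by simp
    \<comment> \<open>Completing the square.\<close>
    have sq: "normal_density 0 s x * exp (t * x) = exp (t\<^sup>2 * s\<^sup>2 / 2) * normal_density (t * s\<^sup>2) s x" for x
      using s(1) by (simp add: normal_density_def power2_eq_square field_simps flip: exp_add)
    have "integrable lborel (\<lambda>x. normal_density 0 s x * exp (t * x))"
      unfolding sq using s(1) by simp
    then have 1: "integrable M (\<lambda>\<omega>. exp (t * X \<omega>))"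
      using distributed_integrable[OF s(2), of "\<lambda>x. exp (t * x)"] by (auto simp: normal_density_nonneg)
    have "(\<integral>\<omega>. exp (t * X \<omega>) \<partial>M) = (\<integral>x. normal_density 0 s x * exp (t * x) \<partial>lborel)"
      by (subst distributed_integral[OF s(2)]) auto
    also have "\<dots> = exp (t\<^sup>2 * s\<^sup>2 / 2)" unfolding sq using s(1) by simp
    finally have 2: "(\<integral>\<omega>. exp (t * X \<omega>) \<partial>M) = exp (t\<^sup>2 * s\<^sup>2 / 2)" .
    have "distributed M lborel (\<lambda>\<omega>. (X \<omega> - 0) / s) std_normal_density"
      using normal_standard_normal_convert[OF s(1), of X 0] s(2) by simp
    then have d: "distr M borel (\<lambda>\<omega>. X \<omega> / s) = std_normal_distribution"
      using distributed_distr_eq_density[of M lborel "\<lambda>\<omega>. X \<omega> / s" std_normal_density] by (simp cong: distr_cong)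
    have "char (distr M borel (\<lambda>\<omega>. X \<omega> / s)) (t * s) = (CLINT \<omega>|M. iexp (t * X \<omega>))"
      unfolding char_def using s(1) by (subst integral_distr) auto
    then have "(CLINT \<omega>|M. iexp (t * X \<omega>)) = of_real (exp (- ((t * s)\<^sup>2 / 2)))"
      unfolding d char_std_normal_distribution by simp
    then show ?thesis using 1 2 by (simp add: v power_mult_distrib)
  qed
  then show "integrable M (\<lambda>\<omega>. exp (t * X \<omega>))"
    and "(\<integral>\<omega>. exp (t * X \<omega>) \<partial>M) = exp (t\<^sup>2 * (\<integral>\<omega>. (X \<omega>)\<^sup>2 \<partial>M) / 2)"
    and "(CLINT \<omega>|M. iexp (t * X \<omega>)) = of_real (exp (- (t\<^sup>2 * (\<integral>\<omega>. (X \<omega>)\<^sup>2 \<partial>M) / 2)))"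
    by blast+
qed

text \<open>Every linear combination \<open>U\<close> of the \<open>X j\<close> is centered Gaussian, so \<open>r U\<close> and
  \<open>a U + b U'\<close> have the same characteristic function when \<open>U'\<close> is an independent copy of \<open>U\<close>.\<close>

theorem gaussian_rotation:
  fixes X :: "'i \<Rightarrow> 'w \<Rightarrow> real"
  assumes "prob_space M" and J: "finite J"
    and gauss: "\<And>c. centered_gaussian M (\<lambda>\<omega>. \<Sum>j\<in>J. c j * X j \<omega>)"
    and abr: "a\<^sup>2 + b\<^sup>2 = r\<^sup>2"
    and B: "B \<in> sets (PiM J (\<lambda>_. borel))"
  shows "measure M {\<omega> \<in> space M. (\<lambda>j\<in>J. r * X j \<omega>) \<in> B} =
    measure (M \<Otimes>\<^sub>M M) {\<omega> \<in> space (M \<Otimes>\<^sub>M M). (\<lambda>j\<in>J. a * X j (fst \<omega>) + b * X j (snd \<omega>)) \<in> B}"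
proof -
  interpret prob_space M by fact
  interpret MM: pair_prob_space M M by unfold_locales
  have X [measurable]: "X j \<in> borel_measurable M" if "j \<in> J" for j
  proof -
    have "(\<lambda>\<omega>. \<Sum>i\<in>J. (if i = j then 1 else 0) * X i \<omega>) \<in> borel_measurable M"
      using gauss[of "\<lambda>i. if i = j then 1 else 0"] by (simp add: centered_gaussian_def)
    also have "(\<lambda>\<omega>. \<Sum>i\<in>J. (if i = j then 1 else 0) * X i \<omega>) = X j"
      using that J by (auto simp: if_distrib[of "\<lambda>c. c * _"] cong: if_cong)
    finally show ?thesis .
  qed
  have XX [measurable]: "(\<lambda>\<omega>. a * X j (fst \<omega>) + b * X j (snd \<omega>)) \<in> borel_measurable (M \<Otimes>\<^sub>M M)" if "j \<in> J" for j
    using X[OF that] by measurable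
  have rX [measurable]: "(\<lambda>\<omega>. r * X j \<omega>) \<in> borel_measurable M" if "j \<in> J" for j
    using X[OF that] by measurable
  have "distr M (PiM J (\<lambda>_. borel)) (\<lambda>\<omega>. \<lambda>j\<in>J. r * X j \<omega>) =
      distr (M \<Otimes>\<^sub>M M) (PiM J (\<lambda>_. borel)) (\<lambda>\<omega>. \<lambda>j\<in>J. a * X j (fst \<omega>) + b * X j (snd \<omega>))"
  proof (rule cramer_wold[OF _ _ J rX XX])
    fix t :: "'i \<Rightarrow> real"
    define U where "U \<omega> = (\<Sum>j\<in>J. t j * X j \<omega>)" for \<omega>
    define v where "v = (\<integral>\<omega>. (U \<omega>)\<^sup>2 \<partial>M)"
    have U: "centered_gaussian M U" using gauss[of t] by (simp add: U_def[abs_def])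
    then have [measurable]: "U \<in> borel_measurable M" by (simp add: centered_gaussian_def)
    have char: "(CLINT \<omega>|M. iexp (c * U \<omega>)) = of_real (exp (- (c\<^sup>2 * v / 2)))" for c
      using centered_gaussian_moments(3)[OF \<open>prob_space M\<close> U, of c] by (simp only: v_def)
    have "(CLINT \<omega>|M. iexp (\<Sum>j\<in>J. t j * (r * X j \<omega>))) = (CLINT \<omega>|M. iexp (r * U \<omega>))"
      by (simp add: U_def sum_distrib_left mult_ac)
    also have "\<dots> = of_real (exp (- (r\<^sup>2 * v / 2)))" by (rule char)
    also have "\<dots> = of_real (exp (- (a\<^sup>2 * v / 2)) * exp (- (b\<^sup>2 * v / 2)))"
      unfolding abr[symmetric] exp_add[symmetric] by (simp add: field_simps)
    also have "\<dots> = (CLINT \<omega>|M. iexp (a * U \<omega>)) * (CLINT \<omega>|M. iexp (b * U \<omega>))"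
      unfolding char by (simp only: of_real_mult)
    also have "\<dots> = (CLINT x|M. (CLINT y|M. iexp (a * U x) * iexp (b * U y)))" by simp
    also have "\<dots> = (CLINT \<omega>|M \<Otimes>\<^sub>M M. iexp (a * U (fst \<omega>)) * iexp (b * U (snd \<omega>)))"
      by (subst MM.integral_fst'[symmetric]) (auto intro!: MM.integrable_const_bound[where B=1] simp: norm_mult)
    also have "\<dots> = (CLINT \<omega>|M \<Otimes>\<^sub>M M. iexp (\<Sum>j\<in>J. t j * (a * X j (fst \<omega>) + b * X j (snd \<omega>))))"
      unfolding U_def exp_add[symmetric]
      by (intro Bochner_Integration.integral_cong refl arg_cong[where f=exp])
        (simp add: sum_distrib_left sum.distrib algebra_simps)
    finally show "(CLINT \<omega>|M. iexp (\<Sum>j\<in>J. t j * (r * X j \<omega>))) =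
      (CLINT \<omega>|M \<Otimes>\<^sub>M M. iexp (\<Sum>j\<in>J. t j * (a * X j (fst \<omega>) + b * X j (snd \<omega>))))" .
  qed (auto intro: prob_space_axioms MM.prob_space_axioms)
  then have "measure (distr M (PiM J (\<lambda>_. borel)) (\<lambda>\<omega>. \<lambda>j\<in>J. r * X j \<omega>)) B =
      measure (distr (M \<Otimes>\<^sub>M M) (PiM J (\<lambda>_. borel)) (\<lambda>\<omega>. \<lambda>j\<in>J. a * X j (fst \<omega>) + b * X j (snd \<omega>))) B"
    by simp
  moreover have "(\<lambda>\<omega>. \<lambda>j\<in>J. r * X j \<omega>) \<in> measurable M (PiM J (\<lambda>_. borel))"
    by (intro measurable_restrict rX)
  moreover have "(\<lambda>\<omega>. \<lambda>j\<in>J. a * X j (fst \<omega>) + b * X j (snd \<omega>)) \<in> measurable (M \<Otimes>\<^sub>M M) (PiM J (\<lambda>_. borel))"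
    by (intro measurable_restrict XX)
  ultimately show ?thesis
    using B by (simp add: measure_distr vimage_def Int_def conj_commute)
qed

section \<open>Logarithmic energies of cubes and of the sphere\<close>

text \<open>The sum of the geometric series of \<open>exp (- n)\<close>.\<close>

definition geom_const :: real where "geom_const = 1 / (1 - exp (- 1))"

lemma geom_const_nonneg: "geom_const \<ge> 0"
  by (simp add: geom_const_def)

text \<open>The positive part of \<open>ln (s / f)\<close> is at most the number of \<open>n\<close> with
  \<open>f \<le> s * exp (- n)\<close>; this also accounts for the value infinity where \<open>f\<close> vanishes.\<close>

lemma nn_integral_ln_quotient_le:
  fixes f :: "'a \<Rightarrow> real"
  assumes [measurable]: "f \<in> borel_measurable \<rho>" and f: "\<And>y. f y \<ge> 0" and s: "s > 0" and K: "K \<ge> 0"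
    and small: "\<And>n::nat. emeasure \<rho> {y \<in> space \<rho>. f y \<le> s * exp (- real n)} \<le> ennreal (K * exp (- real n))"
  shows "(\<integral>\<^sup>+y. (if f y = 0 then \<infinity> else ennreal (ln (s / f y))) \<partial>\<rho>) \<le> ennreal (K * geom_const)"
proof -
  let ?A = "\<lambda>n::nat. {y \<in> space \<rho>. f y \<le> s * exp (- real n)}"
  have pt: "(if f y = 0 then \<infinity> else ennreal (ln (s / f y))) \<le> (\<Sum>n. indicator (?A n) y)" if y: "y \<in> space \<rho>" for y
  proof -
    have partial: "of_nat N \<le> (\<Sum>n. indicator (?A n) y :: ennreal)" if "\<And>n. n < N \<Longrightarrow> f y \<le> s * exp (- real n)" for N
    proof -
      have "(\<Sum>n<N. indicator (?A n) y :: ennreal) = of_nat N" using that y by simp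
      then show ?thesis using sum_le_suminf[of "\<lambda>n. indicator (?A n) y :: ennreal" "{..<N}"] by simp
    qed
    show ?thesis
    proof (cases "f y = 0")
      case True
      then have "of_nat N \<le> (\<Sum>n. indicator (?A n) y :: ennreal)" for N using s by (intro partial) simp
      then have "(SUP N. of_nat N :: ennreal) \<le> (\<Sum>n. indicator (?A n) y)" by (rule SUP_least)
      then have "(\<Sum>n. indicator (?A n) y :: ennreal) = top"
        unfolding ennreal_SUP_of_nat_eq_top by (simp add: top_unique)
      then show ?thesis by simp
    next
      case False
      then have fy: "f y > 0" using f[of y] by simp
      let ?t = "ln (s / f y)"
      show ?thesis
      proof (cases "?t \<le> 0")
        case True
        then show ?thesis using False by (simp add: ennreal_neg)
      next
        case pos: False
        define N where "N = nat (floor ?t) + 1"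
        have "of_nat N \<le> (\<Sum>n. indicator (?A n) y :: ennreal)"
        proof (rule partial)
          fix n assume "n < N"
          then have "real n \<le> ?t" using pos unfolding N_def by linarith
          then have "exp (real n) \<le> s / f y" using s fy by (subst (asm) ln_ge_iff) auto
          then show "f y \<le> s * exp (- real n)" using fy by (simp add: exp_minus field_simps)
        qed
        moreover have "ennreal ?t \<le> of_nat N"
        proof -
          have "?t \<le> real N" unfolding N_def by linarith
          then show ?thesis by (simp add: ennreal_of_nat_eq_real_of_nat ennreal_leI)
        qed
        ultimately have "ennreal ?t \<le> (\<Sum>n. indicator (?A n) y)" by (rule order_trans[rotated])
        then show ?thesis using False by simp
      qed
    qed
  qed
  have geo: "summable (\<lambda>n. exp (- 1) ^ n :: real)" "(\<Sum>n. exp (- 1) ^ n) = geom_const"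
    by (simp_all add: summable_geometric suminf_geometric geom_const_def)
  have e: "exp (- real n) = exp (- 1) ^ n" for n by (simp flip: exp_of_nat_mult)
  have "(\<integral>\<^sup>+y. (if f y = 0 then \<infinity> else ennreal (ln (s / f y))) \<partial>\<rho>) \<le> (\<integral>\<^sup>+y. (\<Sum>n. indicator (?A n) y) \<partial>\<rho>)"
    by (intro nn_integral_mono pt)
  also have "\<dots> = (\<Sum>n. \<integral>\<^sup>+y. indicator (?A n) y \<partial>\<rho>)" by (intro nn_integral_suminf) measurable
  also have "\<dots> = (\<Sum>n. emeasure \<rho> (?A n))" by simp
  also have "\<dots> \<le> (\<Sum>n. ennreal (K * exp (- 1) ^ n))" using small unfolding e by (intro suminf_le) auto
  also have "\<dots> = ennreal (\<Sum>n. K * exp (- 1) ^ n)"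
    using K geo(1) by (intro suminf_ennreal2 summable_mult) auto
  also have "(\<Sum>n. K * exp (- 1) ^ n) = K * geom_const" using geo by (simp add: suminf_mult)
  finally show ?thesis .
qed

text \<open>Balls of radius \<open>r \<le> s\<close> have mass of order at most \<open>r / s\<close>. Linear decay makes
  logarithmic potentials bounded, and it holds for cubes and spheres alike. The radii
  \<open>s * exp (- n)\<close> are those of \<open>nn_integral_ln_quotient_le\<close>.\<close>

definition small_balls :: "'a::euclidean_space measure \<Rightarrow> real \<Rightarrow> real \<Rightarrow> bool" where
  "small_balls \<rho> s K \<longleftrightarrow> (\<forall>x. \<forall>n::nat. emeasure \<rho> {y. norm (x - y) \<le> s * exp (- real n)} \<le> ennreal (K * exp (- real n)))"

lemma small_balls_potential:
  assumes sets: "sets \<rho> = sets borel" and "small_balls \<rho> s K" "s > 0" "K \<ge> 0"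
  shows "(\<integral>\<^sup>+y. (if x = y then \<infinity> else ennreal (ln (s / norm (x - y)))) \<partial>\<rho>) \<le> ennreal (K * geom_const)"
proof -
  have sp: "space \<rho> = UNIV" using sets_eq_imp_space_eq[OF sets] by simp
  have [measurable_cong]: "sets \<rho> = sets borel" by (rule sets)
  have "(\<integral>\<^sup>+y. (if norm (x - y) = 0 then \<infinity> else ennreal (ln (s / norm (x - y)))) \<partial>\<rho>) \<le> ennreal (K * geom_const)"
    using assms by (intro nn_integral_ln_quotient_le) (auto simp: sp small_balls_def)
  then show ?thesis by simp
qed

text \<open>Below distance \<open>s\<close> the potential is controlled by the small-ball condition, above it by the size
  of the supports.\<close>

lemma abs_log_energy_finite:
  fixes \<mu> \<nu> :: "'a::euclidean_space measure"
  assumes "prob_space \<mu>" "prob_space \<nu>" and sets: "sets \<nu> = sets borel"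
    and small: "small_balls \<nu> s K" "0 < s" "s \<le> 1" "K \<ge> 0"
    and supp: "AE x in \<mu>. norm x \<le> R" "AE y in \<nu>. norm y \<le> R" and R: "R \<ge> 1"
  shows "abs_log_energy \<mu> \<nu> < \<infinity>"
proof -
  interpret \<mu>: prob_space \<mu> by fact
  interpret \<nu>: prob_space \<nu> by fact
  have [measurable_cong]: "sets \<nu> = sets borel" by (rule sets)
  define c where "c = ln (1 / s) + ln (2 * R)"
  have c: "c \<ge> 0" using small R by (simp add: c_def ln_ge_zero)
  have inner: "(\<integral>\<^sup>+y. (if x = y then \<infinity> else ennreal \<bar>ln (norm (x - y))\<bar>) \<partial>\<nu>) \<le> ennreal (K * geom_const + c)"
    if x: "norm x \<le> R" for x
  proof -
    have "(\<integral>\<^sup>+y. (if x = y then \<infinity> else ennreal \<bar>ln (norm (x - y))\<bar>) \<partial>\<nu>)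
      \<le> (\<integral>\<^sup>+y. (if x = y then \<infinity> else ennreal (ln (s / norm (x - y)))) + ennreal c \<partial>\<nu>)"
    proof (rule nn_integral_mono_AE)
      show "AE y in \<nu>. (if x = y then \<infinity> else ennreal \<bar>ln (norm (x - y))\<bar>)
          \<le> (if x = y then \<infinity> else ennreal (ln (s / norm (x - y)))) + ennreal c"
        using supp(2)
      proof eventually_elim
        case (elim y)
        show ?case
        proof (cases "x = y")
          case False
          define t where "t = norm (x - y)"
          have t: "t > 0" "t \<le> 2 * R" using False norm_triangle_ineq4[of x y] x elim by (auto simp: t_def)
          have "ln t \<le> ln (2 * R)" using t by simp
          moreover have "ln (1 / s) \<ge> 0" "ln (2 * R) \<ge> 0" using small R by (auto simp: ln_ge_zero)
          moreover have "ln (s / t) = - ln t - ln (1 / s)" using t small by (simp add: ln_div)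
          ultimately have "\<bar>ln t\<bar> \<le> max 0 (ln (s / t)) + c" unfolding c_def by linarith
          then have "ennreal \<bar>ln t\<bar> \<le> ennreal (max 0 (ln (s / t)) + c)" by (rule ennreal_leI)
          also have "\<dots> = ennreal (ln (s / t)) + ennreal c" using c by (simp add: ennreal_plus max_def ennreal_neg)
          finally show ?thesis using False by (simp add: t_def)
        qed simp
      qed
    qed
    also have "\<dots> = (\<integral>\<^sup>+y. (if x = y then \<infinity> else ennreal (ln (s / norm (x - y)))) \<partial>\<nu>) + ennreal c"
      by (subst nn_integral_add) (auto simp: \<nu>.emeasure_space_1)
    also have "\<dots> \<le> ennreal (K * geom_const) + ennreal c"
      using small by (intro add_right_mono small_balls_potential sets) auto
    also have "\<dots> = ennreal (K * geom_const + c)"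
      using c small geom_const_nonneg by (simp add: ennreal_plus)
    finally show ?thesis .
  qed
  have "abs_log_energy \<mu> \<nu> \<le> (\<integral>\<^sup>+x. ennreal (K * geom_const + c) \<partial>\<mu>)"
    unfolding abs_log_energy_def using supp(1) inner by (intro nn_integral_mono_AE) auto
  also have "\<dots> < \<infinity>" by (simp add: \<mu>.emeasure_space_1)
  finally show ?thesis .
qed

text \<open>If \<open>f\<close> is not integrable, its integral is zero by convention; hence \<open>c \<ge> 0\<close>.\<close>

lemma integral_le_of_nn_integral_le:
  fixes f :: "'a \<Rightarrow> real"
  assumes "(\<integral>\<^sup>+x. ennreal (f x) \<partial>M) \<le> ennreal c" "c \<ge> 0"
  shows "(\<integral>x. f x \<partial>M) \<le> c"
proof (cases "integrable M f")
  case True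
  have "(\<integral>x. f x \<partial>M) = enn2real (\<integral>\<^sup>+x. ennreal (f x) \<partial>M) - enn2real (\<integral>\<^sup>+x. ennreal (- f x) \<partial>M)"
    using True by (rule real_lebesgue_integral_def)
  also have "\<dots> \<le> enn2real (\<integral>\<^sup>+x. ennreal (f x) \<partial>M)" by simp
  also have "\<dots> \<le> c" using assms by (intro enn2real_leI) auto
  finally show ?thesis .
qed (simp add: not_integrable_integral_eq assms)

lemma integral_le_const_AE:
  fixes f :: "'a \<Rightarrow> real"
  assumes "prob_space M" "AE x in M. f x \<le> c" "c \<ge> 0"
  shows "(\<integral>x. f x \<partial>M) \<le> c"
proof (rule integral_le_of_nn_integral_le[OF _ \<open>c \<ge> 0\<close>])
  interpret prob_space M by fact
  have "(\<integral>\<^sup>+x. ennreal (f x) \<partial>M) \<le> (\<integral>\<^sup>+x. ennreal c \<partial>M)"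
    using assms(2) by (intro nn_integral_mono_AE) (auto intro: ennreal_leI)
  then show "(\<integral>\<^sup>+x. ennreal (f x) \<partial>M) \<le> ennreal c" by (simp add: emeasure_space_1)
qed

text \<open>Integrate \<open>ln (1 / t) = ln (s / t) + ln (1 / s)\<close>. For a cube of side of order \<open>s\<close> the constant \<open>K\<close> does
  not depend on \<open>s\<close>, which makes \<open>ln (1 / s)\<close> the leading term.\<close>

lemma log_form_le:
  fixes \<mu> \<nu> :: "'a::euclidean_space measure"
  assumes "prob_space \<mu>" "prob_space \<nu>" and sets: "sets \<nu> = sets borel"
    and small: "small_balls \<nu> s K" "0 < s" "s \<le> 1" "K \<ge> 0"
  shows "log_form \<mu> \<nu> \<le> K * geom_const + ln (1 / s)"
  unfolding log_form_def
proof (rule integral_le_const_AE[OF \<open>prob_space \<mu>\<close> AE_I2])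
  interpret \<nu>: prob_space \<nu> by fact
  have [measurable_cong]: "sets \<nu> = sets borel" by (rule sets)
  have nn: "ln (1 / s) \<ge> 0" "K * geom_const \<ge> 0" using small geom_const_nonneg by (auto simp: ln_ge_zero)
  then show nn': "0 \<le> K * geom_const + ln (1 / s)" by simp
  fix x
  show "(\<integral>y. ln (1 / norm (x - y)) \<partial>\<nu>) \<le> K * geom_const + ln (1 / s)"
  proof (rule integral_le_of_nn_integral_le[OF _ nn'])
    have "(\<integral>\<^sup>+y. ennreal (ln (1 / norm (x - y))) \<partial>\<nu>) \<le> (\<integral>\<^sup>+y. (if x = y then \<infinity> else ennreal (ln (s / norm (x - y)))) + ennreal (ln (1 / s)) \<partial>\<nu>)"
    proof (rule nn_integral_mono)
      fix y
      show "ennreal (ln (1 / norm (x - y))) \<le> (if x = y then \<infinity> else ennreal (ln (s / norm (x - y)))) + ennreal (ln (1 / s))"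
      proof (cases "x = y")
        case False
        define t where "t = norm (x - y)"
        have t: "t > 0" using False by (simp add: t_def)
        have "ln (1 / t) = ln (s / t) + ln (1 / s)" using t small by (simp add: ln_div)
        then have "ennreal (ln (1 / t)) \<le> ennreal (max 0 (ln (s / t)) + ln (1 / s))" by (intro ennreal_leI) simp
        also have "\<dots> = ennreal (ln (s / t)) + ennreal (ln (1 / s))" using nn by (simp add: ennreal_plus max_def ennreal_neg)
        finally show ?thesis using False by (simp add: t_def)
      qed simp
    qed
    also have "\<dots> = (\<integral>\<^sup>+y. (if x = y then \<infinity> else ennreal (ln (s / norm (x - y)))) \<partial>\<nu>) + ennreal (ln (1 / s))"
      by (subst nn_integral_add) (auto simp: \<nu>.emeasure_space_1)
    also have "\<dots> \<le> ennreal (K * geom_const) + ennreal (ln (1 / s))"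
      using small by (intro add_right_mono small_balls_potential sets) auto
    also have "\<dots> = ennreal (K * geom_const + ln (1 / s))" using nn by (simp add: ennreal_plus)
    finally show "(\<integral>\<^sup>+y. ennreal (ln (1 / norm (x - y))) \<partial>\<nu>) \<le> ennreal (K * geom_const + ln (1 / s))" .
  qed
qed

lemma log_form_ge:
  fixes \<mu> \<nu> :: "'a::euclidean_space measure"
  assumes "prob_space \<mu>" "prob_space \<nu>"
    and supp: "AE x in \<mu>. norm x \<le> R" "AE y in \<nu>. norm y \<le> R" and R: "R \<ge> 1"
  shows "- log_form \<mu> \<nu> \<le> ln (2 * R)"
proof -
  have "- log_form \<mu> \<nu> = (\<integral>x. (\<integral>y. - ln (1 / norm (x - y)) \<partial>\<nu>) \<partial>\<mu>)" by (simp add: log_form_def)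
  also have "\<dots> \<le> ln (2 * R)"
  proof (rule integral_le_const_AE[OF \<open>prob_space \<mu>\<close>])
    show "AE x in \<mu>. (\<integral>y. - ln (1 / norm (x - y)) \<partial>\<nu>) \<le> ln (2 * R)"
      using supp(1)
    proof eventually_elim
      case (elim x)
      show ?case
      proof (rule integral_le_const_AE[OF \<open>prob_space \<nu>\<close>])
        show "AE y in \<nu>. - ln (1 / norm (x - y)) \<le> ln (2 * R)"
          using supp(2)
        proof eventually_elim
          case (elim y)
          show ?case
          proof (cases "x = y")
            case False
            have "norm (x - y) \<le> 2 * R" using norm_triangle_ineq4[of x y] elim \<open>norm x \<le> R\<close> by linarith
            then show ?thesis using False R by (simp add: ln_div)
          qed (use R in simp)
        qed
      qed (use R in simp)
    qed
  qed (use R in simp)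
  finally show ?thesis .
qed

text \<open>About \<open>1 / (3 * r)\<close> disjoint translates of the slab by multiples of \<open>(3 * r) *\<^sub>R e\<close> fit into
  the ball of radius two.\<close>

lemma slab_volume_le:
  fixes e :: "'a::euclidean_space"
  assumes e: "norm e = 1" and r: "r > 0"
  shows "measure lborel {u \<in> ball 0 1. \<bar>e \<bullet> u\<bar> \<le> r} \<le> 6 * r * measure lborel (ball (0::'a) 2)"
proof -
  let ?A = "{u \<in> ball 0 1. \<bar>e \<bullet> u\<bar> \<le> r}"
  have A_eq: "?A = ball 0 1 \<inter> {u. \<bar>e \<bullet> u\<bar> \<le> r}" by auto
  have A [measurable]: "?A \<in> sets borel" unfolding A_eq by measurable
  have fin2: "emeasure lborel (ball (0::'a) 2) < \<infinity>" by (rule emeasure_bounded_finite) simp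
  show ?thesis
  proof (cases "6 * r \<le> 1")
    case False
    have "measure lborel ?A \<le> measure lborel (ball (0::'a) 2)"
      using fin2 by (intro measure_mono_fmeasurable fmeasurableI) auto
    also have "\<dots> \<le> 6 * r * measure lborel (ball (0::'a) 2)"
      using False mult_right_mono[of 1 "6 * r" "measure lborel (ball (0::'a) 2)"] by simp
    finally show ?thesis .
  next
    case True
    \<comment> \<open>Consecutive translates are \<open>3 * r\<close> apart, more than the width \<open>2 * r\<close> of the slab.\<close>
    define m where "m = nat (floor (1 / (3 * r)))"
    have "1 / (3 * r) \<ge> 2" using True r by (simp add: field_simps)
    then have m: "real m \<le> 1 / (3 * r)" "real m \<ge> 1 / (3 * r) - 1" "m > 0" unfolding m_def by linarith+
    have m1: "3 * r * real m \<le> 1" using m(1) r by (simp add: field_simps)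
    have m2: "1 \<le> 6 * r * real m"
    proof -
      have "1 / (3 * r) - 1 \<ge> 1 / (6 * r)" using True r by (simp add: field_simps)
      then have "real m \<ge> 1 / (6 * r)" using m by linarith
      then show ?thesis using r by (simp add: field_simps)
    qed
    define c where "c k = (3 * r * real k) *\<^sub>R e" for k :: nat
    define T where "T k = (+) (- c k) -` ?A" for k :: nat
    have T_sets: "T k \<in> sets lborel" for k
    proof -
      have "(+) (- c k) \<in> borel_measurable borel" by measurable
      from measurable_sets_borel[OF this A] show ?thesis by (simp add: T_def)
    qed
    have T_meas: "measure lborel (T k) = measure lborel ?A" for k
    proof -
      have "measure lborel ?A = measure (distr lborel borel ((+) (- c k))) ?A" by (simp only: lborel_distr_plus)
      also have "\<dots> = measure lborel (T k)" by (subst measure_distr) (simp_all add: T_def A)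
      finally show ?thesis by simp
    qed
    have disj: "disjoint_family_on T {..<m}"
      unfolding disjoint_family_on_def
    proof (intro ballI impI)
      fix i j :: nat assume "i \<noteq> j"
      have *: "\<bar>e \<bullet> u - 3 * r * real k\<bar> \<le> r" if "u \<in> T k" for u k
        using that e by (simp add: T_def c_def inner_diff_right dot_square_norm)
      show "T i \<inter> T j = {}"
      proof (rule ccontr)
        assume "T i \<inter> T j \<noteq> {}"
        then obtain u where "u \<in> T i" "u \<in> T j" by auto
        then have "\<bar>3 * r * real i - 3 * r * real j\<bar> \<le> 2 * r" using *[of u i] *[of u j] by linarith
        then have "3 * r * \<bar>real i - real j\<bar> \<le> 2 * r"
          unfolding right_diff_distrib[symmetric] abs_mult using r by simp
        moreover have "\<bar>real i - real j\<bar> \<ge> 1" using \<open>i \<noteq> j\<close> by linarith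
        then have "3 * r * \<bar>real i - real j\<bar> \<ge> 3 * r * 1" using r by (intro mult_left_mono) auto
        ultimately show False using r by linarith
      qed
    qed
    have sub: "T k \<subseteq> ball 0 2" if "k < m" for k
    proof
      fix u assume "u \<in> T k"
      then have v: "norm (u - c k) < 1" by (simp add: T_def)
      have "3 * r * real k \<le> 3 * r * real m" using that r by (intro mult_left_mono) auto
      then have "3 * r * real k \<le> 1" using m1 by (rule order_trans)
      then have "norm (c k) \<le> 1" using r e by (simp add: c_def)
      then show "u \<in> ball 0 2" using v norm_triangle_ineq[of "c k" "u - c k"] by simp
    qed
    have finT: "emeasure lborel (T k) \<noteq> \<infinity>" if "k < m" for k
      using emeasure_mono[OF sub[OF that], of lborel] fin2 by auto
    have "real m * measure lborel ?A = (\<Sum>k<m. measure lborel (T k))" by (simp add: T_meas)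
    also have "\<dots> = measure lborel (\<Union>k<m. T k)"
      using disj T_sets finT by (intro measure_finite_Union[symmetric]) auto
    also have "\<dots> \<le> measure lborel (ball (0::'a) 2)"
      using sub fin2 T_sets by (intro measure_mono_fmeasurable fmeasurableI) (auto intro: sets.finite_UN)
    finally have "real m * measure lborel ?A \<le> measure lborel (ball (0::'a) 2)" .
    then have "6 * r * (real m * measure lborel ?A) \<le> 6 * r * measure lborel (ball (0::'a) 2)"
      using r by (intro mult_left_mono) auto
    moreover have "1 * measure lborel ?A \<le> 6 * r * real m * measure lborel ?A"
      using m2 by (intro mult_right_mono) auto
    ultimately show ?thesis by (simp add: mult.assoc)
  qed
qed


text \<open>A ball that meets the support lies in a ball of twice the radius centered in the support.\<close>

lemma small_balls_of_support:
  assumes sets: "sets \<rho> = sets borel" and K: "K \<ge> 0" "s > 0"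
    and supp: "AE y in \<rho>. y \<in> A"
    and centre: "\<And>x (n::nat). x \<in> A \<Longrightarrow> emeasure \<rho> {y. norm (x - y) \<le> 2 * (s * exp (- real n))} \<le> ennreal (K * exp (- real n))"
  shows "small_balls \<rho> s K"
  unfolding small_balls_def
proof (intro allI)
  fix x and n :: nat
  let ?r = "s * exp (- real n)"
  have sp: "space \<rho> = UNIV" using sets_eq_imp_space_eq[OF sets] by simp
  have [measurable_cong]: "sets \<rho> = sets borel" by (rule sets)
  show "emeasure \<rho> {y. norm (x - y) \<le> ?r} \<le> ennreal (K * exp (- real n))"
  proof (cases "\<exists>z\<in>A. norm (x - z) \<le> ?r")
    case True
    then obtain z where z: "z \<in> A" "norm (x - z) \<le> ?r" by blast
    have "norm (z - y) \<le> 2 * ?r" if "norm (x - y) \<le> ?r" for y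
      using z(2) that norm_triangle_ineq4[of "x - y" "x - z"] by simp
    then have "emeasure \<rho> {y. norm (x - y) \<le> ?r} \<le> emeasure \<rho> {y. norm (z - y) \<le> 2 * ?r}"
      using sets by (intro emeasure_mono) (auto simp: sets)
    then show ?thesis using centre[OF z(1), of n] by (rule order_trans)
  next
    case False
    then have "AE y in \<rho>. \<not> norm (x - y) \<le> ?r" using supp by (auto elim: eventually_mono)
    then have "emeasure \<rho> {y. norm (x - y) \<le> ?r} = 0"
      by (subst (asm) AE_iff_measurable[where N = "{y. norm (x - y) \<le> ?r}"]) (auto simp: sp)
    then show ?thesis by simp
  qed
qed

lemma sets_sphere_measure [simp, measurable_cong]: "sets sphere_measure = sets borel"
  by (simp add: sphere_measure_def)

lemma measurable_sgn [measurable]: "sgn \<in> borel_measurable (borel :: 'a::euclidean_space measure)"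
  unfolding sgn_div_norm[abs_def] by measurable

lemma emeasure_ball_pos_finite: 
  "emeasure lborel (ball (0::'a::euclidean_space) 1) \<noteq> 0" "emeasure lborel (ball (0::'a) 1) \<noteq> \<infinity>"
proof -
  show "emeasure lborel (ball (0::'a) 1) \<noteq> \<infinity>"
    using emeasure_bounded_finite[of "ball (0::'a) 1"] by auto
  show "emeasure lborel (ball (0::'a) 1) \<noteq> 0"
    using content_ball_pos[of 1 "0::'a"] by (auto simp: measure_def)
qed

lemma prob_space_unit_ball: "prob_space (uniform_measure lborel (ball (0::'a::euclidean_space) 1))"
  using emeasure_ball_pos_finite by (intro prob_space_uniform_measure)

lemma prob_space_sphere_measure: "prob_space (sphere_measure :: 'a::euclidean_space measure)"
  unfolding sphere_measure_def by (intro prob_space.prob_space_distr prob_space_unit_ball) simp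

lemma sphere_measure_AE: "AE y in (sphere_measure :: 'a::euclidean_space measure). norm y = 1"
proof -
  have "AE u in lborel. u \<noteq> (0::'a)" by (rule AE_lborel_singleton)
  then have "AE u in uniform_measure lborel (ball (0::'a) 1). norm (sgn u) = 1"
    using emeasure_ball_pos_finite emeasure_bounded_finite[of "ball (0::'a) 1"]
    by (subst AE_uniform_measure) (auto simp: norm_sgn)
  then show ?thesis
    unfolding sphere_measure_def by (subst AE_distr_iff) auto
qed

text \<open>Let \<open>e\<close> be a unit vector orthogonal to \<open>w\<close>. If the direction of \<open>u\<close> is within \<open>r\<close> of \<open>w\<close>,
  then \<open>u\<close> lies in the slab of half-width \<open>r\<close> orthogonal to \<open>e\<close>, because
  \<open>e \<bullet> u = norm u * (e \<bullet> (sgn u - w))\<close>.\<close>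

lemma sphere_cap_le:
  fixes w :: "'a::euclidean_space"
  assumes d: "DIM('a) \<ge> 2" and w: "norm w = 1" and r: "r > 0"
  shows "emeasure sphere_measure {y. norm (w - y) \<le> r}
    \<le> ennreal (6 * r * (measure lborel (ball (0::'a) 2) / measure lborel (ball (0::'a) 1)))"
proof -
  let ?B = "ball (0::'a) 1"
  have B: "measure lborel ?B > 0" using content_ball_pos[of 1 "0::'a"] by simp
  have eB: "emeasure lborel ?B = ennreal (measure lborel ?B)"
    using emeasure_ball_pos_finite(2) by (intro emeasure_eq_ennreal_measure) auto
  obtain e0 where e0: "e0 \<noteq> 0" "orthogonal w e0" using orthogonal_to_vector_exists[OF d] by blast
  define e where "e = sgn e0"
  have e: "norm e = 1" "e \<bullet> w = 0" using e0 by (auto simp: e_def norm_sgn orthogonal_def sgn_div_norm inner_commute)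
  let ?A = "{u \<in> ball 0 1. \<bar>e \<bullet> u\<bar> \<le> r}"
  have A_eq: "?A = ball 0 1 \<inter> {u. \<bar>e \<bullet> u\<bar> \<le> r}" by auto
  have A [measurable]: "?A \<in> sets borel" unfolding A_eq by measurable
  have eA: "emeasure lborel ?A = ennreal (measure lborel ?A)"
  proof (rule emeasure_eq_ennreal_measure)
    have "bounded ?A" by (rule bounded_subset[OF bounded_ball[of 0 1]]) auto
    from emeasure_bounded_finite[OF this] show "emeasure lborel ?A \<noteq> top" by simp
  qed
  have sub: "?B \<inter> {u. norm (w - sgn u) \<le> r} \<subseteq> ?A"
  proof
    fix u assume u: "u \<in> ?B \<inter> {u. norm (w - sgn u) \<le> r}"
    have "u = norm u *\<^sub>R sgn u" by (cases "u = 0") (simp_all add: sgn_div_norm)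
    then have "e \<bullet> u = norm u * (e \<bullet> (sgn u - w))" using e(2) by (metis diff_zero inner_diff_right inner_scaleR_right)
    then have "\<bar>e \<bullet> u\<bar> = norm u * \<bar>e \<bullet> (sgn u - w)\<bar>" by (simp add: abs_mult)
    also have "\<dots> \<le> 1 * (norm e * norm (sgn u - w))"
      using u by (intro mult_mono Cauchy_Schwarz_ineq2) auto
    also have "\<dots> \<le> r" using u e(1) by (simp add: norm_minus_commute)
    finally show "u \<in> ?A" using u by simp
  qed
  have "emeasure sphere_measure {y. norm (w - y) \<le> r} = emeasure (uniform_measure lborel ?B) {u. norm (w - sgn u) \<le> r}"
    unfolding sphere_measure_def by (subst emeasure_distr) (auto simp: vimage_def)
  also have "\<dots> = emeasure lborel (?B \<inter> {u. norm (w - sgn u) \<le> r}) / emeasure lborel ?B"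
    by (subst emeasure_uniform_measure) auto
  also have "\<dots> \<le> emeasure lborel ?A / emeasure lborel ?B"
    by (intro divide_right_mono_ennreal emeasure_mono sub) (simp add: A)
  also have "\<dots> = ennreal (measure lborel ?A / measure lborel ?B)"
    unfolding eA eB using B by (intro divide_ennreal) auto
  also have "\<dots> \<le> ennreal (6 * r * measure lborel (ball (0::'a) 2) / measure lborel ?B)"
    using slab_volume_le[OF e(1) r] B by (intro ennreal_leI divide_right_mono) auto
  finally show ?thesis by simp
qed

lemma sphere_small_balls:
  assumes "DIM('a::euclidean_space) \<ge> 2"
  obtains K where "K \<ge> 0" "small_balls (sphere_measure :: 'a measure) 1 K"
proof
  define K where "K = 12 * (measure lborel (ball (0::'a) 2) / measure lborel (ball (0::'a) 1))"
  show K: "K \<ge> 0" by (simp add: K_def)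
  show "small_balls (sphere_measure :: 'a measure) 1 K"
  proof (rule small_balls_of_support[OF _ K, where A = "{y. norm y = 1}"])
    show "AE y in (sphere_measure :: 'a measure). y \<in> {y. norm y = 1}"
      using sphere_measure_AE by simp
  next
    fix x :: 'a and n :: nat assume "x \<in> {y. norm y = 1}"
    then show "emeasure sphere_measure {y. norm (x - y) \<le> 2 * (1 * exp (- real n))} \<le> ennreal (K * exp (- real n))"
      using sphere_cap_le[OF assms, of x "2 * (1 * exp (- real n))"] by (simp add: K_def mult_ac)
  qed auto
qed

definition axis_cube :: "real \<Rightarrow> real^'n \<Rightarrow> (real^'n) set" where
  "axis_cube \<epsilon> x = {y. \<forall>i. \<bar>y $ i - x $ i\<bar> \<le> \<epsilon>}"

lemma axis_cube_eq_cbox: "axis_cube \<epsilon> x = cbox (x - (\<chi> i. \<epsilon>)) (x + (\<chi> i. \<epsilon>))"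
  by (auto simp: axis_cube_def mem_box_cart abs_le_iff algebra_simps)

lemma emeasure_axis_cube: "\<epsilon> \<ge> 0 \<Longrightarrow> emeasure lborel (axis_cube \<epsilon> (x :: real^'n)) = ennreal ((2 * \<epsilon>) ^ CARD('n))"
proof -
  assume "\<epsilon> \<ge> 0"
  have b: "((x + (\<chi> i. \<epsilon>)) - (x - (\<chi> i. \<epsilon>))) \<bullet> b = 2 * \<epsilon>" "(x - (\<chi> i. \<epsilon>)) \<bullet> b \<le> (x + (\<chi> i. \<epsilon>)) \<bullet> b" if "b \<in> Basis" for b
    using that \<open>\<epsilon> \<ge> 0\<close> by (auto simp: Basis_vec_def inner_axis)
  have "emeasure lborel (axis_cube \<epsilon> x) = ennreal (\<Prod>b\<in>Basis. ((x + (\<chi> i. \<epsilon>)) - (x - (\<chi> i. \<epsilon>))) \<bullet> b)"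
    unfolding axis_cube_eq_cbox by (rule emeasure_lborel_cbox) (rule b)
  also have "(\<Prod>b\<in>Basis. ((x + (\<chi> i. \<epsilon>)) - (x - (\<chi> i. \<epsilon>))) \<bullet> b) = (\<Prod>b\<in>(Basis :: (real^'n) set). 2 * \<epsilon>)"
    by (intro prod.cong refl b)
  finally show ?thesis by simp
qed

definition box_measure :: "real \<Rightarrow> real^'n \<Rightarrow> (real^'n) measure" where
  "box_measure \<epsilon> x = uniform_measure lborel (axis_cube \<epsilon> x)"

lemma sets_box_measure [simp, measurable_cong]: "sets (box_measure \<epsilon> x) = sets borel"
  by (simp add: box_measure_def)

lemma sets_axis_cube [measurable]: "axis_cube \<epsilon> x \<in> sets borel"
  by (simp add: axis_cube_eq_cbox)

lemma prob_space_box_measure: "\<epsilon> > 0 \<Longrightarrow> prob_space (box_measure \<epsilon> x)"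
  unfolding box_measure_def by (intro prob_space_uniform_measure) (simp_all add: emeasure_axis_cube)

lemma box_measure_AE: "AE y in box_measure \<epsilon> x. y \<in> axis_cube \<epsilon> x"
  unfolding box_measure_def by (rule AE_uniform_measureI) auto

text \<open>A Euclidean ball of radius \<open>\<epsilon> q\<close> lies in a cube that has \<open>q ^ CARD('n)\<close> times the volume of the
  cube with parameter \<open>\<epsilon>\<close>, and \<open>q ^ CARD('n) \<le> q\<close> for \<open>q \<le> 1\<close>.\<close>

lemma box_small_balls:
  assumes "0 < \<epsilon>"
  shows "small_balls (box_measure \<epsilon> (x :: real^'n)) \<epsilon> 1"
  unfolding small_balls_def
proof (intro allI)
  fix z :: "real^'n" and n :: nat
  let ?q = "exp (- real n)"
  have q: "0 < ?q" "?q \<le> 1" by simp_all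
  have sub: "{y. norm (z - y) \<le> \<epsilon> * ?q} \<subseteq> axis_cube (\<epsilon> * ?q) z"
    unfolding axis_cube_def
  proof safe
    fix y i assume "norm (z - y) \<le> \<epsilon> * ?q"
    then show "\<bar>y $ i - z $ i\<bar> \<le> \<epsilon> * ?q"
      using component_le_norm_cart[of "z - y" i] by (simp add: abs_minus_commute)
  qed
  have "emeasure (box_measure \<epsilon> x) {y. norm (z - y) \<le> \<epsilon> * ?q} = emeasure lborel (axis_cube \<epsilon> x \<inter> {y. norm (z - y) \<le> \<epsilon> * ?q}) / emeasure lborel (axis_cube \<epsilon> x)"
    unfolding box_measure_def by (rule emeasure_uniform_measure) auto
  also have "\<dots> \<le> emeasure lborel (axis_cube (\<epsilon> * ?q) z) / emeasure lborel (axis_cube \<epsilon> x)"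
    using sub by (intro divide_right_mono_ennreal emeasure_mono) auto
  also have "\<dots> = ennreal ((2 * (\<epsilon> * ?q)) ^ CARD('n) / (2 * \<epsilon>) ^ CARD('n))"
    using assms by (simp add: emeasure_axis_cube divide_ennreal)
  also have "(2 * (\<epsilon> * ?q)) ^ CARD('n) / (2 * \<epsilon>) ^ CARD('n) = ?q ^ CARD('n)"
    using assms by (simp add: power_mult_distrib)
  also have "ennreal (?q ^ CARD('n)) \<le> ennreal (?q ^ 1)"
    using q by (intro ennreal_leI power_decreasing) (auto simp: Suc_leI)
  finally show "emeasure (box_measure \<epsilon> x) {y. norm (z - y) \<le> \<epsilon> * ?q} \<le> ennreal (1 * ?q)" by simp
qed

lemma axis_cube_norm_le:
  fixes x :: "real^'n"
  assumes "\<forall>i. 0 \<le> x $ i \<and> x $ i \<le> 1" "\<epsilon> \<le> 1" "y \<in> axis_cube \<epsilon> x"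
  shows "norm y \<le> 2 * real CARD('n)"
proof -
  have "\<bar>y $ i\<bar> \<le> 2" for i
    using assms(1)[THEN spec, of i] assms(2) assms(3)[unfolded axis_cube_def, THEN CollectD, THEN spec, of i] by linarith
  then have "(\<Sum>i\<in>UNIV. \<bar>y $ i\<bar>) \<le> (\<Sum>i\<in>(UNIV :: 'n set). 2)" by (intro sum_mono)
  then show ?thesis using norm_le_l1_cart[of y] by simp
qed

text \<open>The variance of \<open>h\<close> averaged over a small cube is \<open>ln (1 / \<epsilon>)\<close> up to a constant:
  only the self-energy of the cube depends on \<open>\<epsilon>\<close> to leading order, while the energy of the sphere
  is a constant and the mixed terms are bounded below because both supports are bounded.\<close>

theorem box_charge:
  assumes card: "CARD('n) \<ge> 2"
  obtains C where
    "\<And>\<epsilon> (x :: real^'n). 0 < \<epsilon> \<Longrightarrow> \<epsilon> \<le> 1 \<Longrightarrow> \<forall>i. 0 \<le> x $ i \<and> x $ i \<le> 1 \<Longrightarrow> (box_measure \<epsilon> x, sphere_measure) \<in> neutral_charges"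
    "\<And>\<epsilon> (x :: real^'n). 0 < \<epsilon> \<Longrightarrow> \<epsilon> \<le> 1 \<Longrightarrow> \<forall>i. 0 \<le> x $ i \<and> x $ i \<le> 1 \<Longrightarrow>
      log_cov (box_measure \<epsilon> x, sphere_measure) (box_measure \<epsilon> x, sphere_measure) \<le> ln (1 / \<epsilon>) + C"
proof -
  obtain K where K: "K \<ge> 0" "small_balls (sphere_measure :: (real^'n) measure) 1 K"
    using sphere_small_balls[where 'a = "real^'n"] card by auto
  define R where "R = 2 * real CARD('n)"
  have R: "R \<ge> 1" using card by (simp add: R_def)
  note \<sigma> = prob_space_sphere_measure[where 'a = "real^'n"]
  have \<sigma>_supp: "AE y in (sphere_measure :: (real^'n) measure). norm y \<le> R"
    using sphere_measure_AE by eventually_elim (use R in simp)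
  have B_supp: "AE y in box_measure \<epsilon> x. norm y \<le> R" 
    if "\<epsilon> \<le> 1" "\<forall>i. 0 \<le> x $ i \<and> x $ i \<le> 1" for \<epsilon> :: real and x :: "real^'n"
    using box_measure_AE[of \<epsilon> x] by eventually_elim (use axis_cube_norm_le[OF that(2,1)] in \<open>simp add: R_def\<close>)
  show ?thesis
  proof (rule that[where C = "geom_const + 2 * ln (2 * R) + K * geom_const"])
    fix \<epsilon> :: real and x :: "real^'n" assume \<epsilon>: "0 < \<epsilon>" "\<epsilon> \<le> 1" and x: "\<forall>i. 0 \<le> x $ i \<and> x $ i \<le> 1"
    let ?B = "box_measure \<epsilon> x" and ?\<sigma> = "sphere_measure :: (real^'n) measure"
    note B = prob_space_box_measure[OF \<epsilon>(1), of x] and B_supp = B_supp[OF \<epsilon>(2) x] and B_small = box_small_balls[OF \<epsilon>(1), of x]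
    interpret B: prob_space ?B by (rule B)
    interpret \<sigma>: prob_space ?\<sigma> by (rule \<sigma>)
    have "abs_log_energy \<rho>1 \<rho>2 < \<infinity>" if "\<rho>1 \<in> {?B, ?\<sigma>}" "\<rho>2 \<in> {?B, ?\<sigma>}" for \<rho>1 \<rho>2
    proof -
      have 1: "prob_space \<rho>1" "AE x in \<rho>1. norm x \<le> R" using that(1) B \<sigma> B_supp \<sigma>_supp by auto
      show ?thesis
      proof (cases "\<rho>2 = ?B")
        case True
        then show ?thesis
          using abs_log_energy_finite[OF 1(1) B _ B_small \<epsilon> _ 1(2) B_supp R] by simp
      next
        case False
        then have "\<rho>2 = ?\<sigma>" using that by simp
        then show ?thesis
          using abs_log_energy_finite[OF 1(1) \<sigma> _ K(2) _ _ K(1) 1(2) \<sigma>_supp R] by simp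
      qed
    qed
    moreover have "measure ?B UNIV = measure ?\<sigma> UNIV"
      using B.prob_space \<sigma>.prob_space by (simp add: sets_eq_imp_space_eq[OF sets_box_measure] sets_eq_imp_space_eq[OF sets_sphere_measure])
    ultimately show "(?B, ?\<sigma>) \<in> neutral_charges"
      unfolding neutral_charges_def using B.finite_measure_axioms \<sigma>.finite_measure_axioms by simp
    have "log_form ?B ?B \<le> 1 * geom_const + ln (1 / \<epsilon>)" by (rule log_form_le[OF B B _ B_small]) (use \<epsilon> in auto)
    moreover have "log_form ?\<sigma> ?\<sigma> \<le> K * geom_const + ln (1 / 1)" by (rule log_form_le[OF \<sigma> \<sigma> _ K(2)]) (use K in auto)
    moreover have "- log_form ?B ?\<sigma> \<le> ln (2 * R)" by (rule log_form_ge[OF B \<sigma> B_supp \<sigma>_supp R])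
    moreover have "- log_form ?\<sigma> ?B \<le> ln (2 * R)" by (rule log_form_ge[OF \<sigma> B \<sigma>_supp B_supp R])
    ultimately show "log_cov (?B, ?\<sigma>) (?B, ?\<sigma>) \<le> ln (1 / \<epsilon>) + (geom_const + 2 * ln (2 * R) + K * geom_const)"
      unfolding log_cov_def by simp
  qed
qed

section \<open>Lattice paths and their vertex sets\<close>

text \<open>Cut out the loop between two visits to the same vertex, and repeat.\<close>

lemma lattice_paths_injective:
  assumes "(N, P) \<in> lattice_paths \<epsilon> z w A"
  shows "\<exists>N' P'. (N', P') \<in> lattice_paths \<epsilon> z w A \<and> inj_on P' {1..N'} \<and> P' ` {1..N'} \<subseteq> P ` {1..N}"
  using assms
proof (induction N arbitrary: P rule: less_induct)
  case (less N P)
  note path = less.prems[unfolded lattice_paths_def, simplified]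
  show ?case
  proof (cases "inj_on P {1..N}")
    case True
    then show ?thesis using less.prems by blast
  next
    case False
    then obtain a b where ab: "a \<in> {1..N}" "b \<in> {1..N}" "P a = P b" "a \<noteq> b"
      by (auto simp: inj_on_def)
    define i where "i = min a b"
    define j where "j = max a b"
    have ij: "1 \<le> i" "i < j" "j \<le> N" "P i = P j"
      using ab by (auto simp: i_def j_def min_def max_def)
    \<comment> \<open>Drop the vertices \<open>i + 1, \<dots>, j\<close>.\<close>
    define N' where "N' = N - (j - i)"
    define P' where "P' m = (if m \<le> i then P m else P (m + (j - i)))" for m
    have N': "N' < N" "1 \<le> N'" "i \<le> N'" using ij by (auto simp: N'_def)
    have img: "P' m \<in> P ` {1..N}" if "m \<in> {1..N'}" for m
      using that ij by (auto simp: P'_def N'_def intro!: imageI)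
    have "(N', P') \<in> lattice_paths \<epsilon> z w A"
      unfolding lattice_paths_def
    proof (clarsimp, intro conjI ballI)
      show "Suc 0 \<le> N'" using N' by simp
      show "P' (Suc 0) = z" using path ij by (simp add: P'_def)
      show "P' N' = w"
      proof (cases "N' \<le> i")
        case True
        then have "N' = i" "j = N" using N' ij by (auto simp: N'_def)
        then show ?thesis using path ij by (simp add: P'_def)
      next
        case False
        then have "N' + (j - i) = N" using ij by (auto simp: N'_def)
        then show ?thesis using path False by (simp add: P'_def)
      qed
      fix m assume "m \<in> {Suc 0..N'}"
      then have "P' m \<in> P ` {1..N}" by (intro img) simp
      then show "P' m \<in> A" "P' m \<in> lattice \<epsilon>" using path by auto
    next
      fix m assume m: "m \<in> {Suc 0..<N'}"
      consider "m < i" | "m = i" | "m > i" by linarith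
      then show "dist (P' m) (P' (Suc m)) = \<epsilon>"
      proof cases
        case 1
        then show ?thesis using path m ij by (simp add: P'_def)
      next
        case 2
        then have "j \<in> {Suc 0..<N}" using m ij by (auto simp: N'_def)
        moreover have "Suc i + (j - i) = Suc j" using ij by simp
        ultimately show ?thesis using path 2 ij(4) by (simp add: P'_def)
      next
        case 3
        then have "m + (j - i) \<in> {Suc 0..<N}" using m ij by (auto simp: N'_def)
        then show ?thesis using path 3 by (simp add: P'_def)
      qed
    qed
    from less.IH[OF N'(1) this] obtain N'' P'' where
      "(N'', P'') \<in> lattice_paths \<epsilon> z w A" "inj_on P'' {1..N''}" "P'' ` {1..N''} \<subseteq> P' ` {1..N'}"
      by blast
    then show ?thesis using img by (meson image_subsetI order_trans)
  qed
qed

definition crossing_sets :: "'n \<Rightarrow> real \<Rightarrow> (real^'n) set set" where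
  "crossing_sets k \<epsilon> = {P ` {1..N} | N P z w. z \<in> left_face k \<epsilon> \<and> w \<in> right_face k \<epsilon> \<and>
     (N, P) \<in> lattice_paths \<epsilon> z w (lattice_cube \<epsilon>)}"

lemma crossing_sets_subset: "A \<in> crossing_sets k \<epsilon> \<Longrightarrow> A \<subseteq> lattice_cube \<epsilon>"
  by (auto simp: crossing_sets_def lattice_paths_def)

lemma crossing_sets_nonempty: "A \<in> crossing_sets k \<epsilon> \<Longrightarrow> A \<noteq> {}"
  by (auto simp: crossing_sets_def lattice_paths_def)

lemma lattice_cube_finite_card:
  assumes n: "0 < n"
  shows "finite (lattice_cube (1 / real n) :: (real^'n) set)"
    and "card (lattice_cube (1 / real n) :: (real^'n) set) \<le> (n + 1) ^ CARD('n)"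
proof -
  let ?F = "Pi\<^sub>E (UNIV :: 'n set) (\<lambda>_. {0..n})"
  let ?g = "\<lambda>f::'n \<Rightarrow> nat. (\<chi> i. real (f i) / real n) :: real^'n"
  have sub: "lattice_cube (1 / real n) \<subseteq> ?g ` ?F"
  proof
    fix x :: "real^'n" assume x: "x \<in> lattice_cube (1 / real n)"
    then obtain m :: "'n \<Rightarrow> int" where m: "\<And>i. x $ i = 1 / real n * of_int (m i)"
      unfolding lattice_cube_def lattice_def by (simp, metis)
    have b: "0 \<le> x $ i" "x $ i \<le> 1" for i using x by (auto simp: lattice_cube_def)
    have mi: "0 \<le> m i" "m i \<le> int n" for i
    proof -
      have "0 \<le> of_int (m i) / real n" "of_int (m i) / real n \<le> 1" using b[of i] m[of i] by simp_all
      then have "0 \<le> real_of_int (m i)" "real_of_int (m i) \<le> real n" using n by (simp_all add: field_simps)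
      then show "0 \<le> m i" "m i \<le> int n" by linarith+
    qed
    have "x = ?g (\<lambda>i. nat (m i))" using m mi by (simp add: vec_eq_iff)
    moreover have "(\<lambda>i. nat (m i)) \<in> ?F" using mi by (auto simp: nat_le_iff)
    ultimately show "x \<in> ?g ` ?F" by (rule image_eqI)
  qed
  have fin: "finite ?F" by (intro finite_PiE) auto
  show "finite (lattice_cube (1 / real n) :: (real^'n) set)" by (rule finite_subset[OF sub finite_imageI[OF fin]])
  have "card (lattice_cube (1 / real n) :: (real^'n) set) \<le> card (?g ` ?F)" by (rule card_mono[OF finite_imageI[OF fin] sub])
  also have "\<dots> \<le> card ?F" by (rule card_image_le[OF fin])
  also have "\<dots> = (n + 1) ^ CARD('n)" by (simp add: card_PiE)
  finally show "card (lattice_cube (1 / real n) :: (real^'n) set) \<le> (n + 1) ^ CARD('n)" .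
qed

text \<open>The straight path along the coordinate axis \<open>k\<close>.\<close>

lemma short_crossing:
  assumes n: "0 < n"
  shows "\<exists>A\<in>crossing_sets (k :: 'n::finite) (1 / real n). card A \<le> n + 1"
proof -
  define P :: "nat \<Rightarrow> real^'n" where "P i = (\<chi> c. if c = k then real (i - 1) / real n else 0)" for i
  have cube: "P i \<in> lattice_cube (1 / real n)" if "i \<in> {1..n + 1}" for i
  proof -
    have "\<exists>m::int. P i $ c = 1 / real n * of_int m" for c
      by (rule exI[of _ "if c = k then int (i - 1) else 0"]) (simp add: P_def)
    moreover have "real (i - 1) \<le> real n" using that by simp
    then have "real (i - 1) / real n \<le> 1" using n by simp
    ultimately show ?thesis by (simp add: lattice_cube_def lattice_def P_def)
  qed
  have dist: "dist (P i) (P (Suc i)) = 1 / real n" if "1 \<le> i" for i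
  proof -
    have "real i - real (i - 1) = 1" using that by (simp add: of_nat_diff)
    then have "P (Suc i) - P i = axis k (1 / real n)"
      by (simp add: P_def vec_eq_iff axis_def diff_divide_distrib[symmetric])
    then have "dist (P (Suc i)) (P i) = norm (axis k (1 / real n) :: real^'n)" by (simp only: dist_norm)
    then show ?thesis by (simp add: dist_commute norm_eq_sqrt_inner inner_axis_axis real_sqrt_divide real_sqrt_abs2)
  qed
  have "(n + 1, P) \<in> lattice_paths (1 / real n) (P 1) (P (n + 1)) (lattice_cube (1 / real n))"
    using cube dist by (auto simp: lattice_paths_def lattice_cube_def)
  moreover have "P 1 \<in> left_face k (1 / real n)" "P (n + 1) \<in> right_face k (1 / real n)"
    using cube[of 1] cube[of "n + 1"] n by (simp_all add: left_face_def right_face_def) (simp_all add: P_def)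
  ultimately have "P ` {1..n + 1} \<in> crossing_sets k (1 / real n)"
    unfolding crossing_sets_def by blast
  moreover have "card (P ` {1..n + 1}) \<le> n + 1" using card_image_le[of "{1..n + 1}" P] by simp
  ultimately show ?thesis by blast
qed

text \<open>The cost of a vertex set is at most the length of a path through it, with equality for an injective
  path. Since the cube has finitely many subsets, the infimum over paths is attained.\<close>

lemma lfpp_set_dist_le_iff:
  fixes g :: "(real^'n) measure \<times> (real^'n) measure \<Rightarrow> real"
  assumes n: "0 < n" and \<epsilon>: "\<epsilon> = 1 / real n" and t: "t \<ge> 0"
  shows "lfpp_set_dist g \<epsilon> \<xi> (left_face k \<epsilon>) (right_face k \<epsilon>) (lattice_cube \<epsilon>) \<le> ennreal t \<longleftrightarrow>
    (\<exists>A\<in>crossing_sets k \<epsilon>. (\<Sum>x\<in>A. exp (\<xi> * box_average g \<epsilon> x) / real n) \<le> t)"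
proof -
  define c where "c x = \<epsilon> * exp (\<xi> * box_average g \<epsilon> x)" for x
  have c0: "c x \<ge> 0" for x using n \<epsilon> by (simp add: c_def)
  have c_eq: "exp (\<xi> * box_average g \<epsilon> x) / real n = c x" for x by (simp add: c_def \<epsilon>)
  have fin: "finite (crossing_sets k \<epsilon>)"
    using crossing_sets_subset lattice_cube_finite_card(1)[OF n] unfolding \<epsilon>
    by (meson PowI finite_Pow_iff finite_subset subsetI)
  have len: "lfpp_length g \<epsilon> \<xi> (N, P) = (\<Sum>i=1..N. c (P i))" for N P
    by (simp add: lfpp_length_def c_def)
  have img: "(\<Sum>x\<in>P ` {1..N}. c x) \<le> lfpp_length g \<epsilon> \<xi> (N, P)" for N and P :: "nat \<Rightarrow> real^'n"
    unfolding len using sum_image_le[of "{1..N}" c P] c0 by simp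
  show ?thesis
    unfolding c_eq
  proof
    assume le: "lfpp_set_dist g \<epsilon> \<xi> (left_face k \<epsilon>) (right_face k \<epsilon>) (lattice_cube \<epsilon>) \<le> ennreal t"
    show "\<exists>A\<in>crossing_sets k \<epsilon>. (\<Sum>x\<in>A. c x) \<le> t"
    proof (rule ccontr)
      assume "\<not> ?thesis"
      then have gt: "t < (\<Sum>x\<in>A. c x)" if "A \<in> crossing_sets k \<epsilon>" for A using that by auto
      \<comment> \<open>The point \<open>t + 1\<close> makes the set nonempty even if there were no crossing.\<close>
      define m where "m = Min (insert (t + 1) ((\<lambda>A. \<Sum>x\<in>A. c x) ` crossing_sets k \<epsilon>))"
      have "t < m" unfolding m_def using fin gt by (subst Min_gr_iff) auto
      have m_le: "m \<le> (\<Sum>x\<in>A. c x)" if "A \<in> crossing_sets k \<epsilon>" for A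
        unfolding m_def using fin that by (intro Min_le) auto
      have "ennreal m \<le> lfpp_set_dist g \<epsilon> \<xi> (left_face k \<epsilon>) (right_face k \<epsilon>) (lattice_cube \<epsilon>)"
        unfolding lfpp_set_dist_def lfpp_dist_def
      proof (intro INF_greatest)
        fix z w p assume zw: "z \<in> left_face k \<epsilon>" "w \<in> right_face k \<epsilon>" "p \<in> lattice_paths \<epsilon> z w (lattice_cube \<epsilon>)"
        obtain N P where p: "p = (N, P)" by (cases p)
        have "P ` {1..N} \<in> crossing_sets k \<epsilon>" using zw unfolding p crossing_sets_def by blast
        then have "m \<le> lfpp_length g \<epsilon> \<xi> p" using m_le img unfolding p by (meson order_trans)
        then show "ennreal m \<le> ennreal (lfpp_length g \<epsilon> \<xi> p)" by (rule ennreal_leI)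
      qed
      then have "ennreal m \<le> ennreal t" using le by (rule order_trans)
      then show False using \<open>t < m\<close> t by (simp add: ennreal_le_iff)
    qed
  next
    assume "\<exists>A\<in>crossing_sets k \<epsilon>. (\<Sum>x\<in>A. c x) \<le> t"
    then obtain N P z w where zw: "z \<in> left_face k \<epsilon>" "w \<in> right_face k \<epsilon>" "(N, P) \<in> lattice_paths \<epsilon> z w (lattice_cube \<epsilon>)"
      and le: "(\<Sum>x\<in>P ` {1..N}. c x) \<le> t" unfolding crossing_sets_def by blast
    obtain N' P' where P': "(N', P') \<in> lattice_paths \<epsilon> z w (lattice_cube \<epsilon>)" "inj_on P' {1..N'}" "P' ` {1..N'} \<subseteq> P ` {1..N}"
      using lattice_paths_injective[OF zw(3)] by blast
    have "lfpp_length g \<epsilon> \<xi> (N', P') = (\<Sum>x\<in>P' ` {1..N'}. c x)"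
      unfolding len using P'(2) by (simp add: sum.reindex)
    also have "\<dots> \<le> (\<Sum>x\<in>P ` {1..N}. c x)" using P'(3) c0 by (intro sum_mono2) auto
    also have "\<dots> \<le> t" by (rule le)
    finally have "ennreal (lfpp_length g \<epsilon> \<xi> (N', P')) \<le> ennreal t" by (rule ennreal_leI)
    then show "lfpp_set_dist g \<epsilon> \<xi> (left_face k \<epsilon>) (right_face k \<epsilon>) (lattice_cube \<epsilon>) \<le> ennreal t"
      unfolding lfpp_set_dist_def lfpp_dist_def
      using zw P'(1) by (intro INF_lower2[OF zw(1)] INF_lower2[OF zw(2)] INF_lower2[OF P'(1)])
  qed
qed

section \<open>Crossing costs at two parameters\<close>

text \<open>First passage percolation at scale \<open>1 / n\<close> on a finite set \<open>S n\<close>. The members of \<open>V n\<close> stand for the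
  vertex sets of the crossing paths; a short one bounds the exponent at \<open>\<xi> = 0\<close> from below.\<close>

locale gaussian_fpp = prob_space M for M :: "'w measure" +
  fixes dim :: nat
    and S :: "nat \<Rightarrow> 'v set" and V :: "nat \<Rightarrow> 'v set set"
    and H :: "nat \<Rightarrow> 'v \<Rightarrow> 'w \<Rightarrow> real" and C :: real
  assumes finite_S: "0 < n \<Longrightarrow> finite (S n)"
    and card_S: "0 < n \<Longrightarrow> card (S n) \<le> (n + 1) ^ dim"
    and V_subset: "0 < n \<Longrightarrow> A \<in> V n \<Longrightarrow> A \<subseteq> S n"
    and V_nonempty: "0 < n \<Longrightarrow> A \<in> V n \<Longrightarrow> A \<noteq> {}"
    and V_short: "0 < n \<Longrightarrow> \<exists>A\<in>V n. card A \<le> n + 1"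
    and gaussian: "0 < n \<Longrightarrow> centered_gaussian M (\<lambda>\<omega>. \<Sum>x\<in>S n. c x * H n x \<omega>)"
    and variance_le: "0 < n \<Longrightarrow> x \<in> S n \<Longrightarrow> (\<integral>\<omega>. (H n x \<omega>)\<^sup>2 \<partial>M) \<le> ln (real n) + C"
begin

definition cost :: "nat \<Rightarrow> real \<Rightarrow> 'w \<Rightarrow> 'v set \<Rightarrow> real" where
  "cost n \<xi> \<omega> A = (\<Sum>x\<in>A. exp (\<xi> * H n x \<omega>) / real n)"

definition fpp_event :: "nat \<Rightarrow> real \<Rightarrow> real \<Rightarrow> 'w set" where
  "fpp_event n \<xi> t = {\<omega> \<in> space M. \<exists>A\<in>V n. cost n \<xi> \<omega> A \<le> t}"

text \<open>The exponents over which the supremum in the definition of \<open>\<lambda>\<close> is taken.\<close>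

definition good :: "real \<Rightarrow> real set" where
  "good \<xi> = {\<alpha>. (\<lambda>n. prob (fpp_event n \<xi> (real n powr - \<alpha>))) \<longlonglongrightarrow> 1}"

definition exponent :: "real \<Rightarrow> real" where
  "exponent \<xi> = Sup (good \<xi>)"

lemma finite_V: "0 < n \<Longrightarrow> finite (V n)"
  using V_subset finite_S by (meson PowI finite_Pow_iff finite_subset subsetI)

lemma gaussian_H: 
  assumes "0 < n" "x \<in> S n"
  shows "centered_gaussian M (H n x)"
proof -
  have "(\<lambda>\<omega>. \<Sum>y\<in>S n. (if y = x then 1 else 0) * H n y \<omega>) = H n x"
    using assms finite_S by (auto simp: if_distrib[of "\<lambda>c. c * _"] cong: if_cong)
  then show ?thesis using gaussian[OF assms(1), of "\<lambda>y. if y = x then 1 else 0"] by simp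
qed

lemma measurable_H: "0 < n \<Longrightarrow> x \<in> S n \<Longrightarrow> H n x \<in> borel_measurable M"
  using gaussian_H by (auto simp: centered_gaussian_def)

lemma measurable_exp_H:
  assumes "0 < n" "x \<in> S n"
  shows "(\<lambda>\<omega>. exp (t * H n x \<omega>)) \<in> borel_measurable M"
proof -
  note [measurable] = measurable_H[OF assms]
  show ?thesis by measurable
qed

lemma measurable_cost:
  assumes "0 < n" "A \<in> V n"
  shows "(\<lambda>\<omega>. cost n \<xi> \<omega> A) \<in> borel_measurable M"
  unfolding cost_def using assms V_subset[OF assms]
  by (intro borel_measurable_sum borel_measurable_divide measurable_exp_H) auto

lemma events_fpp_event:
  assumes "0 < n"
  shows "fpp_event n \<xi> t \<in> events"
proof -
  have "fpp_event n \<xi> t = (\<Union>A\<in>V n. {\<omega> \<in> space M. cost n \<xi> \<omega> A \<le> t})"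
    by (auto simp: fpp_event_def)
  also have "\<dots> \<in> events"
    using measurable_cost assms by (intro sets.finite_UN finite_V) (auto intro!: borel_measurable_le)
  finally show ?thesis .
qed

text \<open>The Laplace transform of a Gaussian of variance at most \<open>ln n + C\<close>.\<close>

lemma exp_moment:
  assumes "0 < n" "x \<in> S n"
  shows "integrable M (\<lambda>\<omega>. exp (t * H n x \<omega>))"
    and "(\<integral>\<omega>. exp (t * H n x \<omega>) \<partial>M) \<le> exp (t\<^sup>2 * C / 2) * real n powr (t\<^sup>2 / 2)"
proof -
  note m = centered_gaussian_moments[OF prob_space_axioms gaussian_H[OF assms], of t]
  show "integrable M (\<lambda>\<omega>. exp (t * H n x \<omega>))" by (rule m)
  have "(\<integral>\<omega>. exp (t * H n x \<omega>) \<partial>M) \<le> exp (t\<^sup>2 * (ln (real n) + C) / 2)"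
    unfolding m(2) using variance_le[OF assms] by (simp add: mult_left_mono)
  also have "t\<^sup>2 * (ln (real n) + C) / 2 = t\<^sup>2 * C / 2 + t\<^sup>2 / 2 * ln (real n)"
    by (simp add: field_simps)
  also have "exp \<dots> = exp (t\<^sup>2 * C / 2) * real n powr (t\<^sup>2 / 2)"
    using assms(1) by (simp only: exp_add) (simp add: powr_def)
  finally show "(\<integral>\<omega>. exp (t * H n x \<omega>) \<partial>M) \<le> exp (t\<^sup>2 * C / 2) * real n powr (t\<^sup>2 / 2)" .
qed

lemma card_S_powr: "0 < n \<Longrightarrow> real (card (S n)) \<le> 2 ^ dim * real n powr real dim"
proof -
  assume n: "0 < n"
  have "real (card (S n)) \<le> real ((n + 1) ^ dim)" using card_S[OF n] by (simp only: of_nat_le_iff)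
  also have "\<dots> \<le> (2 * real n) ^ dim" unfolding of_nat_power using n by (intro power_mono) auto
  also have "\<dots> = 2 ^ dim * real n powr real dim" using n by (simp add: power_mult_distrib powr_realpow)
  finally show ?thesis .
qed

text \<open>Chernoff's bound for \<open>t * H n x \<omega> \<ge> t\<^sup>2 * ln n\<close>. Keeping the event in exponential form treats both signs
  of \<open>t\<close> at once.\<close>

lemma prob_exp_ge_le:
  assumes "0 < n" "x \<in> S n"
  shows "prob {\<omega> \<in> space M. exp (t * H n x \<omega>) \<ge> real n powr (t\<^sup>2)} \<le> exp (t\<^sup>2 * C / 2) * real n powr (- (t\<^sup>2 / 2))"
proof -
  have "prob {\<omega> \<in> space M. exp (t * H n x \<omega>) \<ge> real n powr (t\<^sup>2)} \<le> (\<integral>\<omega>. exp (t * H n x \<omega>) \<partial>M) / real n powr (t\<^sup>2)"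
    using assms by (intro integral_Markov_inequality_measure[where A = "{}"] exp_moment) auto
  also have "\<dots> \<le> exp (t\<^sup>2 * C / 2) * real n powr (t\<^sup>2 / 2) / real n powr (t\<^sup>2)"
    using exp_moment(2)[OF assms, of t] by (intro divide_right_mono) auto
  also have "\<dots> = exp (t\<^sup>2 * C / 2) * real n powr (- (t\<^sup>2 / 2))"
  proof -
    have "real n powr (t\<^sup>2 / 2) / real n powr (t\<^sup>2) = real n powr (- (t\<^sup>2 / 2))"
      unfolding powr_diff[symmetric] by simp
    then show ?thesis by (simp only: times_divide_eq_right[symmetric])
  qed
  finally show ?thesis .
qed

lemma powr_neg_tendsto_0:
  assumes "s > 0"
  shows "(\<lambda>n. K * real n powr (- s)) \<longlonglongrightarrow> 0"
  using tendsto_mult_right_zero[OF tendsto_neg_powr[OF _ filterlim_real_sequentially], of "- s" K] assms by simp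

text \<open>How a comparison between two parameters on the complement of an exceptional event becomes a
  comparison between exponents.\<close>

lemma good_transfer:
  assumes "\<alpha> \<in> good \<xi>"
    and ev: "\<And>n. 0 < n \<Longrightarrow> B n \<in> events"
    and sub: "eventually (\<lambda>n. fpp_event n \<xi> (real n powr - \<alpha>) \<subseteq> fpp_event n \<xi>' (real n powr - \<beta>) \<union> B n) sequentially"
    and B: "(\<lambda>n. prob (B n)) \<longlonglongrightarrow> 0"
  shows "\<beta> \<in> good \<xi>'"
  unfolding good_def mem_Collect_eq
proof (rule tendsto_sandwich)
  show "eventually (\<lambda>n. prob (fpp_event n \<xi> (real n powr - \<alpha>)) - prob (B n) \<le> prob (fpp_event n \<xi>' (real n powr - \<beta>))) sequentially"
    using sub eventually_gt_at_top[of 0]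
  proof eventually_elim
    case (elim n)
    have "prob (fpp_event n \<xi> (real n powr - \<alpha>)) \<le> prob (fpp_event n \<xi>' (real n powr - \<beta>) \<union> B n)"
      using elim by (intro finite_measure_mono sets.Un events_fpp_event ev) auto
    also have "\<dots> \<le> prob (fpp_event n \<xi>' (real n powr - \<beta>)) + prob (B n)"
      using elim by (intro measure_Un_le events_fpp_event ev) auto
    finally show ?case by simp
  qed
  show "eventually (\<lambda>n. prob (fpp_event n \<xi>' (real n powr - \<beta>)) \<le> 1) sequentially" by simp
  show "(\<lambda>n. prob (fpp_event n \<xi> (real n powr - \<alpha>)) - prob (B n)) \<longlonglongrightarrow> 1"
  proof -
    have "(\<lambda>n. prob (fpp_event n \<xi> (real n powr - \<alpha>))) \<longlonglongrightarrow> 1"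
      using assms(1) by (simp add: good_def)
    from tendsto_diff[OF this B] show ?thesis by simp
  qed
qed auto

lemma good_transfer_sure:
  assumes "\<alpha> \<in> good \<xi>"
    and "eventually (\<lambda>n. fpp_event n \<xi> (real n powr - \<alpha>) \<subseteq> fpp_event n \<xi>' (real n powr - \<beta>)) sequentially"
  shows "\<beta> \<in> good \<xi>'"
  using assms(2) by (intro good_transfer[OF assms(1), where B = "\<lambda>_. {}"]) auto

lemma good_mono:
  assumes "\<alpha> \<in> good \<xi>" "\<beta> \<le> \<alpha>"
  shows "\<beta> \<in> good \<xi>"
proof (rule good_transfer_sure[OF assms(1)], rule eventually_mono[OF eventually_gt_at_top[of 0]])
  fix n :: nat assume "0 < n"
  then have "real n powr - \<alpha> \<le> real n powr - \<beta>" using assms(2) by (intro powr_mono) auto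
  then show "fpp_event n \<xi> (real n powr - \<alpha>) \<subseteq> fpp_event n \<xi> (real n powr - \<beta>)"
    by (auto simp: fpp_event_def intro: order_trans)
qed

lemma good_zero: "\<alpha> < 0 \<Longrightarrow> \<alpha> \<in> good 0"
proof -
  assume \<alpha>: "\<alpha> < 0"
  have "(\<lambda>n. 1 * real n powr - (- \<alpha>)) \<longlonglongrightarrow> 0" using \<alpha> by (intro powr_neg_tendsto_0) auto
  then have "eventually (\<lambda>n. real n powr \<alpha> < 1 / 2) sequentially"
    by (intro order_tendstoD(2)[where y = 0]) auto
  then have "eventually (\<lambda>n. prob (fpp_event n 0 (real n powr - \<alpha>)) = 1) sequentially"
    using eventually_gt_at_top[of 0]
  proof eventually_elim
    case (elim n)
    obtain A where A: "A \<in> V n" "card A \<le> n + 1" using V_short elim by blast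
    have "real (card A) \<le> real n + 1" using A(2) by linarith
    then have "real (card A) / real n \<le> 2" using elim by (simp add: field_simps)
    moreover have "2 \<le> real n powr - \<alpha>" using elim by (simp add: powr_minus field_simps)
    ultimately have "cost n 0 \<omega> A \<le> real n powr - \<alpha>" for \<omega> by (simp add: cost_def)
    then have "fpp_event n 0 (real n powr - \<alpha>) = space M" using A by (auto simp: fpp_event_def)
    then show ?case by (simp add: prob_space)
  qed
  then show ?thesis unfolding good_def by (simp add: tendsto_eventually)
qed

text \<open>At \<open>\<xi> = 0\<close> the cost of a nonempty set is at least \<open>1 / n\<close>.\<close>

lemma good_zero_le: "\<alpha> \<in> good 0 \<Longrightarrow> \<alpha> \<le> 1"
proof (rule ccontr)
  assume \<alpha>: "\<alpha> \<in> good 0" "\<not> \<alpha> \<le> 1"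
  have "eventually (\<lambda>n. prob (fpp_event n 0 (real n powr - \<alpha>)) = 0) sequentially"
    using eventually_ge_at_top[of 2]
  proof eventually_elim
    case (elim n)
    have "\<not> cost n 0 \<omega> A \<le> real n powr - \<alpha>" if "A \<in> V n" for A \<omega>
    proof -
      have "finite A" "A \<noteq> {}" using that elim V_subset[of n A] V_nonempty[of n A] finite_S[of n] by (auto intro: finite_subset)
      then have "card A \<ge> 1" by (simp add: card_gt_0_iff Suc_leI)
      then have "1 / real n \<le> cost n 0 \<omega> A" using elim by (simp add: cost_def divide_right_mono)
      moreover have "real n powr - \<alpha> < real n powr (- 1)" using \<alpha> elim by (intro powr_less_mono) auto
      moreover have "real n powr (- 1) = 1 / real n" using elim by (simp add: powr_minus field_simps)
      ultimately show ?thesis by linarith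
    qed
    then have "fpp_event n 0 (real n powr - \<alpha>) = {}" by (auto simp: fpp_event_def)
    then show ?case by simp
  qed
  then have "(\<lambda>n. prob (fpp_event n 0 (real n powr - \<alpha>))) \<longlonglongrightarrow> 0" by (rule tendsto_eventually)
  moreover have "(\<lambda>n. prob (fpp_event n 0 (real n powr - \<alpha>))) \<longlonglongrightarrow> 1" using \<alpha> by (simp add: good_def)
  ultimately show False using LIMSEQ_unique by fastforce
qed

text \<open>Outside \<open>B n\<close> one has \<open>|H n x| \<le> c * ln n\<close> for all \<open>x\<close>. There are about \<open>n ^ dim\<close> points, and each of
  them fails with probability of order \<open>n powr - (c\<^sup>2 / 2)\<close>; hence the condition on \<open>c\<close>.\<close>

lemma good_lipschitz:
  assumes \<alpha>: "\<alpha> \<in> good \<xi>" and c: "c > sqrt (2 * real dim)"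
  shows "\<alpha> - \<bar>\<xi>' - \<xi>\<bar> * c \<in> good \<xi>'"
proof -
  have c0: "c > 0" using c by (rule le_less_trans[rotated]) simp
  have c2: "c\<^sup>2 / 2 > real dim" 
    using power_strict_mono[OF c, of 2] by simp
  define B where "B n = (\<Union>x\<in>S n. {\<omega> \<in> space M. exp (c * H n x \<omega>) \<ge> real n powr (c\<^sup>2)} \<union> {\<omega> \<in> space M. exp ((- c) * H n x \<omega>) \<ge> real n powr ((- c)\<^sup>2)})" for n
  have B_events: "B n \<in> events" if "0 < n" for n
    unfolding B_def using that
    by (intro sets.finite_UN finite_S sets.Un borel_measurable_le borel_measurable_const measurable_exp_H) auto
  show ?thesis
  proof (rule good_transfer[OF \<alpha> B_events])
    define K where "K = 2 * exp (c\<^sup>2 * C / 2) * 2 ^ dim"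
    have prob_B: "prob (B n) \<le> K * real n powr (- (c\<^sup>2 / 2 - real dim))" if n: "0 < n" for n
    proof -
      have "prob (B n) \<le> (\<Sum>x\<in>S n. prob ({\<omega> \<in> space M. exp (c * H n x \<omega>) \<ge> real n powr (c\<^sup>2)} \<union> {\<omega> \<in> space M. exp ((- c) * H n x \<omega>) \<ge> real n powr ((- c)\<^sup>2)}))"
        unfolding B_def using n
        by (intro finite_measure_subadditive_finite finite_S image_subsetI sets.Un borel_measurable_le borel_measurable_const measurable_exp_H) auto
      also have "\<dots> \<le> (\<Sum>x\<in>S n. 2 * exp (c\<^sup>2 * C / 2) * real n powr (- (c\<^sup>2 / 2)))"
      proof (rule sum_mono)
        fix x assume x: "x \<in> S n"
        have "prob ({\<omega> \<in> space M. exp (c * H n x \<omega>) \<ge> real n powr (c\<^sup>2)} \<union> {\<omega> \<in> space M. exp ((- c) * H n x \<omega>) \<ge> real n powr ((- c)\<^sup>2)})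
           \<le> prob {\<omega> \<in> space M. exp (c * H n x \<omega>) \<ge> real n powr (c\<^sup>2)} + prob {\<omega> \<in> space M. exp ((- c) * H n x \<omega>) \<ge> real n powr ((- c)\<^sup>2)}"
          using n x by (intro measure_Un_le borel_measurable_le borel_measurable_const measurable_exp_H) auto
        also have "\<dots> \<le> 2 * exp (c\<^sup>2 * C / 2) * real n powr (- (c\<^sup>2 / 2))"
          using prob_exp_ge_le[OF n x, of c] prob_exp_ge_le[OF n x, of "- c"] by simp
        finally show "prob ({\<omega> \<in> space M. exp (c * H n x \<omega>) \<ge> real n powr (c\<^sup>2)} \<union> {\<omega> \<in> space M. exp ((- c) * H n x \<omega>) \<ge> real n powr ((- c)\<^sup>2)})
          \<le> 2 * exp (c\<^sup>2 * C / 2) * real n powr (- (c\<^sup>2 / 2))" .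
      qed
      also have "\<dots> = real (card (S n)) * (2 * exp (c\<^sup>2 * C / 2) * real n powr (- (c\<^sup>2 / 2)))" by simp
      also have "\<dots> \<le> (2 ^ dim * real n powr real dim) * (2 * exp (c\<^sup>2 * C / 2) * real n powr (- (c\<^sup>2 / 2)))"
        by (intro mult_right_mono card_S_powr n) auto
      also have "\<dots> = K * (real n powr real dim * real n powr (- (c\<^sup>2 / 2)))" by (simp add: K_def)
      also have "real n powr real dim * real n powr (- (c\<^sup>2 / 2)) = real n powr (- (c\<^sup>2 / 2 - real dim))"
        unfolding powr_add[symmetric] by simp
      finally show ?thesis .
    qed
    have "(\<lambda>n. K * real n powr (- (c\<^sup>2 / 2 - real dim))) \<longlonglongrightarrow> 0"
      using c2 by (intro powr_neg_tendsto_0) auto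
    then show "(\<lambda>n. prob (B n)) \<longlonglongrightarrow> 0"
      by (rule tendsto_0_le[where K = 1])
        (auto intro!: eventually_mono[OF eventually_gt_at_top[of 0]] order_trans[OF prob_B order_trans[OF abs_ge_self]])
  next
    show "eventually (\<lambda>n. fpp_event n \<xi> (real n powr - \<alpha>) \<subseteq> fpp_event n \<xi>' (real n powr - (\<alpha> - \<bar>\<xi>' - \<xi>\<bar> * c)) \<union> B n) sequentially"
      using eventually_gt_at_top[of 0]
    proof eventually_elim
      case (elim n)
      show ?case
      proof
        fix \<omega> assume "\<omega> \<in> fpp_event n \<xi> (real n powr - \<alpha>)"
        then obtain A where A: "\<omega> \<in> space M" "A \<in> V n" "cost n \<xi> \<omega> A \<le> real n powr - \<alpha>"
          by (auto simp: fpp_event_def)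
        show "\<omega> \<in> fpp_event n \<xi>' (real n powr - (\<alpha> - \<bar>\<xi>' - \<xi>\<bar> * c)) \<union> B n"
        proof (cases "\<omega> \<in> B n")
          case False
          have le: "exp (\<xi>' * H n x \<omega>) \<le> real n powr (\<bar>\<xi>' - \<xi>\<bar> * c) * exp (\<xi> * H n x \<omega>)" if x: "x \<in> A" for x
          proof -
            have "x \<in> S n" using x A V_subset elim by auto
            then have "exp (c * H n x \<omega>) < real n powr (c\<^sup>2)" "exp ((- c) * H n x \<omega>) < real n powr ((- c)\<^sup>2)"
              using False A(1) by (auto simp: B_def not_le)
            then have "c * H n x \<omega> < c * (c * ln n)" "c * - H n x \<omega> < c * (c * ln n)"
              using elim by (simp_all add: powr_def power2_eq_square)
            then have "\<bar>H n x \<omega>\<bar> \<le> c * ln n" using c0 by (simp only: mult_less_cancel_left_pos)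
            then have "\<bar>\<xi>' - \<xi>\<bar> * \<bar>H n x \<omega>\<bar> \<le> \<bar>\<xi>' - \<xi>\<bar> * (c * ln n)"
              by (rule mult_left_mono) simp
            then have "(\<xi>' - \<xi>) * H n x \<omega> \<le> \<bar>\<xi>' - \<xi>\<bar> * (c * ln n)"
              unfolding abs_mult[symmetric] by (rule order_trans[OF abs_ge_self])
            then have "\<xi>' * H n x \<omega> \<le> \<bar>\<xi>' - \<xi>\<bar> * c * ln n + \<xi> * H n x \<omega>" by (simp add: algebra_simps)
            then have "exp (\<xi>' * H n x \<omega>) \<le> exp (\<bar>\<xi>' - \<xi>\<bar> * c * ln n + \<xi> * H n x \<omega>)" by simp
            then show ?thesis using elim by (simp add: powr_def exp_add)
          qed
          have "cost n \<xi>' \<omega> A \<le> (\<Sum>x\<in>A. real n powr (\<bar>\<xi>' - \<xi>\<bar> * c) * (exp (\<xi> * H n x \<omega>) / real n))"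
            unfolding cost_def using le elim by (intro sum_mono) (simp add: divide_right_mono)
          also have "\<dots> = real n powr (\<bar>\<xi>' - \<xi>\<bar> * c) * cost n \<xi> \<omega> A"
            by (simp add: cost_def sum_distrib_left)
          also have "\<dots> \<le> real n powr (\<bar>\<xi>' - \<xi>\<bar> * c) * real n powr - \<alpha>"
            by (intro mult_left_mono A) auto
          also have "\<dots> = real n powr - (\<alpha> - \<bar>\<xi>' - \<xi>\<bar> * c)" unfolding powr_add[symmetric] by simp
          finally show ?thesis using A by (auto simp: fpp_event_def)
        qed simp
      qed
    qed
  qed
qed

text \<open>With \<open>s = (\<Sum>x\<in>A. a x)\<close> one has \<open>a x powr p \<le> a x * s powr (p - 1)\<close>. Raising the weights to the power
  \<open>p\<close> is passing from \<open>\<xi>\<close> to \<open>p * \<xi>\<close>, and the factors \<open>1 / n\<close> give the shift by \<open>1 - p\<close>.\<close>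

lemma good_power:
  assumes \<alpha>: "\<alpha> \<in> good \<xi>" and p: "p \<ge> 1"
  shows "1 - p + p * \<alpha> \<in> good (p * \<xi>)"
proof (rule good_transfer_sure[OF \<alpha>], rule eventually_mono[OF eventually_gt_at_top[of 0]], rule subsetI)
  fix n :: nat and \<omega> assume n: "0 < n" and "\<omega> \<in> fpp_event n \<xi> (real n powr - \<alpha>)"
  then obtain A where A: "\<omega> \<in> space M" "A \<in> V n" "cost n \<xi> \<omega> A \<le> real n powr - \<alpha>"
    by (auto simp: fpp_event_def)
  define a where "a x = exp (\<xi> * H n x \<omega>)" for x
  define s where "s = (\<Sum>x\<in>A. a x)"
  have fin: "finite A" "A \<noteq> {}" using A n V_subset[of n A] V_nonempty[of n A] finite_S[of n] by (auto intro: finite_subset)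
  have s: "s > 0" unfolding s_def a_def using fin by (intro sum_pos) auto
  have as: "a x \<le> s" if "x \<in> A" for x
    unfolding s_def using that fin by (intro member_le_sum) (auto simp: a_def)
  have "(\<Sum>x\<in>A. a x powr p) \<le> (\<Sum>x\<in>A. a x * s powr (p - 1))"
  proof (rule sum_mono)
    fix x assume "x \<in> A"
    have "a x powr p = a x * a x powr (p - 1)" using powr_add[of "a x" 1 "p - 1"] by (simp add: a_def)
    also have "\<dots> \<le> a x * s powr (p - 1)" using as[OF \<open>x \<in> A\<close>] p by (intro mult_left_mono powr_mono2) (auto simp: a_def)
    finally show "a x powr p \<le> a x * s powr (p - 1)" .
  qed
  also have "\<dots> = s * s powr (p - 1)" by (simp only: s_def sum_distrib_right)
  also have "\<dots> = s powr p" using s powr_add[of s 1 "p - 1"] by simp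
  finally have sum_le: "(\<Sum>x\<in>A. a x powr p) \<le> s powr p" .
  have "cost n \<xi> \<omega> A = s / n" by (simp add: cost_def s_def a_def sum_divide_distrib)
  then have "s / n \<le> real n powr - \<alpha>" using A(3) by (simp only:)
  then have "s \<le> real n * real n powr - \<alpha>"
    using n by (subst (asm) pos_divide_le_eq) (simp_all only: mult.commute of_nat_0_less_iff)
  also have "\<dots> = real n powr (1 - \<alpha>)" using n by (simp add: powr_diff powr_minus divide_inverse)
  finally have sn: "s \<le> real n powr (1 - \<alpha>)" .
  have "cost n (p * \<xi>) \<omega> A = (\<Sum>x\<in>A. a x powr p) / n"
    unfolding cost_def a_def exp_powr_real sum_divide_distrib by (intro sum.cong refl) (simp only: mult_ac)
  also have "\<dots> \<le> s powr p / n" using sum_le by (simp add: divide_right_mono)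
  also have "\<dots> \<le> (real n powr (1 - \<alpha>)) powr p / n" using sn s p by (intro divide_right_mono powr_mono2) simp_all
  also have "\<dots> = real n powr - (1 - p + p * \<alpha>)"
  proof -
    have "(real n powr (1 - \<alpha>)) powr p / n = real n powr ((1 - \<alpha>) * p) / real n powr 1"
      using n by (simp add: powr_powr)
    also have "\<dots> = real n powr ((1 - \<alpha>) * p - 1)" by (simp only: powr_diff)
    finally show ?thesis by (simp add: algebra_simps)
  qed
  finally show "\<omega> \<in> fpp_event n (p * \<xi>) (real n powr - (1 - p + p * \<alpha>))"
    using A by (auto simp: fpp_event_def)
qed


text \<open>On the product space \<open>\<xi>' H\<close> is replaced by \<open>\<xi> H + s H'\<close>, which has the same law. Freeze the first
  coordinate \<open>\<omega>\<close> together with a set \<open>A\<close> that is cheap for \<open>\<xi> H\<close>. In the second coordinate the cost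
  of \<open>A\<close> has mean at most \<open>K * n powr (s\<^sup>2 / 2)\<close> times the original cost, so Markov's inequality with the
  extra factor \<open>n powr \<delta>\<close> applies.\<close>

lemma good_quadratic:
  assumes \<alpha>: "\<alpha> \<in> good \<xi>" and \<xi>: "0 \<le> \<xi>" "\<xi> \<le> \<xi>'" and \<delta>: "\<delta> > 0"
  shows "\<alpha> - (\<xi>'\<^sup>2 - \<xi>\<^sup>2) / 2 - \<delta> \<in> good \<xi>'"
  unfolding good_def mem_Collect_eq
proof -
  define s where "s = sqrt (\<xi>'\<^sup>2 - \<xi>\<^sup>2)"
  have s2: "s\<^sup>2 = \<xi>'\<^sup>2 - \<xi>\<^sup>2" using \<xi> by (simp add: s_def power_mono)
  define \<beta> where "\<beta> = \<alpha> - s\<^sup>2 / 2 - \<delta>"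
  define K where "K = exp (s\<^sup>2 * C / 2)"
  interpret MM: pair_prob_space M M by unfold_locales
  have main: "prob (fpp_event n \<xi> (real n powr - \<alpha>)) - K * real n powr - \<delta> \<le> prob (fpp_event n \<xi>' (real n powr - \<beta>))"
    if n: "0 < n" for n
  proof -
    let ?\<tau> = "real n powr - \<beta>"
    define T where "T = {z \<in> space (PiM (S n) (\<lambda>_. borel)). \<exists>A\<in>V n. (\<Sum>x\<in>A. exp (z x) / real n) \<le> ?\<tau>}"
    have T: "T \<in> sets (PiM (S n) (\<lambda>_. borel))"
    proof -
      have "T = (\<Union>A\<in>V n. {z \<in> space (PiM (S n) (\<lambda>_. borel)). (\<Sum>x\<in>A. exp (z x) / real n) \<le> ?\<tau>})"
        unfolding T_def by blast
      also have "\<dots> \<in> sets (PiM (S n) (\<lambda>_. borel))"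
      proof (intro sets.finite_UN finite_V n borel_measurable_le borel_measurable_const borel_measurable_sum)
        fix A x assume "A \<in> V n" "x \<in> A"
        then have [measurable]: "(\<lambda>z. z x) \<in> borel_measurable (PiM (S n) (\<lambda>_. borel :: real measure))"
          using V_subset[OF n] by (intro measurable_component_singleton) auto
        show "(\<lambda>z. exp (z x) / real n) \<in> borel_measurable (PiM (S n) (\<lambda>_. borel))" by measurable
      qed
      finally show ?thesis .
    qed
    have in_T: "(\<lambda>x\<in>S n. f x) \<in> T \<longleftrightarrow> (\<exists>A\<in>V n. (\<Sum>x\<in>A. exp (f x) / real n) \<le> ?\<tau>)" for f :: "'v \<Rightarrow> real"
    proof -
      have "(\<Sum>x\<in>A. exp ((\<lambda>x\<in>S n. f x) x) / real n) = (\<Sum>x\<in>A. exp (f x) / real n)" if "A \<in> V n" for A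
        using V_subset[OF n that] by (intro sum.cong) auto
      then show ?thesis by (auto simp: T_def space_PiM)
    qed
    define E where "E = {\<omega> \<in> space (M \<Otimes>\<^sub>M M). (\<lambda>x\<in>S n. \<xi> * H n x (fst \<omega>) + s * H n x (snd \<omega>)) \<in> T}"
    have E_sets: "E \<in> sets (M \<Otimes>\<^sub>M M)"
    proof -
      have "(\<lambda>\<omega>. \<lambda>x\<in>S n. \<xi> * H n x (fst \<omega>) + s * H n x (snd \<omega>)) \<in> measurable (M \<Otimes>\<^sub>M M) (PiM (S n) (\<lambda>_. borel))"
      proof (rule measurable_restrict)
        fix x assume "x \<in> S n"
        note [measurable] = measurable_H[OF n this]
        show "(\<lambda>\<omega>. \<xi> * H n x (fst \<omega>) + s * H n x (snd \<omega>)) \<in> borel_measurable (M \<Otimes>\<^sub>M M)" by measurable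
      qed
      from measurable_sets[OF this T] show ?thesis by (simp add: E_def vimage_def Int_def conj_commute)
    qed
    have "prob (fpp_event n \<xi>' ?\<tau>) = prob {\<omega> \<in> space M. (\<lambda>x\<in>S n. \<xi>' * H n x \<omega>) \<in> T}"
      unfolding in_T by (simp add: fpp_event_def cost_def)
    also have "\<dots> = measure (M \<Otimes>\<^sub>M M) E"
      unfolding E_def by (rule gaussian_rotation[OF prob_space_axioms finite_S[OF n] gaussian[OF n] _ T]) (simp add: s2)
    finally have eq: "prob (fpp_event n \<xi>' ?\<tau>) = measure (M \<Otimes>\<^sub>M M) E" .
    define q where "q = 1 - K * real n powr - \<delta>"
    have slice: "q \<le> prob (Pair \<omega> -` E)" if \<omega>: "\<omega> \<in> fpp_event n \<xi> (real n powr - \<alpha>)" for \<omega>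
    proof -
      obtain A where A: "\<omega> \<in> space M" "A \<in> V n" "cost n \<xi> \<omega> A \<le> real n powr - \<alpha>"
        using \<omega> by (auto simp: fpp_event_def)
      define f where "f \<omega>' = (\<Sum>x\<in>A. exp (\<xi> * H n x \<omega>) / real n * exp (s * H n x \<omega>'))" for \<omega>'
      have AS: "x \<in> S n" if "x \<in> A" for x using that V_subset[OF n A(2)] by auto
      have f_int: "integrable M f"
        unfolding f_def using exp_moment(1)[OF n AS] by (intro Bochner_Integration.integrable_sum integrable_mult_right) auto
      have f_nonneg: "f \<omega>' \<ge> 0" for \<omega>' unfolding f_def by (intro sum_nonneg) auto
      have "(\<integral>\<omega>'. f \<omega>' \<partial>M) = (\<Sum>x\<in>A. exp (\<xi> * H n x \<omega>) / real n * (\<integral>\<omega>'. exp (s * H n x \<omega>') \<partial>M))"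
        unfolding f_def using exp_moment(1)[OF n AS]
        by (subst Bochner_Integration.integral_sum) (auto intro!: integrable_mult_right)
      also have "\<dots> \<le> (\<Sum>x\<in>A. exp (\<xi> * H n x \<omega>) / real n * (K * real n powr (s\<^sup>2 / 2)))"
        unfolding K_def using exp_moment(2)[OF n AS] by (intro sum_mono mult_left_mono) auto
      also have "\<dots> = cost n \<xi> \<omega> A * (K * real n powr (s\<^sup>2 / 2))" by (simp only: cost_def sum_distrib_right)
      also have "\<dots> \<le> real n powr - \<alpha> * (K * real n powr (s\<^sup>2 / 2))"
        using A(3) by (intro mult_right_mono) (auto simp: K_def)
      finally have f_le: "(\<integral>\<omega>'. f \<omega>' \<partial>M) \<le> real n powr - \<alpha> * (K * real n powr (s\<^sup>2 / 2))" .
      have "prob {\<omega>' \<in> space M. f \<omega>' \<ge> ?\<tau>} \<le> (\<integral>\<omega>'. f \<omega>' \<partial>M) / ?\<tau>"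
        using f_nonneg n by (intro integral_Markov_inequality_measure[OF f_int, of "{}"]) auto
      also have "\<dots> \<le> real n powr - \<alpha> * (K * real n powr (s\<^sup>2 / 2)) / ?\<tau>"
        using f_le by (intro divide_right_mono) auto
      also have "\<dots> = K * (real n powr - \<alpha> * real n powr (s\<^sup>2 / 2) / ?\<tau>)" by simp
      also have "real n powr - \<alpha> * real n powr (s\<^sup>2 / 2) / ?\<tau> = real n powr - \<delta>"
        unfolding powr_add[symmetric] powr_diff[symmetric] by (simp add: \<beta>_def)
      finally have markov: "prob {\<omega>' \<in> space M. f \<omega>' \<ge> ?\<tau>} \<le> K * real n powr - \<delta>" .
      have ev: "{\<omega>' \<in> space M. f \<omega>' \<ge> ?\<tau>} \<in> events"
        using f_int by (intro borel_measurable_le) auto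
      have "space M - {\<omega>' \<in> space M. f \<omega>' \<ge> ?\<tau>} \<subseteq> Pair \<omega> -` E"
      proof
        fix \<omega>' assume "\<omega>' \<in> space M - {\<omega>' \<in> space M. f \<omega>' \<ge> ?\<tau>}"
        then have *: "\<omega>' \<in> space M" "f \<omega>' \<le> ?\<tau>" by auto
        have "f \<omega>' = (\<Sum>x\<in>A. exp (\<xi> * H n x \<omega> + s * H n x \<omega>') / real n)"
          by (simp add: f_def exp_add)
        then show "\<omega>' \<in> Pair \<omega> -` E"
          using * A by (auto simp: E_def in_T space_pair_measure)
      qed
      then have "prob (space M - {\<omega>' \<in> space M. f \<omega>' \<ge> ?\<tau>}) \<le> prob (Pair \<omega> -` E)"
        using sets_Pair1[OF E_sets] by (intro finite_measure_mono) auto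
      then show ?thesis using markov prob_compl[OF ev] by (simp add: q_def)
    qed
    have "q * prob (fpp_event n \<xi> (real n powr - \<alpha>)) \<le> measure (M \<Otimes>\<^sub>M M) E"
    proof (cases "q \<ge> 0")
      case True
      have "ennreal (q * prob (fpp_event n \<xi> (real n powr - \<alpha>))) = ennreal q * emeasure M (fpp_event n \<xi> (real n powr - \<alpha>))"
        using True by (simp add: emeasure_eq_measure ennreal_mult)
      also have "\<dots> = (\<integral>\<^sup>+\<omega>. ennreal q * indicator (fpp_event n \<xi> (real n powr - \<alpha>)) \<omega> \<partial>M)"
        using events_fpp_event[OF n] by (simp add: nn_integral_cmult_indicator)
      also have "\<dots> \<le> (\<integral>\<^sup>+\<omega>. emeasure M (Pair \<omega> -` E) \<partial>M)"
      proof (rule nn_integral_mono)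
        fix \<omega>
        show "ennreal q * indicator (fpp_event n \<xi> (real n powr - \<alpha>)) \<omega> \<le> emeasure M (Pair \<omega> -` E)"
        proof (cases "\<omega> \<in> fpp_event n \<xi> (real n powr - \<alpha>)")
          case True
          then show ?thesis using ennreal_leI[OF slice[OF True]] by (simp add: emeasure_eq_measure)
        qed simp
      qed
      also have "\<dots> = emeasure (M \<Otimes>\<^sub>M M) E" using E_sets by (simp add: emeasure_pair_measure_alt)
      finally show ?thesis by (simp add: MM.emeasure_eq_measure)
    next
      case False
      then have "q * prob (fpp_event n \<xi> (real n powr - \<alpha>)) \<le> 0" by (simp add: mult_nonpos_nonneg)
      then show ?thesis using measure_nonneg[of "M \<Otimes>\<^sub>M M" E] by linarith
    qed
    moreover have "prob (fpp_event n \<xi> (real n powr - \<alpha>)) - K * real n powr - \<delta> \<le> q * prob (fpp_event n \<xi> (real n powr - \<alpha>))"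
    proof -
      have "K * real n powr - \<delta> * prob (fpp_event n \<xi> (real n powr - \<alpha>)) \<le> K * real n powr - \<delta> * 1"
        by (intro mult_left_mono) (auto simp: K_def)
      then show ?thesis by (simp add: q_def left_diff_distrib)
    qed
    ultimately show ?thesis using eq by simp
  qed
  have "(\<lambda>n. prob (fpp_event n \<xi>' (real n powr - \<beta>))) \<longlonglongrightarrow> 1"
  proof (rule tendsto_sandwich)
    show "eventually (\<lambda>n. prob (fpp_event n \<xi> (real n powr - \<alpha>)) - K * real n powr - \<delta> \<le> prob (fpp_event n \<xi>' (real n powr - \<beta>))) sequentially"
      using main by (intro eventually_mono[OF eventually_gt_at_top[of 0]]) auto
    have "(\<lambda>n. prob (fpp_event n \<xi> (real n powr - \<alpha>))) \<longlonglongrightarrow> 1" using \<alpha> by (simp add: good_def)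
    from tendsto_diff[OF this powr_neg_tendsto_0[OF \<delta>]]
    show "(\<lambda>n. prob (fpp_event n \<xi> (real n powr - \<alpha>)) - K * real n powr - \<delta>) \<longlonglongrightarrow> 1" by simp
  qed auto
  then show "(\<lambda>n. prob (fpp_event n \<xi>' (real n powr - (\<alpha> - (\<xi>'\<^sup>2 - \<xi>\<^sup>2) / 2 - \<delta>)))) \<longlonglongrightarrow> 1"
    by (simp only: \<beta>_def s2)
qed

text \<open>For every real \<open>y\<close>, the value of the field at a vertex,
  \<open>exp (\<xi>' * y) \<le> n powr ((\<xi> - \<xi>') * b) * exp (\<xi> * y) + n powr - ((\<xi>' + b) * b) * exp (- b * y)\<close>:
  the first term dominates when \<open>y \<ge> - b * ln n\<close> and the second one otherwise. Summed over a path, the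
  first term is controlled by the cost at \<open>\<xi>\<close>; the second is summed over all of \<open>S n\<close> and has mean of order
  \<open>n powr - \<kappa>\<close> with \<open>\<kappa> = 1 - dim + \<xi>' * b + b\<^sup>2 / 2\<close>. The exponent \<open>- b\<close> is the one that
  minimises this mean.\<close>

lemma good_thick:
  assumes \<alpha>: "\<alpha> \<in> good \<xi>" and \<xi>: "\<xi>' \<le> \<xi>" "0 \<le> b + \<xi>'"
    and \<gamma>: "\<gamma> < \<alpha> - (\<xi> - \<xi>') * b" "\<gamma> < 1 - real dim + \<xi>' * b + b\<^sup>2 / 2"
  shows "\<gamma> \<in> good \<xi>'"
proof -
  define \<kappa> where "\<kappa> = 1 - real dim + \<xi>' * b + b\<^sup>2 / 2"
  \<comment> \<open>Room on both sides: \<open>Z n\<close> exceeds \<open>n powr - \<eta>\<close> with small probability, and \<open>n powr - \<eta>\<close> is negligible against \<open>n powr - \<gamma>\<close>.\<close>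
  define \<eta> where "\<eta> = (\<gamma> + \<kappa>) / 2"
  define K where "K = 2 ^ dim * exp (b\<^sup>2 * C / 2)"
  have \<eta>: "\<gamma> < \<eta>" "\<eta> < \<kappa>" using \<gamma> by (auto simp: \<eta>_def \<kappa>_def)
  define Z where "Z n \<omega> = (\<Sum>x\<in>S n. real n powr - ((\<xi>' + b) * b) / real n * exp ((- b) * H n x \<omega>))" for n \<omega>
  define B where "B n = {\<omega> \<in> space M. Z n \<omega> \<ge> real n powr - \<eta>}" for n
  have Z_int: "integrable M (Z n)" if "0 < n" for n
    unfolding Z_def by (intro Bochner_Integration.integrable_sum integrable_mult_right exp_moment that)
  have Z_nonneg: "Z n \<omega> \<ge> 0" for n \<omega> unfolding Z_def by (intro sum_nonneg) auto
  have B_events: "B n \<in> events" if "0 < n" for n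
    unfolding B_def using Z_int[OF that] by (intro borel_measurable_le) auto
  have prob_B: "prob (B n) \<le> K * real n powr - (\<kappa> - \<eta>)" if n: "0 < n" for n
  proof -
    have "(\<integral>\<omega>. Z n \<omega> \<partial>M) = (\<Sum>x\<in>S n. real n powr - ((\<xi>' + b) * b) / real n * (\<integral>\<omega>. exp ((- b) * H n x \<omega>) \<partial>M))"
      unfolding Z_def
      by (subst Bochner_Integration.integral_sum) (intro integrable_mult_right exp_moment n, assumption, simp only: integral_mult_right_zero)
    also have "\<dots> \<le> (\<Sum>x\<in>S n. real n powr - ((\<xi>' + b) * b) / real n * (exp (b\<^sup>2 * C / 2) * real n powr (b\<^sup>2 / 2)))"
      using exp_moment(2)[OF n, of _ "- b"] by (intro sum_mono mult_left_mono) auto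
    also have "\<dots> = real (card (S n)) * (real n powr - ((\<xi>' + b) * b) / real n * (exp (b\<^sup>2 * C / 2) * real n powr (b\<^sup>2 / 2)))"
      by simp
    also have "\<dots> \<le> (2 ^ dim * real n powr real dim) * (real n powr - ((\<xi>' + b) * b) / real n * (exp (b\<^sup>2 * C / 2) * real n powr (b\<^sup>2 / 2)))"
      by (intro mult_right_mono card_S_powr n) auto
    also have "\<dots> = K * (real n powr real dim * real n powr - ((\<xi>' + b) * b) / real n powr 1 * real n powr (b\<^sup>2 / 2))"
      using n by (simp add: K_def)
    also have "real n powr real dim * real n powr - ((\<xi>' + b) * b) / real n powr 1 * real n powr (b\<^sup>2 / 2) = real n powr - \<kappa>"
      unfolding powr_add[symmetric] powr_diff[symmetric] by (simp add: \<kappa>_def power2_eq_square algebra_simps)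
    finally have EZ: "(\<integral>\<omega>. Z n \<omega> \<partial>M) \<le> K * real n powr - \<kappa>" .
    have "prob (B n) \<le> (\<integral>\<omega>. Z n \<omega> \<partial>M) / real n powr - \<eta>"
      unfolding B_def using Z_nonneg n by (intro integral_Markov_inequality_measure[OF Z_int, of _ "{}"]) auto
    also have "\<dots> \<le> K * real n powr - \<kappa> / real n powr - \<eta>" using EZ by (intro divide_right_mono) auto
    also have "\<dots> = K * (real n powr - \<kappa> / real n powr - \<eta>)" by simp
    also have "real n powr - \<kappa> / real n powr - \<eta> = real n powr - (\<kappa> - \<eta>)" unfolding powr_diff[symmetric] by simp
    finally show ?thesis .
  qed
  show ?thesis
  proof (rule good_transfer[OF \<alpha> B_events])
    have "(\<lambda>n. K * real n powr - (\<kappa> - \<eta>)) \<longlonglongrightarrow> 0" using \<eta> by (intro powr_neg_tendsto_0) auto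
    then show "(\<lambda>n. prob (B n)) \<longlonglongrightarrow> 0"
      by (rule tendsto_0_le[where K = 1])
        (auto intro!: eventually_mono[OF eventually_gt_at_top[of 0]] order_trans[OF prob_B order_trans[OF abs_ge_self]])
  next
    have small: "eventually (\<lambda>n. real n powr - (u - \<gamma>) < 1 / 2) sequentially" if "\<gamma> < u" for u
    proof -
      have "(\<lambda>n. 1 * real n powr - (u - \<gamma>)) \<longlonglongrightarrow> 0" using that by (intro powr_neg_tendsto_0) auto
      then show ?thesis by (intro order_tendstoD(2)[where y = 0]) auto
    qed
    show "eventually (\<lambda>n. fpp_event n \<xi> (real n powr - \<alpha>) \<subseteq> fpp_event n \<xi>' (real n powr - \<gamma>) \<union> B n) sequentially"
      using small[OF \<gamma>(1)] small[OF \<eta>(1)] eventually_gt_at_top[of 0]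
    proof eventually_elim
      case (elim n)
      note n = \<open>0 < n\<close>
      \<comment> \<open>Each of the two terms takes at most half of the allowed cost.\<close>
      have half: "real n powr - u \<le> real n powr - \<gamma> / 2" if "real n powr - (u - \<gamma>) < 1 / 2" for u
      proof -
        have "real n powr - u = real n powr - (u - \<gamma>) * real n powr - \<gamma>" unfolding powr_add[symmetric] by simp
        also have "\<dots> \<le> 1 / 2 * real n powr - \<gamma>" using that by (intro mult_right_mono) auto
        finally show ?thesis by simp
      qed
      show ?case
      proof
        fix \<omega> assume "\<omega> \<in> fpp_event n \<xi> (real n powr - \<alpha>)"
        then obtain A where A: "\<omega> \<in> space M" "A \<in> V n" "cost n \<xi> \<omega> A \<le> real n powr - \<alpha>"
          by (auto simp: fpp_event_def)
        show "\<omega> \<in> fpp_event n \<xi>' (real n powr - \<gamma>) \<union> B n"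
        proof (cases "\<omega> \<in> B n")
          case False
          let ?L = "ln (real n)"
          have le: "exp (\<xi>' * y) \<le> real n powr ((\<xi> - \<xi>') * b) * exp (\<xi> * y) + real n powr - ((\<xi>' + b) * b) * exp ((- b) * y)" for y
          proof (cases "y \<ge> - b * ?L")
            case True
            have "0 \<le> (\<xi> - \<xi>') * (y + b * ?L)" using True \<xi>(1) by (intro mult_nonneg_nonneg) auto
            then have "\<xi>' * y \<le> (\<xi> - \<xi>') * b * ?L + \<xi> * y" by (simp add: algebra_simps)
            then have "exp (\<xi>' * y) \<le> exp ((\<xi> - \<xi>') * b * ?L + \<xi> * y)" by simp
            then have "exp (\<xi>' * y) \<le> real n powr ((\<xi> - \<xi>') * b) * exp (\<xi> * y)" using n by (simp add: powr_def exp_add)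
            then show ?thesis by (rule order_trans) simp
          next
            case False
            have "(\<xi>' + b) * (y + b * ?L) \<le> 0" using False \<xi>(2) by (intro mult_nonneg_nonpos) auto
            then have "\<xi>' * y \<le> - ((\<xi>' + b) * b) * ?L + (- b) * y" by (simp add: algebra_simps)
            then have "exp (\<xi>' * y) \<le> exp (- ((\<xi>' + b) * b) * ?L + (- b) * y)" by (simp only: exp_le_cancel_iff)
            then have "exp (\<xi>' * y) \<le> real n powr - ((\<xi>' + b) * b) * exp ((- b) * y)" using n by (simp add: powr_def flip: exp_add)
            then show ?thesis by (rule order_trans) simp
          qed
          have "cost n \<xi>' \<omega> A \<le> (\<Sum>x\<in>A. real n powr ((\<xi> - \<xi>') * b) * (exp (\<xi> * H n x \<omega>) / real n)
              + real n powr - ((\<xi>' + b) * b) / real n * exp ((- b) * H n x \<omega>))"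
            unfolding cost_def
          proof (rule sum_mono)
            fix x
            show "exp (\<xi>' * H n x \<omega>) / real n \<le> real n powr ((\<xi> - \<xi>') * b) * (exp (\<xi> * H n x \<omega>) / real n)
              + real n powr - ((\<xi>' + b) * b) / real n * exp ((- b) * H n x \<omega>)"
              using divide_right_mono[OF le[of "H n x \<omega>"], of "real n"] n by (simp add: add_divide_distrib)
          qed
          also have "\<dots> = real n powr ((\<xi> - \<xi>') * b) * cost n \<xi> \<omega> A
              + (\<Sum>x\<in>A. real n powr - ((\<xi>' + b) * b) / real n * exp ((- b) * H n x \<omega>))"
            by (simp only: cost_def sum.distrib sum_distrib_left)
          also have "(\<Sum>x\<in>A. real n powr - ((\<xi>' + b) * b) / real n * exp ((- b) * H n x \<omega>)) \<le> Z n \<omega>"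
            unfolding Z_def by (intro sum_mono2 finite_S n V_subset A(2)) auto
          also have "Z n \<omega> \<le> real n powr - \<eta>" using False A(1) by (simp add: B_def)
          also have "real n powr ((\<xi> - \<xi>') * b) * cost n \<xi> \<omega> A \<le> real n powr ((\<xi> - \<xi>') * b) * real n powr - \<alpha>"
            using A(3) by (intro mult_left_mono) auto
          also have "real n powr ((\<xi> - \<xi>') * b) * real n powr - \<alpha> = real n powr - (\<alpha> - (\<xi> - \<xi>') * b)"
            unfolding powr_add[symmetric] by simp
          finally have "cost n \<xi>' \<omega> A \<le> real n powr - (\<alpha> - (\<xi> - \<xi>') * b) + real n powr - \<eta>" by simp
          then have "cost n \<xi>' \<omega> A \<le> real n powr - \<gamma>" using half[OF elim(1)] half[OF elim(2)] by linarith
          then show ?thesis using A by (auto simp: fpp_event_def)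
        qed simp
      qed
    qed
  qed
qed

end

section \<open>The exponent and its derivative\<close>

context gaussian_fpp
begin

text \<open>Compare with \<open>\<xi> = 0\<close>, where the cost is deterministic.\<close>

lemma good_bounds: "good \<xi> \<noteq> {}" "bdd_above (good \<xi>)"
proof -
  define c where "c = sqrt (2 * real dim) + 1"
  have c: "c > sqrt (2 * real dim)" by (simp add: c_def)
  have "- 1 - \<bar>\<xi> - 0\<bar> * c \<in> good \<xi>" by (rule good_lipschitz[OF good_zero c]) simp
  then show "good \<xi> \<noteq> {}" by blast
  show "bdd_above (good \<xi>)"
  proof (rule bdd_aboveI)
    fix \<alpha> assume "\<alpha> \<in> good \<xi>"
    then have "\<alpha> - \<bar>0 - \<xi>\<bar> * c \<in> good 0" by (rule good_lipschitz[OF _ c])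
    then show "\<alpha> \<le> 1 + \<bar>0 - \<xi>\<bar> * c" using good_zero_le by fastforce
  qed
qed

lemma good_le_exponent: "\<alpha> \<in> good \<xi> \<Longrightarrow> \<alpha> \<le> exponent \<xi>"
  unfolding exponent_def by (intro cSup_upper good_bounds)

lemma less_exponent_good: "\<alpha> < exponent \<xi> \<Longrightarrow> \<alpha> \<in> good \<xi>"
  using less_cSup_iff[OF good_bounds, of \<alpha> \<xi>] good_mono unfolding exponent_def by (meson less_imp_le)

lemma ereal_exponent: "Sup (ereal ` good \<xi>) = ereal (exponent \<xi>)"
proof (rule Sup_eqI)
  show "y \<le> ereal (exponent \<xi>)" if "y \<in> ereal ` good \<xi>" for y
    using that good_le_exponent by auto
  fix y assume y: "\<And>z. z \<in> ereal ` good \<xi> \<Longrightarrow> z \<le> y"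
  obtain \<alpha> where \<alpha>: "\<alpha> \<in> good \<xi>" using good_bounds(1) by blast
  show "ereal (exponent \<xi>) \<le> y"
  proof (cases y)
    case (real r)
    have "x \<le> r" if "x \<in> good \<xi>" for x using y[OF imageI[OF that]] real by simp
    then have "exponent \<xi> \<le> r" unfolding exponent_def by (intro cSup_least good_bounds)
    then show ?thesis using real by simp
  next
    case MInf
    then show ?thesis using y[of "ereal \<alpha>"] \<alpha> by simp
  qed simp
qed

lemma exponent_zero_nonneg: "exponent 0 \<ge> 0"
proof (rule ccontr)
  assume "\<not> exponent 0 \<ge> 0"
  then have "exponent 0 / 2 < 0" "exponent 0 / 2 > exponent 0" by auto
  then show False using good_le_exponent[OF good_zero, of "exponent 0 / 2"] by linarith
qed

lemma exponent_ge:
  assumes "\<And>\<alpha>. \<alpha> < exponent \<xi> \<Longrightarrow> f \<alpha> \<in> good \<xi>'"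
    and "continuous (at_left (exponent \<xi>)) f"
  shows "f (exponent \<xi>) \<le> exponent \<xi>'"
proof (rule tendsto_upperbound)
  show "(f \<longlongrightarrow> f (exponent \<xi>)) (at_left (exponent \<xi>))"
    using assms(2) by (simp add: continuous_within)
  show "eventually (\<lambda>\<alpha>. f \<alpha> \<le> exponent \<xi>') (at_left (exponent \<xi>))"
    using assms(1) good_le_exponent by (auto simp: eventually_at_filter)
qed (simp add: trivial_limit_at_left_real)

lemma exponent_lower_lipschitz: "exponent \<xi> - \<bar>\<xi>' - \<xi>\<bar> * sqrt (2 * real dim) \<le> exponent \<xi>'"
proof (rule field_le_epsilon)
  fix e :: real assume e: "e > 0"
  define c where "c = sqrt (2 * real dim) + e / (\<bar>\<xi>' - \<xi>\<bar> + 1)"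
  have c: "c > sqrt (2 * real dim)" using e by (simp add: c_def)
  have "exponent \<xi> - \<bar>\<xi>' - \<xi>\<bar> * c \<le> exponent \<xi>'"
    using good_lipschitz[OF less_exponent_good c, of _ \<xi> \<xi>']
    by (rule exponent_ge[where f = "\<lambda>\<alpha>. \<alpha> - \<bar>\<xi>' - \<xi>\<bar> * c"]) (auto intro!: continuous_intros)
  moreover have "\<bar>\<xi>' - \<xi>\<bar> * (e / (\<bar>\<xi>' - \<xi>\<bar> + 1)) \<le> e"
    using e by (simp add: field_simps)
  ultimately show "exponent \<xi> - \<bar>\<xi>' - \<xi>\<bar> * sqrt (2 * real dim) \<le> exponent \<xi>' + e"
    by (simp add: c_def distrib_left)
qed

theorem exponent_lipschitz: "(sqrt (2 * real dim))-lipschitz_on UNIV exponent"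
proof (rule lipschitz_onI)
  fix x y
  show "dist (exponent x) (exponent y) \<le> sqrt (2 * real dim) * dist x y"
    using exponent_lower_lipschitz[of x y] exponent_lower_lipschitz[of y x]
    by (simp add: dist_real_def abs_le_iff abs_minus_commute mult.commute)
qed simp

lemma exponent_quadratic:
  assumes "0 \<le> \<xi>" "\<xi> \<le> \<xi>'"
  shows "exponent \<xi> - (\<xi>'\<^sup>2 - \<xi>\<^sup>2) / 2 \<le> exponent \<xi>'"
proof (rule field_le_epsilon)
  fix e :: real assume e: "e > 0"
  have "exponent \<xi> - (\<xi>'\<^sup>2 - \<xi>\<^sup>2) / 2 - e \<le> exponent \<xi>'"
    using good_quadratic[OF less_exponent_good assms e]
    by (rule exponent_ge[where f = "\<lambda>\<alpha>. \<alpha> - (\<xi>'\<^sup>2 - \<xi>\<^sup>2) / 2 - e"]) (auto intro!: continuous_intros)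
  then show "exponent \<xi> - (\<xi>'\<^sup>2 - \<xi>\<^sup>2) / 2 \<le> exponent \<xi>' + e" by simp
qed

lemma exponent_power:
  assumes "p \<ge> 1"
  shows "1 - p + p * exponent \<xi> \<le> exponent (p * \<xi>)"
  using good_power[OF less_exponent_good assms]
  by (rule exponent_ge[where f = "\<lambda>\<alpha>. 1 - p + p * \<alpha>"]) (auto intro!: continuous_intros)

lemma exponent_thick:
  assumes "\<xi>' \<le> \<xi>" "0 \<le> b + \<xi>'"
  shows "min (exponent \<xi> - (\<xi> - \<xi>') * b) (1 - real dim + \<xi>' * b + b\<^sup>2 / 2) \<le> exponent \<xi>'" (is "?m \<le> _")
proof (rule dense_le)
  fix \<gamma> assume \<gamma>: "\<gamma> < ?m"
  then obtain \<alpha> where \<alpha>: "\<gamma> + (\<xi> - \<xi>') * b < \<alpha>" "\<alpha> < exponent \<xi>"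
    using dense[of "\<gamma> + (\<xi> - \<xi>') * b" "exponent \<xi>"] by auto
  have "\<gamma> \<in> good \<xi>'"
    using \<alpha> \<gamma> by (intro good_thick[OF less_exponent_good assms]) auto
  then show "\<gamma> \<le> exponent \<xi>'" by (rule good_le_exponent)
qed

text \<open>The two lower bounds pass to the limit from the right. For the upper bound, let \<open>q\<close> be the expression
  under the root. For \<open>b > sqrt q - \<xi>\<close> one has \<open>(b + \<xi>)\<^sup>2 > q\<close>, which says that the second term in
  \<open>exponent_thick\<close> exceeds \<open>exponent \<xi>\<close>; by continuity the first term is the smaller one slightly to the
  left of \<open>\<xi>\<close>. That \<open>q \<ge> 0\<close> follows from the monotonicity of \<open>exponent \<xi> + \<xi>\<^sup>2 / 2\<close>.\<close>

lemma exponent_deriv_bounds: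
  assumes D: "(exponent has_real_derivative D) (at \<xi>)" and \<xi>: "\<xi> > 0" and dim: "dim > 0"
  shows "- \<xi> \<le> D" "(exponent \<xi> - 1) / \<xi> \<le> D"
    "D \<le> sqrt (2 * (real dim - 1) + 2 * exponent \<xi> + \<xi>\<^sup>2) - \<xi>"
proof -
  have lim: "((\<lambda>h. (exponent (\<xi> + h) - exponent \<xi>) / h) \<longlongrightarrow> D) (at 0)"
    using D by (simp add: DERIV_def)
  have right: "((\<lambda>h. (exponent (\<xi> + h) - exponent \<xi>) / h) \<longlongrightarrow> D) (at_right 0)"
    using lim by (rule tendsto_mono[rotated]) (simp add: at_le)
  have left: "((\<lambda>h. (exponent (\<xi> + h) - exponent \<xi>) / h) \<longlongrightarrow> D) (at_left 0)"
    using lim by (rule tendsto_mono[rotated]) (simp add: at_le)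
  have pos: "eventually (\<lambda>h. h > (0::real)) (at_right 0)"
    by (rule eventually_at_right_less)
  show "- \<xi> \<le> D"
  proof (rule tendsto_le[OF _ right])
    show "((\<lambda>h. - \<xi> - h / 2) \<longlongrightarrow> - \<xi>) (at_right 0)"
      by (auto intro!: tendsto_eq_intros)
    show "eventually (\<lambda>h. - \<xi> - h / 2 \<le> (exponent (\<xi> + h) - exponent \<xi>) / h) (at_right 0)"
      using pos
    proof eventually_elim
      case (elim h)
      have "(- \<xi> - h / 2) * h \<le> exponent (\<xi> + h) - exponent \<xi>"
        using exponent_quadratic[of \<xi> "\<xi> + h"] \<xi> elim by (simp add: power2_eq_square field_simps)
      then show ?case using elim by (simp add: pos_le_divide_eq)
    qed
  qed simp
  show "(exponent \<xi> - 1) / \<xi> \<le> D"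
  proof (rule tendsto_lowerbound[OF right])
    show "eventually (\<lambda>h. (exponent \<xi> - 1) / \<xi> \<le> (exponent (\<xi> + h) - exponent \<xi>) / h) (at_right 0)"
      using pos
    proof eventually_elim
      case (elim h)
      have "1 - (\<xi> + h) / \<xi> + (\<xi> + h) / \<xi> * exponent \<xi> \<le> exponent ((\<xi> + h) / \<xi> * \<xi>)"
        using \<xi> elim by (intro exponent_power) simp
      then have "(exponent \<xi> - 1) / \<xi> * h \<le> exponent (\<xi> + h) - exponent \<xi>"
        using \<xi> by (simp add: add_divide_distrib diff_divide_distrib algebra_simps)
      then show ?case using elim by (simp only: pos_le_divide_eq)
    qed
  qed simp
  define q where "q = 2 * (real dim - 1) + 2 * exponent \<xi> + \<xi>\<^sup>2"
  have "D \<le> b" if b: "b > sqrt q - \<xi>" for b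
  proof (cases "q \<ge> 0")
    case True
    have "sqrt q \<ge> 0" using True by simp
    then have b\<xi>: "b + \<xi> > 0" using b by linarith
    have "(sqrt q)\<^sup>2 < (b + \<xi>)\<^sup>2" using b \<open>sqrt q \<ge> 0\<close> by (intro power_strict_mono) auto
    then have "q < (b + \<xi>)\<^sup>2" using True by simp
    then have gap: "exponent \<xi> < 1 - real dim + \<xi> * b + b\<^sup>2 / 2"
      by (simp add: q_def power2_eq_square field_simps)
    show ?thesis
    proof (rule tendsto_upperbound[OF left])
      have "((\<lambda>h. 1 - real dim + (\<xi> + h) * b + b\<^sup>2 / 2 - (exponent \<xi> + h * b)) \<longlongrightarrow> 1 - real dim + \<xi> * b + b\<^sup>2 / 2 - exponent \<xi>) (at_left 0)"
        by (auto intro!: tendsto_eq_intros)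
      then have "eventually (\<lambda>h. 0 < 1 - real dim + (\<xi> + h) * b + b\<^sup>2 / 2 - (exponent \<xi> + h * b)) (at_left 0)"
        using gap by (intro order_tendstoD(1)) auto
      moreover have "((\<lambda>h. b + \<xi> + h) \<longlongrightarrow> b + \<xi>) (at_left 0)"
        by (auto intro!: tendsto_eq_intros)
      then have "eventually (\<lambda>h. 0 < b + \<xi> + h) (at_left 0)" using b\<xi> by (rule order_tendstoD(1))
      moreover have "eventually (\<lambda>h. h < (0::real)) (at_left 0)" by (auto simp: eventually_at_filter)
      ultimately show "eventually (\<lambda>h. (exponent (\<xi> + h) - exponent \<xi>) / h \<le> b) (at_left 0)"
      proof eventually_elim
        case (elim h)
        have "min (exponent \<xi> - (\<xi> - (\<xi> + h)) * b) (1 - real dim + (\<xi> + h) * b + b\<^sup>2 / 2) \<le> exponent (\<xi> + h)"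
          using elim by (intro exponent_thick) auto
        then have "exponent \<xi> + h * b \<le> exponent (\<xi> + h)" using elim by (simp add: min_def split: if_splits)
        then show ?case using elim by (simp add: neg_divide_le_eq mult.commute)
      qed
    qed simp
  next
    case False
    have "exponent 0 - \<xi>\<^sup>2 / 2 \<le> exponent \<xi>" using exponent_quadratic[of 0 \<xi>] \<xi> by simp
    then have "2 * exponent \<xi> + \<xi>\<^sup>2 \<ge> 0" using exponent_zero_nonneg by simp
    then show ?thesis using False dim by (simp add: q_def)
  qed
  then show "D \<le> sqrt (2 * (real dim - 1) + 2 * exponent \<xi> + \<xi>\<^sup>2) - \<xi>"
    unfolding q_def by (rule dense_ge)
qed

end

section \<open>The distance exponent of Liouville first passage percolation\<close>

lemma liminf_eq_1_iff:
  fixes f :: "nat \<Rightarrow> real"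
  assumes "\<And>n. f n \<le> 1"
  shows "liminf (\<lambda>n. ereal (f n)) = 1 \<longleftrightarrow> f \<longlonglongrightarrow> 1"
proof -
  have "limsup (\<lambda>n. ereal (f n)) \<le> 1" using assms by (intro Limsup_bounded) auto
  moreover have "liminf (\<lambda>n. ereal (f n)) \<le> limsup (\<lambda>n. ereal (f n))" by (intro Liminf_le_Limsup) simp
  ultimately have "liminf (\<lambda>n. ereal (f n)) = 1 \<longleftrightarrow> liminf (\<lambda>n. ereal (f n)) = 1 \<and> limsup (\<lambda>n. ereal (f n)) = 1"
    by auto
  also have "\<dots> \<longleftrightarrow> (\<lambda>n. ereal (f n)) \<longlonglongrightarrow> 1"
    by (rule tendsto_iff_Liminf_eq_Limsup[symmetric]) simp
  also have "\<dots> \<longleftrightarrow> f \<longlonglongrightarrow> 1" unfolding one_ereal_def by (rule lim_ereal)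
  finally show ?thesis .
qed

text \<open>The index map \<open>q\<close> may identify points, in which case their coefficients add up.\<close>

lemma gaussian_process_reindex:
  assumes h: "centered_gaussian_process M I h" and S: "finite S" "q ` S \<subseteq> I"
  shows "centered_gaussian M (\<lambda>\<omega>. \<Sum>x\<in>S. c x * h \<omega> (q x))"
proof -
  have "(\<Sum>x\<in>S. c x * h \<omega> (q x)) = (\<Sum>j\<in>q ` S. (\<Sum>x\<in>{x \<in> S. q x = j}. c x) * h \<omega> j)" for \<omega>
  proof -
    have "(\<Sum>x\<in>S. c x * h \<omega> (q x)) = (\<Sum>j\<in>q ` S. \<Sum>x\<in>{x \<in> S. q x = j}. c x * h \<omega> (q x))"
      by (rule sum.image_gen[OF S(1)])
    also have "\<dots> = (\<Sum>j\<in>q ` S. (\<Sum>x\<in>{x \<in> S. q x = j}. c x) * h \<omega> j)"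
      unfolding sum_distrib_right by (intro sum.cong refl) auto
    finally show ?thesis .
  qed
  then show ?thesis using h S unfolding centered_gaussian_process_def by simp
qed

theorem lemma1p6:
  fixes M :: "'w measure"
    and h :: "'w \<Rightarrow> (real^'n) measure \<times> (real^'n) measure \<Rightarrow> real"
    and k :: 'n
    and d :: real
    and lam :: "real \<Rightarrow> real"
  defines "d \<equiv> real CARD('n)"
    and "lam \<equiv> (\<lambda>\<xi>. real_of_ereal (lfpp_exponent M h k \<xi>))"
  assumes "CARD('n) \<ge> 3"
    and "log_correlated_field M h"
  shows "(\<forall>\<xi>\<ge>0. \<bar>lfpp_exponent M h k \<xi>\<bar> \<noteq> \<infinity>) \<and>
    (sqrt (2 * d))-lipschitz_on {0..} lam \<and>
    (AE \<xi> in lebesgue. \<xi> \<ge> 0 \<longrightarrow> lam differentiable (at \<xi>)) \<and>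
    (AE \<xi> in lebesgue. \<xi> \<ge> 0 \<longrightarrow>
       max (- \<xi>) (1 / \<xi> * (lam \<xi> - 1)) \<le> deriv lam \<xi> \<and>
       deriv lam \<xi> \<le> sqrt (2 * (d - 1) + 2 * lam \<xi> + \<xi>\<^sup>2) - \<xi>)"
proof -
  have M: "prob_space M" and gp: "centered_gaussian_process M neutral_charges h"
    and cov: "\<And>p q. p \<in> neutral_charges \<Longrightarrow> q \<in> neutral_charges \<Longrightarrow> (\<integral>\<omega>. h \<omega> p * h \<omega> q \<partial>M) = log_cov p q"
    using assms(4) by (auto simp: log_correlated_field_def)
  have card2: "CARD('n) \<ge> 2" using assms(3) by simp
  obtain C where
    charge: "\<And>\<epsilon> (x :: real^'n). 0 < \<epsilon> \<Longrightarrow> \<epsilon> \<le> 1 \<Longrightarrow> \<forall>i. 0 \<le> x $ i \<and> x $ i \<le> 1 \<Longrightarrow> (box_measure \<epsilon> x, sphere_measure) \<in> neutral_charges" and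
    var: "\<And>\<epsilon> (x :: real^'n). 0 < \<epsilon> \<Longrightarrow> \<epsilon> \<le> 1 \<Longrightarrow> \<forall>i. 0 \<le> x $ i \<and> x $ i \<le> 1 \<Longrightarrow>
      log_cov (box_measure \<epsilon> x, sphere_measure) (box_measure \<epsilon> x, sphere_measure) \<le> ln (1 / \<epsilon>) + C"
    using box_charge[OF card2] by blast
  define S where "S n = (lattice_cube (1 / real n) :: (real^'n) set)" for n :: nat
  define V where "V n = crossing_sets k (1 / real n)" for n :: nat
  define H where "H n x \<omega> = box_average (h \<omega>) (1 / real n) x" for n :: nat and x \<omega>
  have H_eq: "H n x \<omega> = h \<omega> (box_measure (1 / real n) x, sphere_measure)" for n x \<omega>
    by (simp add: H_def box_average_def pairing_def box_measure_def axis_cube_def)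
  have S_charge: "(box_measure (1 / real n) x, sphere_measure) \<in> neutral_charges" if "0 < n" "x \<in> S n" for n x
    using that by (intro charge) (auto simp: S_def lattice_cube_def)
  interpret F: gaussian_fpp M "CARD('n)" S V H C
  proof (rule gaussian_fpp.intro[OF M], unfold_locales)
    fix n :: nat assume n: "0 < n"
    show "finite (S n)" "card (S n) \<le> (n + 1) ^ CARD('n)"
      using lattice_cube_finite_card[OF n] by (simp_all add: S_def)
    show "\<exists>A\<in>V n. card A \<le> n + 1" unfolding V_def by (rule short_crossing[OF n])
    show "A \<subseteq> S n" "A \<noteq> {}" if "A \<in> V n" for A
      using that crossing_sets_subset crossing_sets_nonempty unfolding V_def S_def by blast+
    show "centered_gaussian M (\<lambda>\<omega>. \<Sum>x\<in>S n. c x * H n x \<omega>)" for c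
      unfolding H_eq using S_charge[OF n] \<open>finite (S n)\<close>
      by (intro gaussian_process_reindex[OF gp, where q = "\<lambda>x. (box_measure (1 / real n) x, sphere_measure)"]) auto
    fix x assume x: "x \<in> S n"
    have "(\<integral>\<omega>. (H n x \<omega>)\<^sup>2 \<partial>M) = log_cov (box_measure (1 / real n) x, sphere_measure) (box_measure (1 / real n) x, sphere_measure)"
      unfolding H_eq power2_eq_square using S_charge[OF n x] by (intro cov)
    also have "\<dots> \<le> ln (1 / (1 / real n)) + C"
      using n x by (intro var) (auto simp: S_def lattice_cube_def)
    finally show "(\<integral>\<omega>. (H n x \<omega>)\<^sup>2 \<partial>M) \<le> ln (real n) + C" by simp
  qed
  have crossing: "crossing_prob M h k \<xi> \<alpha> (1 / real n) = measure M (F.fpp_event n \<xi> (real n powr - \<alpha>))" if n: "0 < n" for \<xi> \<alpha> n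
  proof -
    have "(1 / real n) powr \<alpha> = real n powr - \<alpha>" using n by (simp add: powr_minus powr_divide inverse_eq_divide)
    then show ?thesis
      using lfpp_set_dist_le_iff[OF n refl, of "real n powr - \<alpha>" _ \<xi> k]
      by (simp add: crossing_prob_def F.fpp_event_def F.cost_def V_def H_def)
  qed
  have exponent: "lfpp_exponent M h k \<xi> = ereal (F.exponent \<xi>)" for \<xi>
  proof -
    have "liminf (\<lambda>n. ereal (crossing_prob M h k \<xi> \<alpha> (1 / real n))) = 1 \<longleftrightarrow> \<alpha> \<in> F.good \<xi>" for \<alpha>
    proof -
      have "liminf (\<lambda>n. ereal (crossing_prob M h k \<xi> \<alpha> (1 / real n))) = 1 \<longleftrightarrow> (\<lambda>n. crossing_prob M h k \<xi> \<alpha> (1 / real n)) \<longlonglongrightarrow> 1"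
        by (rule liminf_eq_1_iff) (simp add: crossing_prob_def)
      also have "\<dots> \<longleftrightarrow> (\<lambda>n. measure M (F.fpp_event n \<xi> (real n powr - \<alpha>))) \<longlonglongrightarrow> 1"
        by (rule tendsto_cong) (use eventually_gt_at_top[of 0] in eventually_elim, rule crossing)
      finally show ?thesis by (simp add: F.good_def)
    qed
    then show ?thesis by (simp add: lfpp_exponent_def F.ereal_exponent)
  qed
  have lam: "lam = F.exponent" by (simp add: lam_def exponent)
  have AE_diff: "AE \<xi> in lborel. lam differentiable (at \<xi>)"
    unfolding lam by (rule lipschitz_AE_differentiable[OF F.exponent_lipschitz])
  have "AE \<xi> in lborel. \<xi> \<ge> 0 \<longrightarrow>
       max (- \<xi>) (1 / \<xi> * (lam \<xi> - 1)) \<le> deriv lam \<xi> \<and>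
       deriv lam \<xi> \<le> sqrt (2 * (d - 1) + 2 * lam \<xi> + \<xi>\<^sup>2) - \<xi>"
    using AE_diff AE_lborel_singleton[of 0]
  proof eventually_elim
    case (elim \<xi>)
    have "(F.exponent has_real_derivative deriv lam \<xi>) (at \<xi>)"
      using elim(1) unfolding lam by (simp add: DERIV_deriv_iff_real_differentiable)
    then show ?case
      using F.exponent_deriv_bounds[of "deriv lam \<xi>" \<xi>] elim(2) by (auto simp: lam d_def)
  qed
  then have "AE \<xi> in lebesgue. \<xi> \<ge> 0 \<longrightarrow>
       max (- \<xi>) (1 / \<xi> * (lam \<xi> - 1)) \<le> deriv lam \<xi> \<and>
       deriv lam \<xi> \<le> sqrt (2 * (d - 1) + 2 * lam \<xi> + \<xi>\<^sup>2) - \<xi>"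
    by (rule AE_completion)
  moreover have "AE \<xi> in lebesgue. \<xi> \<ge> 0 \<longrightarrow> lam differentiable (at \<xi>)"
    using AE_completion[OF AE_diff] by eventually_elim simp
  moreover have "(sqrt (2 * d))-lipschitz_on {0..} lam"
    unfolding lam d_def by (rule lipschitz_on_subset[OF F.exponent_lipschitz]) simp
  moreover have "\<forall>\<xi>\<ge>0. \<bar>lfpp_exponent M h k \<xi>\<bar> \<noteq> \<infinity>" by (simp add: exponent)
  ultimately show ?thesis by blast
qed

end
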